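(* Let $\phi$ be a finite-range repulsive pair potential on $\mathbb{R}^d$ and suppose the Gibbs point processes with potential $\phi$ exhibit strong spatial mixing on $\mathbb{R}^d$ with activities bounded by $\lambda$. Then there exists $L_0>0$ such that for all $L\ge L_0$, all $n$ and all activity functions $\boldsymbol{\lambda}$ bounded by $\lambda$ and supported on $\Lambda_n=[-n,n]^d$, the block dynamics with update radius $L$ for $\mu_{\Lambda_n,\boldsymbol{\lambda}}$ has mixing time $\tau_{\mathrm{mix}}(\varepsilon)=O(N\log(N/\varepsilon))$, where $N=|\Lambda_n|$.
   Context: $\phi$ symmetric, $\phi\ge0$, $\phi(x)=0$ for $\|x\|>r$; $H=\sum_{i<j}\phi(x_i-x_j)$. For a bounded, boundedly supported activity function $\boldsymbol{\lambda}\ge0$, $\mu_{\boldsymbol{\lambda}}$ is the Gibbs point process with density $\prod\boldsymbol{\lambda}(x_i)e^{-H}/Z(\boldsymbol{\lambda})$ w.r.t. the Poisson process; $\mu_{\Lambda_n,\boldsymbol{\lambda}}=\mu_{\boldsymbol{\lambda}}$ for $\boldsymbol{\lambda}$ supported in $\Lambda_n$. Strong spatial mixing with activities bounded by $\lambda$: there exist $\alpha,\beta>0$ so that for all bounded measurable $\Lambda$ and activity functions $\boldsymbol{\lambda},\boldsymbol{\lambda}'\le\lambda$, the total variation distance between the restrictions to $\Lambda$ of $\mu_{\boldsymbol{\lambda}}$ and $\mu_{\boldsymbol{\lambda}'}$ is at most $\alpha|\Lambda|e^{-\beta\,\mathrm{dist}(\Lambda,\supp(\boldsymbol{\lambda}-\boldsymbol{\lambda}'))}$.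 Block dynamics with radius $L$: from $X_t\subset\Lambda_n$ pick $y\in\Lambda_n$ uniformly, and resample the points in $B_L(y)$ from the process with density $\exp(-\sum_{i<j}\phi(x_i-x_j)-\sum_i\sum_{x\in X_t\setminus B_L(y)}\phi(x_i-x))$ against the Poisson process of intensity $\boldsymbol{\lambda}$ on $B_L(y)$. Mixing time $\tau_{\mathrm{mix}}(\varepsilon)=\sup_{\mu_0}\min\{j:\|\mu_j-\mu_{\Lambda_n,\boldsymbol{\lambda}}\|_{TV}<\varepsilon\}$. *)

theory Defs
  imports "HOL-Probability.Probability"
begin

text \<open>Finite point configurations in a Euclidean space are represented as lists of points;
  all events used below for distances between laws are permutation invariant, so only the
  law of the underlying (multi)set of points matters.\<close>

definition list_of_fun :: "nat \<Rightarrow> (nat \<Rightarrow> 'a) \<Rightarrow> 'a list" where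
  "list_of_fun k x = map x [0..<k]"

definition config_sets :: "'a::euclidean_space list set set" where
  "config_sets = {A. \<forall>k. list_of_fun k -` A \<inter> space (PiM {..<k} (\<lambda>_. (lborel::'a measure)))
                         \<in> sets (PiM {..<k} (\<lambda>_. (lborel::'a measure)))}"

definition configM :: "'a::euclidean_space list measure" where
  "configM = sigma UNIV config_sets"

definition poisson_pp :: "('a::euclidean_space \<Rightarrow> real) \<Rightarrow> 'a list measure" where
  "poisson_pp lam = measure_of UNIV config_sets
     (\<lambda>A. \<Sum>k. ennreal (exp (- (\<integral>x. lam x \<partial>lborel)) / fact k) *
        emeasure (PiM {..<k} (\<lambda>_. density lborel (\<lambda>x. ennreal (lam x))))
                 (list_of_fun k -` A \<inter> space (PiM {..<k} (\<lambda>_. (lborel::'a measure)))))"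

text \<open>exp(-t) for t in [0,\<infinity>], with exp(-\<infinity>) = 0 (hard-core interactions allowed).\<close>
definition expneg :: "ereal \<Rightarrow> real" where
  "expneg t = (if t = \<infinity> then 0 else exp (- real_of_ereal t))"

definition hamiltonian :: "('a::ab_group_add \<Rightarrow> ereal) \<Rightarrow> 'a list \<Rightarrow> ereal" where
  "hamiltonian phi xs = (\<Sum>(i,j)\<in>{(i,j). i < j \<and> j < length xs}. phi (xs ! i - xs ! j))"

definition interaction :: "('a::ab_group_add \<Rightarrow> ereal) \<Rightarrow> 'a list \<Rightarrow> 'a list \<Rightarrow> ereal" where
  "interaction phi ys zs = (\<Sum>i<length ys. \<Sum>j<length zs. phi (ys ! i - zs ! j))"

definition gibbs_bc :: "('a::euclidean_space \<Rightarrow> ereal) \<Rightarrow> ('a \<Rightarrow> real) \<Rightarrow> 'a list \<Rightarrow> 'a list measure" where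
  "gibbs_bc phi lam zs =
     (let w = (\<lambda>ys. expneg (hamiltonian phi ys + interaction phi ys zs));
          Z = (\<integral>ys. w ys \<partial>poisson_pp lam)
      in density (poisson_pp lam) (\<lambda>ys. ennreal (w ys / Z)))"

definition gibbs :: "('a::euclidean_space \<Rightarrow> ereal) \<Rightarrow> ('a \<Rightarrow> real) \<Rightarrow> 'a list measure" where
  "gibbs phi lam = gibbs_bc phi lam []"

definition sym_event :: "'a list set \<Rightarrow> bool" where
  "sym_event A \<longleftrightarrow> (\<forall>xs ys. mset xs = mset ys \<longrightarrow> (xs \<in> A \<longleftrightarrow> ys \<in> A))"

definition tv_dist :: "'a::euclidean_space list measure \<Rightarrow> 'a list measure \<Rightarrow> real" where
  "tv_dist M N = (SUP A \<in> {A \<in> sets configM. sym_event A}. \<bar>measure M A - measure N A\<bar>)"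

definition restrict_config :: "'a::euclidean_space set \<Rightarrow> 'a list measure \<Rightarrow> 'a list measure" where
  "restrict_config \<Lambda> M = distr M configM (filter (\<lambda>x. x \<in> \<Lambda>))"

definition activity_fn :: "real \<Rightarrow> ('a::euclidean_space \<Rightarrow> real) \<Rightarrow> bool" where
  "activity_fn lmax lam \<longleftrightarrow> lam \<in> borel_measurable lborel \<and> (\<forall>x. 0 \<le> lam x \<and> lam x \<le> lmax)
     \<and> bounded {x. lam x \<noteq> 0}"

definition finite_range_repulsive :: "('a::euclidean_space \<Rightarrow> ereal) \<Rightarrow> bool" where
  "finite_range_repulsive phi \<longleftrightarrow> phi \<in> borel_measurable borel \<and> (\<forall>x. phi (- x) = phi x)
     \<and> (\<forall>x. 0 \<le> phi x) \<and> (\<exists>r>0. \<forall>x. norm x > r \<longrightarrow> phi x = 0)"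

definition strong_spatial_mixing :: "('a::euclidean_space \<Rightarrow> ereal) \<Rightarrow> real \<Rightarrow> bool" where
  "strong_spatial_mixing phi lmax \<longleftrightarrow> (\<exists>\<alpha>>0. \<exists>\<beta>>0. \<forall>\<Lambda> lam lam'.
     \<Lambda> \<in> sets lborel \<and> bounded \<Lambda> \<and> activity_fn lmax lam \<and> activity_fn lmax lam' \<longrightarrow>
     tv_dist (restrict_config \<Lambda> (gibbs phi lam)) (restrict_config \<Lambda> (gibbs phi lam'))
       \<le> \<alpha> * measure lborel \<Lambda> * exp (- \<beta> * setdist \<Lambda> {x. lam x \<noteq> lam' x}))"

definition box_n :: "nat \<Rightarrow> 'a::euclidean_space set" where
  "box_n n = cbox (- (real n *\<^sub>R One)) (real n *\<^sub>R One)"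

definition block_kernel :: "('a::euclidean_space \<Rightarrow> ereal) \<Rightarrow> ('a \<Rightarrow> real) \<Rightarrow> 'a set \<Rightarrow> real
     \<Rightarrow> 'a list \<Rightarrow> 'a list measure" where
  "block_kernel phi lam Lam L X =
     bind (uniform_measure lborel Lam) (\<lambda>y.
       distr (gibbs_bc phi (\<lambda>x. indicator (ball y L) x * lam x) (filter (\<lambda>x. x \<notin> ball y L) X))
             configM (\<lambda>ys. filter (\<lambda>x. x \<notin> ball y L) X @ ys))"

definition chain_dist :: "('a::euclidean_space \<Rightarrow> ereal) \<Rightarrow> ('a \<Rightarrow> real) \<Rightarrow> 'a set \<Rightarrow> real
     \<Rightarrow> 'a list measure \<Rightarrow> nat \<Rightarrow> 'a list measure" where
  "chain_dist phi lam Lam L \<mu>0 j = ((\<lambda>\<mu>. bind \<mu> (block_kernel phi lam Lam L)) ^^ j) \<mu>0"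

end

theory Submission
  imports Defs
begin

text \<open>
  Path coupling, in dual form. Cut space into unit cells and measure a symmetric function \<open>f\<close> of the
  configuration by its largest oscillation \<open>\<delta>\<close> under changes inside a single cell. Applying one block
  update to two configurations that disagree only in the cell of \<open>z\<close>: if the ball covers the cell, the
  updates have the same law and the disagreement disappears; if the ball is farther than the range of
  the potential, the resampled law is the same and the difference is at most \<open>\<delta>\<close>; in the remaining shell
  of centres the difference is at most \<open>D \<delta>\<close>, where \<open>D\<close> counts the cells at distance at most \<open>R\<close>
  from \<open>z\<close> plus an exponentially small contribution from strong spatial mixing. Strong spatial mixing
  applies to boundary conditions because, for a repulsive potential, these only lower the activity.
  The shell has relative volume \<open>O(1/L)\<close>, so for large \<open>L\<close> a step contracts the oscillation by
  \<open>1 - 1/(2N)\<close>. As a function on the box depends on \<open>O(N)\<close> cells, whatever the number of points in the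
  initial configuration, and the Gibbs law is invariant, \<open>O(N log(N/\<epsilon>))\<close> steps suffice.
\<close>

section \<open>Measurability of configuration maps\<close>

text \<open>Working with functions means that no joint law of two chains has to be built: it is
  enough that the expected value \<open>kop f\<close> of \<open>f\<close> after one update
  oscillates less than \<open>f\<close>. Let p and q be the probabilities that the centre falls into
  the inner and the outer ball around the disagreement. The oscillation is multiplied by at most 1 -
  q + D (q - p). The inner ball meets the box in volume at least 1, so p >= 1/N; if D (q - p) <=
  p/2, then 1 - p/2 remains. The obstacle is the size of D: resampling a ball may affect order L^d
  cells, far too many for a shell of relative volume O(1/L). Hence the second radius R, which leaves
  only order R^d cells uncontrolled. The mixing error for the other cells has to be multiplied by
  \<delta>, not added to it, since an additive error would stop the contraction at a positive level.
  Boundary points \<open>zs\<close> act on each new point separately: they multiply the activity at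
  x by \<open>field zs x\<close>, a number between 0 and 1. So the conditional law is again a Gibbs
  law with an admissible activity.\<close>

lemma sigma_algebra_config_sets:
  "sigma_algebra UNIV (config_sets :: 'a::euclidean_space list set set)"
  unfolding sigma_algebra_iff2
proof (intro conjI ballI allI impI)
  show "(config_sets :: 'a list set set) \<subseteq> Pow UNIV" by simp
  show "({} :: 'a list set) \<in> config_sets" by (simp add: config_sets_def)
next
  fix s :: "'a list set" assume s: "s \<in> config_sets"
  have eq: "list_of_fun k -` (UNIV - s) \<inter> space (PiM {..<k} (\<lambda>_. (lborel::'a measure)))
     = space (PiM {..<k} (\<lambda>_. (lborel::'a measure)))
       - list_of_fun k -` s \<inter> space (PiM {..<k} (\<lambda>_. (lborel::'a measure)))" for k
    by auto
  show "UNIV - s \<in> config_sets"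
    using s unfolding config_sets_def by (simp add: eq sets.compl_sets del: vimage_Diff)
next
  fix A :: "nat \<Rightarrow> 'a list set" assume A: "range A \<subseteq> config_sets"
  have eq: "list_of_fun k -` (\<Union>i. A i) \<inter> space (PiM {..<k} (\<lambda>_. (lborel::'a measure)))
     = (\<Union>i. list_of_fun k -` A i \<inter> space (PiM {..<k} (\<lambda>_. (lborel::'a measure))))" for k
    by auto
  have "list_of_fun k -` A i \<inter> space (PiM {..<k} (\<lambda>_. (lborel::'a measure)))
      \<in> sets (PiM {..<k} (\<lambda>_. (lborel::'a measure)))" for i k
    using A by (auto simp: config_sets_def)
  then show "\<Union> (range A) \<in> config_sets"
    unfolding config_sets_def by (simp only: mem_Collect_eq eq) blast
qed

lemma sets_configM: "sets (configM :: 'a::euclidean_space list measure) = config_sets"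
  unfolding configM_def by (rule sigma_algebra.sets_measure_of_eq[OF sigma_algebra_config_sets])

lemma space_configM [simp]: "space (configM :: 'a::euclidean_space list measure) = UNIV"
  unfolding configM_def by (simp add: space_measure_of_conv)

lemma measurable_list_of_fun [measurable]:
  "list_of_fun k \<in> measurable (PiM {..<k} (\<lambda>_. lborel)) configM"
  by (rule measurableI) (auto simp: sets_configM config_sets_def)

lemma length_list_of_fun [simp]: "length (list_of_fun k x) = k"
  by (simp add: list_of_fun_def)

lemma list_of_fun_Suc: "list_of_fun (Suc k) x = list_of_fun k x @ [x k]"
  by (simp add: list_of_fun_def)

lemma list_of_fun_0 [simp]: "list_of_fun 0 x = []"
  by (simp add: list_of_fun_def)

lemma list_of_fun_nth: "list_of_fun (length xs) (restrict ((!) xs) {..<length xs}) = xs"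
  by (rule nth_equalityI) (auto simp: list_of_fun_def)

text \<open>\<open>configM\<close> carries the final sigma-algebra of the maps
  \<open>list_of_fun k\<close>, and every list is a value of one of them, so a map can be tested on
  each fixed length.\<close>

lemma measurable_from_configM:
  fixes f :: "'a::euclidean_space list \<Rightarrow> 'b"
  assumes "\<And>k. (\<lambda>x. f (list_of_fun k x)) \<in> measurable (PiM {..<k} (\<lambda>_. lborel)) N"
  shows "f \<in> measurable configM N"
proof (rule measurableI)
  fix xs :: "'a list"
  have "restrict ((!) xs) {..<length xs} \<in> space (PiM {..<length xs} (\<lambda>_. (lborel::'a measure)))"
    by (simp add: space_PiM)
  from measurable_space[OF assms this] show "f xs \<in> space N"
    by (simp add: list_of_fun_nth)
next
  fix A assume A: "A \<in> sets N"
  have "list_of_fun k -` (f -` A) \<inter> space (PiM {..<k} (\<lambda>_. (lborel::'a measure)))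
    \<in> sets (PiM {..<k} (\<lambda>_. (lborel::'a measure)))" for k
    using measurable_sets[OF assms[of k] A] by (simp add: vimage_def)
  then show "f -` A \<inter> space configM \<in> sets configM"
    by (simp add: sets_configM config_sets_def)
qed

lemma measurable_length [measurable]: "length \<in> measurable configM (count_space UNIV)"
  by (rule measurable_from_configM) simp

lemma measurable_nth [measurable]:
  "(\<lambda>xs. xs ! i) \<in> measurable (configM :: 'a::euclidean_space list measure) borel"
proof (rule measurable_from_configM)
  fix k :: nat
  \<comment> \<open>Beyond the end of the list, \<open>!\<close> returns an unspecified value that
    depends on \<open>i - k\<close> only, hence a constant function of \<open>x\<close>.\<close>
  have eq: "list_of_fun k x ! i = (if i < k then x i else [] ! (i - k))" for x :: "nat \<Rightarrow> 'a"
  proof (cases "i < k")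
    case True then show ?thesis by (simp add: list_of_fun_def)
  next
    case False
    have "list_of_fun k x ! i = (list_of_fun k x @ []) ! i" by simp
    also have "\<dots> = [] ! (i - k)" using False by (simp only: nth_append length_list_of_fun if_False)
    finally show ?thesis using False by simp
  qed
  show "(\<lambda>x. list_of_fun k x ! i) \<in> measurable (PiM {..<k} (\<lambda>_. (lborel::'a measure))) borel"
    unfolding eq by (cases "i < k") (simp_all add: measurable_component_singleton)
qed

text \<open>With a parameter \<open>w\<close> the test on fixed lengths is not immediate, because a
  product with a final sigma-algebra is involved. The list \<open>X w\<close> is instead recovered
  from its length, which takes countably many values, and its coordinates.\<close>

lemma measurable_configM_compose:
  assumes X [measurable]: "X \<in> measurable M configM"
    and f: "\<And>k. (\<lambda>p. f (fst p) (list_of_fun k (snd p))) \<in> measurable (M \<Otimes>\<^sub>M PiM {..<k} (\<lambda>_. lborel)) N"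
  shows "(\<lambda>w. f w (X w)) \<in> measurable M N"
proof -
  have "(\<lambda>w. restrict ((!) (X w)) {..<k}) \<in> measurable M (PiM {..<k} (\<lambda>_. (lborel :: 'b measure)))" for k
    by (rule measurable_restrict) (use measurable_compose[OF X measurable_nth] in simp)
  then have pair: "(\<lambda>w. (w, restrict ((!) (X w)) {..<k})) \<in> measurable M (M \<Otimes>\<^sub>M PiM {..<k} (\<lambda>_. (lborel :: 'b measure)))" for k
    by simp
  have "(\<lambda>w. f w (list_of_fun k (restrict ((!) (X w)) {..<k}))) \<in> measurable M N" for k
    using measurable_compose[OF pair f[of k]] by simp
  from measurable_compose_countable[where f = "\<lambda>k w. f w (list_of_fun k (restrict ((!) (X w)) {..<k}))"
      and g = "\<lambda>w. length (X w)", OF this measurable_compose[OF X measurable_length]]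
  have "(\<lambda>w. f w (list_of_fun (length (X w)) (restrict ((!) (X w)) {..<length (X w)}))) \<in> measurable M N" .
  then show ?thesis by (simp add: list_of_fun_nth)
qed

section \<open>Closure of configuration-valued maps under concatenation, filtering and products over
  points\<close>

lemma list_of_fun_append:
  "list_of_fun k x @ list_of_fun l y = list_of_fun (k + l) (\<lambda>i\<in>{..<k+l}. if i < k then x i else y (i - k))"
  by (rule nth_equalityI) (auto simp: list_of_fun_def nth_append)

lemma measurable_component_pair [measurable]:
  assumes "i < k"
  shows "(\<lambda>p. snd p i) \<in> measurable (M \<Otimes>\<^sub>M PiM {..<k} (\<lambda>_. (lborel :: 'a::euclidean_space measure))) borel"
  using measurable_compose[OF measurable_snd measurable_component_singleton[of i "{..<k}" "\<lambda>_. lborel"]] assms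
  by simp

lemma measurable_append [measurable (raw)]:
  assumes X [measurable]: "X \<in> measurable M configM" and Y [measurable]: "Y \<in> measurable M configM"
  shows "(\<lambda>w. X w @ Y w) \<in> measurable M (configM :: 'a::euclidean_space list measure)"
proof (rule measurable_configM_compose[OF X, where f = "\<lambda>w xs. xs @ Y w"])
  fix k :: nat
  show "(\<lambda>p. list_of_fun k (snd p) @ Y (fst p)) \<in> measurable (M \<Otimes>\<^sub>M PiM {..<k} (\<lambda>_. lborel)) configM"
  proof (rule measurable_configM_compose[where X = "\<lambda>p. Y (fst p)" and f = "\<lambda>p ys. list_of_fun k (snd p) @ ys"])
    fix l :: nat
    let ?M = "(M \<Otimes>\<^sub>M PiM {..<k} (\<lambda>_. lborel)) \<Otimes>\<^sub>M PiM {..<l} (\<lambda>_. (lborel :: 'a measure))"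
    have "(\<lambda>p. \<lambda>i\<in>{..<k+l}. if i < k then snd (fst p) i else snd p (i - k)) \<in> measurable ?M (PiM {..<k+l} (\<lambda>_. lborel))"
    proof (rule measurable_restrict)
      fix i assume i: "i \<in> {..<k+l}"
      show "(\<lambda>p. if i < k then snd (fst p) i else snd p (i - k)) \<in> measurable ?M lborel"
      proof (cases "i < k")
        case True
        then have "(\<lambda>p. snd (fst p) i) \<in> measurable ?M lborel"
          using measurable_compose[OF measurable_fst measurable_component_pair[of i k M]] by simp
        then show ?thesis using True by simp
      next
        case False
        then have "(\<lambda>p. snd p (i - k)) \<in> measurable ?M lborel"
          using i measurable_component_pair[of "i - k" l] by simp
        then show ?thesis using False by simp
      qed
    qed
    then show "(\<lambda>p. list_of_fun k (snd (fst p)) @ list_of_fun l (snd p)) \<in> measurable ?M configM"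
      unfolding list_of_fun_append by measurable
  qed simp
qed

lemma measurable_single [measurable (raw)]:
  assumes [measurable]: "f \<in> borel_measurable M"
  shows "(\<lambda>w. [f w]) \<in> measurable M (configM :: 'a::euclidean_space list measure)"
proof -
  have "(\<lambda>w. \<lambda>i\<in>{..<1::nat}. f w) \<in> measurable M (PiM {..<1} (\<lambda>_. (lborel::'a measure)))"
    by (rule measurable_restrict) simp
  from measurable_compose[OF this measurable_list_of_fun] show ?thesis
    by (simp add: list_of_fun_def)
qed

lemma measurable_filter [measurable (raw)]:
  assumes X [measurable]: "X \<in> measurable M configM"
    and P: "Measurable.pred (M \<Otimes>\<^sub>M borel) (\<lambda>(w, x). P w x)"
  shows "(\<lambda>w. filter (P w) (X w)) \<in> measurable M (configM :: 'a::euclidean_space list measure)"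
proof (rule measurable_configM_compose[OF X, where f = "\<lambda>w xs. filter (P w) xs"])
  fix k :: nat
  let ?M = "M \<Otimes>\<^sub>M PiM {..<k} (\<lambda>_. (lborel :: 'a measure))"
  have "(\<lambda>p. filter (P (fst p)) (list_of_fun m (snd p))) \<in> measurable ?M configM" if "m \<le> k" for m
    using that
  proof (induction m)
    case 0 then show ?case by simp
  next
    case (Suc m)
    then have IH [measurable]: "(\<lambda>p. filter (P (fst p)) (list_of_fun m (snd p))) \<in> measurable ?M configM" by simp
    have comp [measurable]: "(\<lambda>p. snd p m) \<in> measurable ?M borel"
      by (rule measurable_component_pair) (use Suc in simp)
    have "(\<lambda>p. (fst p, snd p m)) \<in> measurable ?M (M \<Otimes>\<^sub>M borel)" by measurable
    from measurable_compose[OF this P] have [measurable]: "Measurable.pred ?M (\<lambda>p. P (fst p) (snd p m))"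
      by simp
    have eq: "filter (P (fst p)) (list_of_fun (Suc m) (snd p)) =
      (if P (fst p) (snd p m) then filter (P (fst p)) (list_of_fun m (snd p)) @ [snd p m]
       else filter (P (fst p)) (list_of_fun m (snd p)))" for p
      by (simp add: list_of_fun_Suc)
    show ?case unfolding eq by measurable
  qed
  then show "(\<lambda>p. filter (P (fst p)) (list_of_fun k (snd p))) \<in> measurable ?M configM" by simp
qed

lemma measurable_prod_list [measurable (raw)]:
  fixes F :: "'b \<Rightarrow> 'a::euclidean_space \<Rightarrow> real"
  assumes X [measurable]: "X \<in> measurable M configM"
    and F: "(\<lambda>(w, x). F w x) \<in> borel_measurable (M \<Otimes>\<^sub>M borel)"
  shows "(\<lambda>w. \<Prod>x\<leftarrow>X w. F w x) \<in> borel_measurable M"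
proof (rule measurable_configM_compose[OF X, where f = "\<lambda>w xs. \<Prod>x\<leftarrow>xs. F w x"])
  fix k :: nat
  let ?M = "M \<Otimes>\<^sub>M PiM {..<k} (\<lambda>_. (lborel :: 'a measure))"
  have "(\<lambda>p. \<Prod>x\<leftarrow>list_of_fun m (snd p). F (fst p) x) \<in> borel_measurable ?M" if "m \<le> k" for m
    using that
  proof (induction m)
    case 0 then show ?case by simp
  next
    case (Suc m)
    then have IH [measurable]: "(\<lambda>p. \<Prod>x\<leftarrow>list_of_fun m (snd p). F (fst p) x) \<in> borel_measurable ?M" by simp
    have comp [measurable]: "(\<lambda>p. snd p m) \<in> measurable ?M borel"
      by (rule measurable_component_pair) (use Suc in simp)
    have "(\<lambda>p. (fst p, snd p m)) \<in> measurable ?M (M \<Otimes>\<^sub>M borel)" by measurable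
    from measurable_compose[OF this F] have [measurable]: "(\<lambda>p. F (fst p) (snd p m)) \<in> borel_measurable ?M"
      by simp
    show ?case unfolding list_of_fun_Suc by simp
  qed
  then show "(\<lambda>p. \<Prod>x\<leftarrow>list_of_fun k (snd p). F (fst p) x) \<in> borel_measurable ?M" by simp
qed

lemma pred_list_all [measurable (raw)]:
  fixes X :: "'b \<Rightarrow> 'a::euclidean_space list"
  assumes X [measurable]: "X \<in> measurable M configM"
    and P [measurable]: "Measurable.pred (M \<Otimes>\<^sub>M borel) (\<lambda>(w, x). P w x)"
  shows "Measurable.pred M (\<lambda>w. \<forall>x\<in>set (X w). P w x)"
proof -
  \<comment> \<open>The quantifier becomes the non-vanishing of a product of zeros and ones, so the
    induction on the length is inherited from products.\<close>
  have "(\<forall>x\<in>set xs. Q x) \<longleftrightarrow> (\<Prod>x\<leftarrow>xs. if Q x then 1 else 0) \<noteq> (0::real)" for xs :: "'a list" and Q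
    by (induction xs) simp_all
  then have eq: "(\<forall>x\<in>set (X w). P w x) \<longleftrightarrow> (\<Prod>x\<leftarrow>X w. if P w x then 1 else 0) \<noteq> (0::real)" for w .
  have "(\<lambda>(w, x). if P w x then 1 else 0 :: real) \<in> borel_measurable (M \<Otimes>\<^sub>M borel)"
    unfolding case_prod_beta using P by measurable
  from measurable_prod_list[OF X this] have [measurable]: "(\<lambda>w. \<Prod>x\<leftarrow>X w. if P w x then 1 else 0 :: real) \<in> borel_measurable M" .
  show ?thesis unfolding eq by simp
qed

section \<open>The Lebesgue-Poisson measure\<close>

definition vol :: "'a::euclidean_space measure \<Rightarrow> nat \<Rightarrow> 'a list measure" where
  "vol M k = distr (PiM {..<k} (\<lambda>_. M)) configM (list_of_fun k)"

lemma sets_vol [simp, measurable_cong]: "sets (vol M k) = sets configM"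
  by (simp add: vol_def)

lemma space_vol [simp]: "space (vol M k) = UNIV"
  by (simp add: vol_def)

lemma measurable_list_of_fun':
  assumes "sets M = sets borel"
  shows "list_of_fun k \<in> measurable (PiM {..<k} (\<lambda>_. M)) (configM :: 'a::euclidean_space list measure)"
proof -
  have "sets (PiM {..<k} (\<lambda>_. M)) = sets (PiM {..<k} (\<lambda>_. (lborel :: 'a measure)))"
    by (rule sets_PiM_cong) (simp_all add: assms)
  with measurable_list_of_fun[where ?'a='a, of k] show ?thesis
    by (auto simp: measurable_def space_PiM sets_eq_imp_space_eq[OF assms])
qed

text \<open>Two base measures are needed: Lebesgue measure, and Lebesgue measure with density
  \<open>lam\<close>, which is the one inside \<open>poisson_pp\<close>.\<close>

locale borel_base = sigma_finite_measure M for M :: "'a::euclidean_space measure" +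
  assumes sets_M [measurable_cong]: "sets M = sets borel"
begin

lemma nn_integral_vol_0:
  assumes [measurable]: "f \<in> borel_measurable configM"
  shows "(\<integral>\<^sup>+xs. f xs \<partial>vol M 0) = f []"
proof -
  interpret product_sigma_finite "\<lambda>_::nat. M" by standard
  show ?thesis
    using measurable_list_of_fun'[OF sets_M, of 0]
    by (simp add: vol_def nn_integral_distr nn_integral_empty del: nn_integral_const)
qed

lemma measurable_snoc_integral [measurable]:
  assumes [measurable]: "f \<in> borel_measurable configM"
  shows "(\<lambda>xs. \<integral>\<^sup>+x. f (xs @ [x]) \<partial>M) \<in> borel_measurable configM"
  by (rule borel_measurable_nn_integral) measurable

text \<open>The last point is split off by Fubini. Integrals over k points are computed by induction
  with this recursion.\<close>

lemma nn_integral_vol_Suc: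
  assumes f [measurable]: "f \<in> borel_measurable configM"
  shows "(\<integral>\<^sup>+xs. f xs \<partial>vol M (Suc k)) = (\<integral>\<^sup>+xs. (\<integral>\<^sup>+x. f (xs @ [x]) \<partial>M) \<partial>vol M k)"
proof -
  interpret product_sigma_finite "\<lambda>_::nat. M" by standard
  note [measurable] = measurable_list_of_fun'[OF sets_M]
  have ins: "insert k {..<k} = {..<Suc k}" by (simp add: lessThan_Suc)
  have m: "(\<lambda>x. f (list_of_fun (Suc k) x)) \<in> borel_measurable (PiM {..<Suc k} (\<lambda>_. M))" by measurable
  have upd: "list_of_fun k (x(k := y)) = list_of_fun k x" for x and y :: 'a
    by (simp add: list_of_fun_def)
  have "(\<integral>\<^sup>+xs. f xs \<partial>vol M (Suc k)) = (\<integral>\<^sup>+x. f (list_of_fun (Suc k) x) \<partial>PiM (insert k {..<k}) (\<lambda>_. M))"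
    unfolding vol_def ins by (rule nn_integral_distr) measurable
  also have "\<dots> = (\<integral>\<^sup>+x. (\<integral>\<^sup>+y. f (list_of_fun (Suc k) (x(k := y))) \<partial>M) \<partial>PiM {..<k} (\<lambda>_. M))"
    by (rule product_nn_integral_insert) (use m ins in auto)
  also have "\<dots> = (\<integral>\<^sup>+x. (\<integral>\<^sup>+y. f (list_of_fun k x @ [y]) \<partial>M) \<partial>PiM {..<k} (\<lambda>_. M))"
    by (simp add: list_of_fun_Suc upd)
  also have "\<dots> = (\<integral>\<^sup>+xs. (\<integral>\<^sup>+x. f (xs @ [x]) \<partial>M) \<partial>vol M k)"
    unfolding vol_def by (rule nn_integral_distr[symmetric]) measurable
  finally show ?thesis .
qed

end

lemma borel_base_density:
  fixes lam :: "'a::euclidean_space \<Rightarrow> real"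
  assumes [measurable]: "lam \<in> borel_measurable borel"
  shows "borel_base (density lborel (\<lambda>x. ennreal (lam x)))"
proof -
  have "sigma_finite_measure (density lborel (\<lambda>x. ennreal (lam x)))"
    by (subst sigma_finite_measure.sigma_finite_iff_density_finite[OF lborel.sigma_finite_measure_axioms]) auto
  then show ?thesis unfolding borel_base_def borel_base_axioms_def by simp
qed

interpretation lborel_base: borel_base lborel
  unfolding borel_base_def borel_base_axioms_def
  using lborel.sigma_finite_measure_axioms by simp

lemma prod_list_nonneg: "(\<And>x. x \<in> set xs \<Longrightarrow> 0 \<le> g x) \<Longrightarrow> 0 \<le> (\<Prod>x\<leftarrow>xs. g x :: real)"
  by (induction xs) auto

lemma nn_integral_vol_density:
  fixes lam :: "'a::euclidean_space \<Rightarrow> real"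
  assumes [measurable]: "lam \<in> borel_measurable borel" and nn: "\<And>x. 0 \<le> lam x"
  assumes "f \<in> borel_measurable configM"
  shows "(\<integral>\<^sup>+xs. f xs \<partial>vol (density lborel (\<lambda>x. ennreal (lam x))) k)
    = (\<integral>\<^sup>+xs. ennreal (\<Prod>x\<leftarrow>xs. lam x) * f xs \<partial>vol lborel k)"
  using assms(3)
proof (induction k arbitrary: f)
  case 0
  interpret D: borel_base "density lborel (\<lambda>x. ennreal (lam x))" by (rule borel_base_density) measurable
  show ?case using 0 by (simp add: D.nn_integral_vol_0 lborel_base.nn_integral_vol_0)
next
  case (Suc k)
  note [measurable] = Suc.prems
  interpret D: borel_base "density lborel (\<lambda>x. ennreal (lam x))" by (rule borel_base_density) measurable
  have "(\<integral>\<^sup>+xs. f xs \<partial>vol (density lborel (\<lambda>x. ennreal (lam x))) (Suc k))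
    = (\<integral>\<^sup>+xs. (\<integral>\<^sup>+x. ennreal (lam x) * f (xs @ [x]) \<partial>lborel) \<partial>vol (density lborel (\<lambda>x. ennreal (lam x))) k)"
    by (subst D.nn_integral_vol_Suc) (auto simp: nn_integral_density)
  also have "\<dots> = (\<integral>\<^sup>+xs. ennreal (\<Prod>x\<leftarrow>xs. lam x) * (\<integral>\<^sup>+x. ennreal (lam x) * f (xs @ [x]) \<partial>lborel) \<partial>vol lborel k)"
    by (rule Suc.IH) measurable
  also have "\<dots> = (\<integral>\<^sup>+xs. (\<integral>\<^sup>+x. ennreal (\<Prod>x\<leftarrow>xs @ [x]. lam x) * f (xs @ [x]) \<partial>lborel) \<partial>vol lborel k)"
    by (subst nn_integral_cmult[symmetric])
       (auto simp: ennreal_mult nn prod_list_nonneg mult.assoc intro!: nn_integral_cong)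
  also have "\<dots> = (\<integral>\<^sup>+xs. ennreal (\<Prod>x\<leftarrow>xs. lam x) * f xs \<partial>vol lborel (Suc k))"
    by (rule lborel_base.nn_integral_vol_Suc[symmetric]) measurable
  finally show ?case .
qed

lemma nn_integral_vol_prod_list:
  fixes g :: "'a::euclidean_space \<Rightarrow> real"
  assumes [measurable]: "g \<in> borel_measurable borel" and nn: "\<And>x. 0 \<le> g x"
  shows "(\<integral>\<^sup>+xs. ennreal (\<Prod>x\<leftarrow>xs. g x) \<partial>vol lborel k) = (\<integral>\<^sup>+x. g x \<partial>lborel) ^ k"
proof (induction k)
  case 0 then show ?case by (subst lborel_base.nn_integral_vol_0) auto
next
  case (Suc k)
  have "(\<integral>\<^sup>+xs. ennreal (\<Prod>x\<leftarrow>xs. g x) \<partial>vol lborel (Suc k))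
    = (\<integral>\<^sup>+xs. (\<integral>\<^sup>+x. ennreal (\<Prod>x\<leftarrow>xs. g x) * ennreal (g x) \<partial>lborel) \<partial>vol lborel k)"
    by (subst lborel_base.nn_integral_vol_Suc) (auto simp: ennreal_mult nn prod_list_nonneg)
  also have "\<dots> = (\<integral>\<^sup>+xs. ennreal (\<Prod>x\<leftarrow>xs. g x) * (\<integral>\<^sup>+x. g x \<partial>lborel) \<partial>vol lborel k)"
    by (subst nn_integral_cmult) auto
  also have "\<dots> = (\<integral>\<^sup>+x. g x \<partial>lborel) ^ Suc k"
    by (subst nn_integral_multc) (auto simp: Suc mult.commute)
  finally show ?case .
qed

text \<open>A reference measure that does not depend on the activity: Poisson and Gibbs laws for all
  activities become densities against it and can be compared.\<close>

definition lebesgue_poisson :: "'a::euclidean_space list measure" where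
  "lebesgue_poisson = measure_of UNIV (sets configM)
     (\<lambda>A. \<Sum>k. ennreal (1 / fact k) * emeasure (vol lborel k) A)"

lemma sets_lebesgue_poisson [simp, measurable_cong]: "sets lebesgue_poisson = sets configM"
  unfolding lebesgue_poisson_def
  using sets.sigma_sets_eq[of "configM :: 'a list measure"] sets.space_closed[of "configM :: 'a list measure"]
  by (simp add: sets_measure_of_conv)

lemma space_lebesgue_poisson [simp]: "space lebesgue_poisson = UNIV"
  unfolding lebesgue_poisson_def by (simp add: space_measure_of_conv)

lemma emeasure_lebesgue_poisson:
  assumes A: "A \<in> sets (configM :: 'a::euclidean_space list measure)"
  shows "emeasure lebesgue_poisson A = (\<Sum>k. ennreal (1 / fact k) * emeasure (vol lborel k) A)"
proof (rule emeasure_measure_of[OF lebesgue_poisson_def])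
  show "sets (configM :: 'a list measure) \<subseteq> Pow UNIV" by simp
  show "A \<in> sets lebesgue_poisson" using A by simp
  show "positive (sets lebesgue_poisson) (\<lambda>A. \<Sum>k. ennreal (1 / fact k) * emeasure (vol (lborel :: 'a measure) k) A)"
    by (simp add: positive_def)
  show "countably_additive (sets lebesgue_poisson) (\<lambda>A. \<Sum>k. ennreal (1 / fact k) * emeasure (vol (lborel :: 'a measure) k) A)"
    unfolding countably_additive_def
  proof (intro allI impI)
    fix B :: "nat \<Rightarrow> 'a list set"
    assume B: "range B \<subseteq> sets lebesgue_poisson" "disjoint_family B"
    have "(\<Sum>i. \<Sum>k. ennreal (1 / fact k) * emeasure (vol lborel k) (B i))
        = (\<integral>\<^sup>+k. (\<Sum>i. ennreal (1 / fact k) * emeasure (vol lborel k) (B i)) \<partial>count_space UNIV)"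
      by (subst nn_integral_suminf) (auto simp: nn_integral_count_space_nat)
    also have "\<dots> = (\<integral>\<^sup>+k. ennreal (1 / fact k) * emeasure (vol lborel k) (\<Union>(range B)) \<partial>count_space UNIV)"
      using B by (intro nn_integral_cong) (simp add: suminf_emeasure)
    finally show "(\<Sum>i. \<Sum>k. ennreal (1 / fact k) * emeasure (vol lborel k) (B i))
       = (\<Sum>k. ennreal (1 / fact k) * emeasure (vol lborel k) (\<Union>(range B)))"
      by (simp add: nn_integral_count_space_nat)
  qed
qed

text \<open>Induction over measurable functions, starting from indicators. In the limit step the
  series over k is read as an integral over counting measure, so that monotone convergence exchanges
  it with the supremum.\<close>

lemma nn_integral_lebesgue_poisson:
  assumes "f \<in> borel_measurable (configM :: 'a::euclidean_space list measure)"
  shows "(\<integral>\<^sup>+xs. f xs \<partial>lebesgue_poisson) = (\<Sum>k. ennreal (1 / fact k) * (\<integral>\<^sup>+xs. f xs \<partial>vol lborel k))"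
  using assms
proof (induction rule: borel_measurable_induct)
  case (cong f g)
  then have "f = g" by auto
  then show ?case using cong by simp
next
  case (set A)
  then show ?case by (simp add: emeasure_lebesgue_poisson)
next
  case (mult u c)
  note [measurable] = mult(2)
  have "(\<Sum>k. ennreal (1 / fact k) * (c * (\<integral>\<^sup>+xs. u xs \<partial>vol lborel k)))
     = c * (\<Sum>k. ennreal (1 / fact k) * (\<integral>\<^sup>+xs. u xs \<partial>vol lborel k))"
    by (subst ennreal_suminf_cmult[symmetric]) (simp add: mult_ac)
  then show ?case using mult by (simp add: nn_integral_cmult)
next
  case (add u v)
  note [measurable] = add(1) add(4)
  show ?case using add
    by (simp add: nn_integral_add distrib_left suminf_add[symmetric])
next
  case (seq U)
  note [measurable] = seq(1)
  have "(\<integral>\<^sup>+xs. (SUP i. U i) xs \<partial>lebesgue_poisson) = (SUP i. \<integral>\<^sup>+xs. U i xs \<partial>lebesgue_poisson)"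
    using seq by (subst nn_integral_monotone_convergence_SUP[symmetric]) (auto simp: SUP_apply[abs_def] image_comp)
  also have "\<dots> = (SUP i. \<integral>\<^sup>+k. ennreal (1 / fact k) * (\<integral>\<^sup>+xs. U i xs \<partial>vol lborel k) \<partial>count_space UNIV)"
    using seq by (simp add: nn_integral_count_space_nat)
  also have "\<dots> = (\<integral>\<^sup>+k. (SUP i. ennreal (1 / fact k) * (\<integral>\<^sup>+xs. U i xs \<partial>vol lborel k)) \<partial>count_space UNIV)"
    using seq by (intro nn_integral_monotone_convergence_SUP[symmetric])
      (auto simp: incseq_def le_fun_def intro!: mult_left_mono nn_integral_mono)
  also have "\<dots> = (\<integral>\<^sup>+k. ennreal (1 / fact k) * (\<integral>\<^sup>+xs. (SUP i. U i) xs \<partial>vol lborel k) \<partial>count_space UNIV)"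
    using seq by (intro nn_integral_cong)
      (subst SUP_mult_left_ennreal[symmetric], subst nn_integral_monotone_convergence_SUP[symmetric], auto simp: SUP_apply[abs_def] image_comp)
  finally show ?case by (simp add: nn_integral_count_space_nat)
qed

text \<open>The k-point integrals factorise into k-th powers, and the weights 1/k! make up the
  exponential series.\<close>

lemma nn_integral_lebesgue_poisson_prod_list:
  fixes g :: "'a::euclidean_space \<Rightarrow> real"
  assumes [measurable]: "g \<in> borel_measurable borel" and nn: "\<And>x. 0 \<le> g x" and "integrable lborel g"
  shows "(\<integral>\<^sup>+xs. ennreal (\<Prod>x\<leftarrow>xs. g x) \<partial>lebesgue_poisson) = ennreal (exp (\<integral>x. g x \<partial>lborel))"
proof -
  let ?I = "\<integral>x. g x \<partial>lborel"
  have I: "0 \<le> ?I" by (simp add: nn)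
  have "(\<integral>\<^sup>+x. g x \<partial>lborel) = ennreal ?I" using assms by (simp add: nn_integral_eq_integral)
  then have "(\<integral>\<^sup>+xs. ennreal (\<Prod>x\<leftarrow>xs. g x) \<partial>lebesgue_poisson) = (\<Sum>k. ennreal (?I ^ k / fact k))"
    by (simp add: nn_integral_lebesgue_poisson nn_integral_vol_prod_list nn ennreal_power I ennreal_mult[symmetric])
  also have "\<dots> = ennreal (\<Sum>k. ?I ^ k / fact k)"
    using summable_exp[of ?I] I by (intro suminf_ennreal2) (auto simp: field_simps)
  also have "(\<Sum>k. ?I ^ k / fact k) = exp ?I"
    by (simp add: exp_def divide_real_def scaleR_conv_of_real mult.commute)
  finally show ?thesis .
qed

text \<open>A list is finite, so the events "all points lie in \<open>cball 0 n\<close>" exhaust the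
  space. Their indicators are products over the points, a form whose integral is known for both
  \<open>vol\<close> and \<open>lebesgue_poisson\<close>.\<close>

lemma sigma_finite_cover:
  fixes N :: "'a::euclidean_space list measure"
  assumes N: "sets N = sets configM"
    and fin: "\<And>n::nat. (\<integral>\<^sup>+xs. ennreal (\<Prod>x\<leftarrow>xs. indicator (cball 0 n) x) \<partial>N) < \<infinity>"
  shows "sigma_finite_measure N"
proof
  note [measurable_cong] = N
  define A :: "nat \<Rightarrow> 'a list set" where "A n = {xs. \<forall>x\<in>set xs. norm x \<le> real n}" for n
  have "Measurable.pred configM (\<lambda>xs. \<forall>x\<in>set xs. norm x \<le> real n)" for n
    by (rule pred_list_all) measurable
  then have A: "A n \<in> sets configM" for n
    by (simp add: A_def pred_def)
  have "(\<Prod>x\<leftarrow>xs. indicator (cball 0 (real n)) x) = (indicator (A n) xs :: real)" for n xs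
    unfolding A_def by (induction xs) (simp_all add: indicator_def)
  then have ind: "indicator (A n) xs = ennreal (\<Prod>x\<leftarrow>xs. indicator (cball 0 (real n)) x)" for n xs
    by (simp add: ennreal_indicator)
  have "emeasure N (A n) < \<infinity>" for n
    using fin[of n] A[of n] N by (simp flip: ind)
  moreover have "(\<Union>n. A n) = UNIV"
  proof (intro set_eqI iffI UNIV_I)
    fix xs :: "'a list"
    obtain n :: nat where "sum_list (map norm xs) \<le> n" using real_arch_simple by blast
    moreover have "norm x \<le> sum_list (map norm xs)" if "x \<in> set xs" for x
      using that by (intro member_le_sum_list) (auto)
    ultimately have "xs \<in> A n" by (force simp: A_def)
    then show "xs \<in> (\<Union>n. A n)" by blast
  qed
  ultimately show "\<exists>B. countable B \<and> B \<subseteq> sets N \<and> \<Union> B = space N \<and> (\<forall>a\<in>B. emeasure N a \<noteq> \<infinity>)"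
    using A N sets_eq_imp_space_eq[OF N] by (intro exI[of _ "range A"]) (auto simp: less_top)
qed

lemma integrable_indicator_cball: "integrable lborel (indicator (cball 0 r) :: 'a::euclidean_space \<Rightarrow> real)"
  using emeasure_lborel_cball_finite[of 0 r] by (intro integrable_real_indicator) auto

interpretation vol: sigma_finite_measure "vol (lborel :: 'a::euclidean_space measure) k"
proof (rule sigma_finite_cover)
  fix n :: nat
  have "(\<integral>\<^sup>+x. ennreal (indicator (cball (0::'a) n) x) \<partial>lborel) < \<infinity>"
    using emeasure_lborel_cball_finite[of "0::'a" n] by (simp add: ennreal_indicator)
  then show "(\<integral>\<^sup>+xs. ennreal (\<Prod>x\<leftarrow>xs. indicator (cball (0::'a) n) x) \<partial>vol lborel k) < \<infinity>"
    by (subst nn_integral_vol_prod_list) (auto simp: power_less_top_ennreal intro!: borel_measurable_indicator)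
qed simp

interpretation LP: sigma_finite_measure "lebesgue_poisson :: 'a::euclidean_space list measure"
proof (rule sigma_finite_cover)
  fix n :: nat
  show "(\<integral>\<^sup>+xs. ennreal (\<Prod>x\<leftarrow>xs. indicator (cball (0::'a) n) x) \<partial>lebesgue_poisson) < \<infinity>"
    by (subst nn_integral_lebesgue_poisson_prod_list) (auto simp: integrable_indicator_cball intro!: borel_measurable_indicator)
qed simp

lemma poisson_pp_eq:
  fixes lam :: "'a::euclidean_space \<Rightarrow> real"
  assumes [measurable]: "lam \<in> borel_measurable borel" and nn: "\<And>x. 0 \<le> lam x"
  shows "poisson_pp lam = density lebesgue_poisson (\<lambda>xs. ennreal (exp (- (\<integral>x. lam x \<partial>lborel)) * (\<Prod>x\<leftarrow>xs. lam x)))"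
    (is "_ = ?D")
proof -
  let ?c = "exp (- (\<integral>x. lam x \<partial>lborel))"
  let ?M = "density lborel (\<lambda>x. ennreal (lam x))"
  have eq: "(\<Sum>k. ennreal (?c / fact k) * emeasure (PiM {..<k} (\<lambda>_. ?M))
      (list_of_fun k -` A \<inter> space (PiM {..<k} (\<lambda>_. (lborel::'a measure))))) = emeasure ?D A"
    if A: "A \<in> config_sets" for A
  proof -
    have A' [measurable]: "A \<in> sets configM" using A by (simp add: sets_configM)
    have "emeasure (PiM {..<k} (\<lambda>_. ?M)) (list_of_fun k -` A \<inter> space (PiM {..<k} (\<lambda>_. (lborel::'a measure))))
       = (\<integral>\<^sup>+xs. ennreal (\<Prod>x\<leftarrow>xs. lam x) * indicator A xs \<partial>vol lborel k)" for k
    proof -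
      have "list_of_fun k \<in> measurable (PiM {..<k} (\<lambda>_. ?M)) configM"
        by (rule measurable_list_of_fun') simp
      then have v: "emeasure (vol ?M k) A
        = emeasure (PiM {..<k} (\<lambda>_. ?M)) (list_of_fun k -` A \<inter> space (PiM {..<k} (\<lambda>_. (lborel::'a measure))))"
        by (simp add: vol_def emeasure_distr space_PiM)
      have "emeasure (vol ?M k) A = (\<integral>\<^sup>+xs. indicator A xs \<partial>vol ?M k)" by simp
      also have "\<dots> = (\<integral>\<^sup>+xs. ennreal (\<Prod>x\<leftarrow>xs. lam x) * indicator A xs \<partial>vol lborel k)"
        by (rule nn_integral_vol_density) (auto simp: nn)
      finally show ?thesis using v by simp
    qed
    then have "(\<Sum>k. ennreal (?c / fact k) * emeasure (PiM {..<k} (\<lambda>_. ?M))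
      (list_of_fun k -` A \<inter> space (PiM {..<k} (\<lambda>_. (lborel::'a measure)))))
      = (\<Sum>k. ennreal ?c * (ennreal (1 / fact k) * (\<integral>\<^sup>+xs. ennreal (\<Prod>x\<leftarrow>xs. lam x) * indicator A xs \<partial>vol lborel k)))"
      by (simp add: mult.assoc[symmetric] ennreal_mult[symmetric])
    also have "\<dots> = ennreal ?c * (\<integral>\<^sup>+xs. ennreal (\<Prod>x\<leftarrow>xs. lam x) * indicator A xs \<partial>lebesgue_poisson)"
      by (subst ennreal_suminf_cmult) (simp add: nn_integral_lebesgue_poisson)
    also have "\<dots> = emeasure ?D A"
      by (subst emeasure_density)
         (auto simp: nn_integral_cmult[symmetric] ennreal_mult prod_list_nonneg nn mult.assoc)
    finally show ?thesis .
  qed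
  have "poisson_pp lam = measure_of UNIV config_sets (emeasure ?D)"
    unfolding poisson_pp_def
    by (rule measure_of_eq) (use eq sigma_algebra.sigma_sets_eq[OF sigma_algebra_config_sets] in auto)
  also have "\<dots> = ?D"
    using measure_of_of_measure[of ?D] by (simp add: sets_configM)
  finally show ?thesis .
qed

section \<open>Splitting configurations along a set\<close>

abbreviation supported_in :: "'a set \<Rightarrow> 'a list \<Rightarrow> ennreal" where
  "supported_in S xs \<equiv> indicator {ys. set ys \<subseteq> S} xs"

lemma supported_in_snoc: "supported_in S (xs @ [x]) = supported_in S xs * indicator S x"
  by (auto simp: indicator_def)

lemma measurable_supported_in [measurable]:
  assumes [measurable]: "S \<in> sets borel"
  shows "supported_in S \<in> borel_measurable (configM :: 'a::euclidean_space list measure)"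
proof -
  have "Measurable.pred configM (\<lambda>xs :: 'a list. \<forall>x\<in>set xs. x \<in> S)"
    by (rule pred_list_all) measurable
  then have "{ys. set ys \<subseteq> S} \<in> sets configM" by (simp add: pred_def subset_eq)
  then show ?thesis by simp
qed

text \<open>One term of a binomial expansion: m labelled points outside \<open>B\<close> and l
  labelled points inside.\<close>

definition split_integral :: "'a::euclidean_space set \<Rightarrow> nat \<Rightarrow> nat \<Rightarrow> ('a list \<times> 'a list \<Rightarrow> ennreal) \<Rightarrow> ennreal" where
  "split_integral B m l G = (\<integral>\<^sup>+a. (\<integral>\<^sup>+b. supported_in (- B) a * (supported_in B b * G (a, b)) \<partial>vol lborel l) \<partial>vol lborel m)"

lemma split_integral_snoc_in:
  assumes [measurable]: "B \<in> sets borel" "G \<in> borel_measurable (configM \<Otimes>\<^sub>M configM)"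
  shows "split_integral B m (Suc l) G
    = split_integral B m l (\<lambda>(a, b). \<integral>\<^sup>+x. indicator B x * G (a, b @ [x]) \<partial>lborel)"
  unfolding split_integral_def
proof (rule nn_integral_cong)
  fix a
  have "(\<integral>\<^sup>+b. supported_in (- B) a * (supported_in B b * G (a, b)) \<partial>vol lborel (Suc l))
    = (\<integral>\<^sup>+b. (\<integral>\<^sup>+x. supported_in (- B) a * (supported_in B (b @ [x]) * G (a, b @ [x])) \<partial>lborel) \<partial>vol lborel l)"
    by (rule lborel_base.nn_integral_vol_Suc) measurable
  also have "\<dots> = (\<integral>\<^sup>+b. supported_in (- B) a * (supported_in B b * (\<integral>\<^sup>+x. indicator B x * G (a, b @ [x]) \<partial>lborel)) \<partial>vol lborel l)"
    unfolding supported_in_snoc mult.assoc by (simp add: nn_integral_cmult)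
  finally show "(\<integral>\<^sup>+b. supported_in (- B) a * (supported_in B b * G (a, b)) \<partial>vol lborel (Suc l))
    = (\<integral>\<^sup>+b. supported_in (- B) a * (supported_in B b *
        (case (a, b) of (a, b) \<Rightarrow> \<integral>\<^sup>+x. indicator B x * G (a, b @ [x]) \<partial>lborel)) \<partial>vol lborel l)"
    by simp
qed

text \<open>The new outer point is integrated outside the integral over the inner points; Fubini
  moves it within, to the place where it is a modification of \<open>G\<close>.\<close>

lemma split_integral_snoc_out:
  assumes [measurable]: "B \<in> sets borel" "G \<in> borel_measurable (configM \<Otimes>\<^sub>M configM)"
  shows "split_integral B (Suc m) l G
    = split_integral B m l (\<lambda>(a, b). \<integral>\<^sup>+x. indicator (- B) x * G (a @ [x], b) \<partial>lborel)"
proof -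
  have "split_integral B (Suc m) l G
    = (\<integral>\<^sup>+a. (\<integral>\<^sup>+x. (\<integral>\<^sup>+b. supported_in (- B) (a @ [x]) * (supported_in B b * G (a @ [x], b)) \<partial>vol lborel l) \<partial>lborel) \<partial>vol lborel m)"
    unfolding split_integral_def by (rule lborel_base.nn_integral_vol_Suc) measurable
  also have "\<dots> = (\<integral>\<^sup>+a. (\<integral>\<^sup>+b. (\<integral>\<^sup>+x. supported_in (- B) (a @ [x]) * (supported_in B b * G (a @ [x], b)) \<partial>lborel) \<partial>vol lborel l) \<partial>vol lborel m)"
  proof (rule nn_integral_cong)
    fix a
    interpret pair_sigma_finite "lborel :: 'a measure" "vol lborel l" by standard
    show "(\<integral>\<^sup>+x. (\<integral>\<^sup>+b. supported_in (- B) (a @ [x]) * (supported_in B b * G (a @ [x], b)) \<partial>vol lborel l) \<partial>lborel)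
      = (\<integral>\<^sup>+b. (\<integral>\<^sup>+x. supported_in (- B) (a @ [x]) * (supported_in B b * G (a @ [x], b)) \<partial>lborel) \<partial>vol lborel l)"
      by (rule Fubini'[symmetric]) measurable
  qed
  also have "\<dots> = split_integral B m l (\<lambda>(a, b). \<integral>\<^sup>+x. indicator (- B) x * G (a @ [x], b) \<partial>lborel)"
    unfolding split_integral_def supported_in_snoc
    by (simp add: nn_integral_cmult[symmetric] mult_ac)
  finally show ?thesis .
qed

lemma split_integral_add:
  assumes [measurable]: "B \<in> sets borel" "F \<in> borel_measurable (configM \<Otimes>\<^sub>M configM)" "G \<in> borel_measurable (configM \<Otimes>\<^sub>M configM)"
  shows "split_integral B m l (\<lambda>p. F p + G p) = split_integral B m l F + split_integral B m l G"
  unfolding split_integral_def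
  by (subst nn_integral_add[symmetric], measurable)
     (simp add: distrib_left nn_integral_add)

text \<open>The last point lies either in \<open>B\<close> or outside, which gives the two terms of
  Pascal's rule.\<close>

lemma nn_integral_vol_split:
  assumes [measurable]: "B \<in> sets borel" and "G \<in> borel_measurable (configM \<Otimes>\<^sub>M configM)"
  shows "(\<integral>\<^sup>+xs. G (filter (\<lambda>x. x \<notin> B) xs, filter (\<lambda>x. x \<in> B) xs) \<partial>vol lborel k)
     = (\<Sum>m\<le>k. of_nat (k choose m) * split_integral B m (k - m) G)"
  using assms(2)
proof (induction k arbitrary: G)
  case 0
  note [measurable] = 0
  have "split_integral B 0 0 G = G ([], [])"
    unfolding split_integral_def by (simp add: lborel_base.nn_integral_vol_0)
  then show ?case by (simp add: lborel_base.nn_integral_vol_0)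
next
  case (Suc k)
  note [measurable] = Suc.prems
  define F where "F p = (case p of (a, b) \<Rightarrow> \<integral>\<^sup>+x. indicator B x * G (a, b @ [x]) \<partial>lborel)" for p
  define H where "H p = (case p of (a, b) \<Rightarrow> \<integral>\<^sup>+x. indicator (- B) x * G (a @ [x], b) \<partial>lborel)" for p
  have F [measurable]: "F \<in> borel_measurable (configM \<Otimes>\<^sub>M configM)"
    unfolding F_def by measurable
  have H [measurable]: "H \<in> borel_measurable (configM \<Otimes>\<^sub>M configM)"
    unfolding H_def by measurable
  let ?S = "\<lambda>m l. split_integral B m l G"
  let ?out = "filter (\<lambda>x. x \<notin> B)" and ?in = "filter (\<lambda>x. x \<in> B)"
  have "(\<integral>\<^sup>+xs. G (?out xs, ?in xs) \<partial>vol lborel (Suc k))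
    = (\<integral>\<^sup>+xs. (\<integral>\<^sup>+x. G (?out (xs @ [x]), ?in (xs @ [x])) \<partial>lborel) \<partial>vol lborel k)"
    by (rule lborel_base.nn_integral_vol_Suc) measurable
  also have "\<dots> = (\<integral>\<^sup>+xs. F (?out xs, ?in xs) + H (?out xs, ?in xs) \<partial>vol lborel k)"
  proof (rule nn_integral_cong)
    fix xs
    have "(\<integral>\<^sup>+x. G (?out (xs @ [x]), ?in (xs @ [x])) \<partial>lborel)
      = (\<integral>\<^sup>+x. indicator B x * G (?out xs, ?in xs @ [x]) + indicator (- B) x * G (?out xs @ [x], ?in xs) \<partial>lborel)"
      by (rule nn_integral_cong) (auto simp: indicator_def)
    also have "\<dots> = F (?out xs, ?in xs) + H (?out xs, ?in xs)"
      unfolding F_def H_def by (subst nn_integral_add) auto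
    finally show "(\<integral>\<^sup>+x. G (?out (xs @ [x]), ?in (xs @ [x])) \<partial>lborel) = F (?out xs, ?in xs) + H (?out xs, ?in xs)" .
  qed
  also have "\<dots> = (\<Sum>m\<le>k. of_nat (k choose m) * split_integral B m (k - m) (\<lambda>p. F p + H p))"
    by (rule Suc.IH) measurable
  also have "\<dots> = (\<Sum>m\<le>k. of_nat (k choose m) * ?S m (Suc k - m)) + (\<Sum>m\<le>k. of_nat (k choose m) * ?S (Suc m) (k - m))"
  proof -
    have "split_integral B m (k - m) (\<lambda>p. F p + H p) = ?S m (Suc k - m) + ?S (Suc m) (k - m)" if "m \<le> k" for m
      using that by (simp add: split_integral_add split_integral_snoc_in split_integral_snoc_out F_def H_def Suc_diff_le)
    then show ?thesis by (simp add: distrib_left sum.distrib)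
  qed
  \<comment> \<open>The added term \<open>m = Suc k\<close> has binomial coefficient 0. It lets the
    index be shifted so that both sums can be joined by Pascal's rule.\<close>
  also have "(\<Sum>m\<le>k. of_nat (k choose m) * ?S m (Suc k - m)) = (\<Sum>m\<le>Suc k. of_nat (k choose m) * ?S m (Suc k - m))"
    by (simp add: binomial_eq_0)
  also have "\<dots> = ?S 0 (Suc k) + (\<Sum>m\<le>k. of_nat (k choose Suc m) * ?S (Suc m) (k - m))"
    by (subst sum.atMost_Suc_shift) simp
  finally have "(\<integral>\<^sup>+xs. G (?out xs, ?in xs) \<partial>vol lborel (Suc k))
    = ?S 0 (Suc k) + (\<Sum>m\<le>k. of_nat (Suc k choose Suc m) * ?S (Suc m) (k - m))"
    by (simp add: distrib_right sum.distrib add_ac)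
  also have "\<dots> = (\<Sum>m\<le>Suc k. of_nat (Suc k choose m) * ?S m (Suc k - m))"
    by (subst sum.atMost_Suc_shift) simp
  finally show ?case .
qed

lemma suminf_triangle_ennreal:
  fixes a :: "nat \<Rightarrow> nat \<Rightarrow> ennreal"
  shows "(\<Sum>k. \<Sum>m\<le>k. a m (k - m)) = (\<Sum>m. \<Sum>l. a m l)"
proof -
  have "(\<Sum>k. \<Sum>m\<le>k. a m (k - m)) = (\<Sum>k. \<Sum>m. if m \<le> k then a m (k - m) else 0)"
  proof (rule suminf_cong)
    fix k
    have "(\<Sum>m. if m \<le> k then a m (k - m) else 0) = (\<Sum>m\<le>k. if m \<le> k then a m (k - m) else 0)"
      by (rule suminf_finite) auto
    then show "(\<Sum>m\<le>k. a m (k - m)) = (\<Sum>m. if m \<le> k then a m (k - m) else 0)"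
      by simp
  qed
  also have "\<dots> = (\<integral>\<^sup>+k. (\<Sum>m. if m \<le> k then a m (k - m) else 0) \<partial>count_space UNIV)"
    by (simp add: nn_integral_count_space_nat)
  also have "\<dots> = (\<Sum>m. \<integral>\<^sup>+k. (if m \<le> k then a m (k - m) else 0) \<partial>count_space UNIV)"
    by (rule nn_integral_suminf) simp
  also have "\<dots> = (\<Sum>m. \<Sum>l. a m l)"
  proof (rule suminf_cong)
    fix m
    have "(\<Sum>k. if m \<le> k then a m (k - m) else 0) = (\<Sum>j. if m \<le> j + m then a m (j + m - m) else 0) + (\<Sum>j<m. if m \<le> j then a m (j - m) else 0)"
      by (rule suminf_offset) (rule summableI)
    then show "(\<integral>\<^sup>+k. (if m \<le> k then a m (k - m) else 0) \<partial>count_space UNIV) = (\<Sum>l. a m l)"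
      by (simp add: nn_integral_count_space_nat)
  qed
  finally show ?thesis .
qed

text \<open>The parts of a configuration inside and outside \<open>B\<close> separate because 1/k!
  times the binomial coefficient equals 1/m! times 1/(k-m)!.\<close>

lemma nn_integral_lebesgue_poisson_split:
  assumes [measurable]: "B \<in> sets borel" "G \<in> borel_measurable (configM \<Otimes>\<^sub>M configM)"
  shows "(\<integral>\<^sup>+xs. G (filter (\<lambda>x. x \<notin> B) xs, filter (\<lambda>x. x \<in> B) xs) \<partial>lebesgue_poisson)
     = (\<integral>\<^sup>+a. (\<integral>\<^sup>+b. supported_in (- B) a * (supported_in B b * G (a, b)) \<partial>lebesgue_poisson) \<partial>lebesgue_poisson)"
proof -
  let ?c = "\<lambda>k::nat. ennreal (1 / fact k)"
  have c: "?c k * of_nat (k choose m) = ?c m * ?c (k - m)" if "m \<le> k" for k m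
  proof -
    have "?c k * of_nat (k choose m) = ennreal (1 / fact k * real (k choose m))"
      by (simp add: ennreal_mult ennreal_of_nat_eq_real_of_nat del: times_divide_eq_left)
    also have "1 / fact k * real (k choose m) = 1 / fact m * (1 / fact (k - m))"
      using that by (simp add: binomial_fact)
    finally show ?thesis by (simp add: ennreal_mult del: times_divide_eq_left times_divide_eq_right)
  qed
  have "(\<integral>\<^sup>+xs. G (filter (\<lambda>x. x \<notin> B) xs, filter (\<lambda>x. x \<in> B) xs) \<partial>lebesgue_poisson)
     = (\<Sum>k. \<Sum>m\<le>k. ?c m * ?c (k - m) * split_integral B m (k - m) G)"
    by (subst nn_integral_lebesgue_poisson)
       (auto simp: nn_integral_vol_split sum_distrib_left mult.assoc[symmetric] c intro!: suminf_cong sum.cong)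
  also have "\<dots> = (\<Sum>m. \<Sum>l. ?c m * ?c l * split_integral B m l G)"
    by (rule suminf_triangle_ennreal)
  also have "\<dots> = (\<Sum>m. ?c m * (\<Sum>l. ?c l * split_integral B m l G))"
    by (simp add: mult.assoc)
  also have "\<dots> = (\<Sum>m. ?c m * (\<integral>\<^sup>+a. (\<Sum>l. ?c l * (\<integral>\<^sup>+b. supported_in (- B) a * (supported_in B b * G (a, b)) \<partial>vol lborel l)) \<partial>vol lborel m))"
    unfolding split_integral_def by (simp add: nn_integral_suminf nn_integral_cmult)
  also have "\<dots> = (\<integral>\<^sup>+a. (\<integral>\<^sup>+b. supported_in (- B) a * (supported_in B b * G (a, b)) \<partial>lebesgue_poisson) \<partial>lebesgue_poisson)"
    by (simp add: nn_integral_lebesgue_poisson)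
  finally show ?thesis .
qed

section \<open>Gibbs weights and Gibbs laws\<close>

lemma expneg_0 [simp]: "expneg 0 = 1"
  by (simp add: expneg_def)

lemma expneg_add: "0 \<le> s \<Longrightarrow> 0 \<le> t \<Longrightarrow> expneg (s + t) = expneg s * expneg t"
  by (cases s; cases t) (auto simp: expneg_def exp_add[symmetric])

lemma expneg_sum:
  "finite A \<Longrightarrow> (\<And>x. x \<in> A \<Longrightarrow> 0 \<le> f x) \<Longrightarrow> expneg (sum f A) = (\<Prod>x\<in>A. expneg (f x))"
  by (induction A rule: finite_induct) (auto simp: expneg_add sum_nonneg)

lemma expneg_nonneg [simp]: "0 \<le> expneg t"
  by (simp add: expneg_def)

lemma expneg_le_1: "0 \<le> t \<Longrightarrow> expneg t \<le> 1"
  by (cases t) (auto simp: expneg_def)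

lemma borel_measurable_expneg [measurable]: "expneg \<in> borel_measurable borel"
  unfolding expneg_def by measurable

lemma hamiltonian_Nil [simp]: "hamiltonian phi [] = 0"
  by (simp add: hamiltonian_def)

lemma hamiltonian_Cons:
  "hamiltonian phi (x # xs) = (\<Sum>j<length xs. phi (x - xs ! j)) + hamiltonian phi xs"
proof -
  let ?P = "{(i, j). i < j \<and> j < length xs}"
  have fin: "finite ?P"
    by (rule finite_subset[of _ "{..<length xs} \<times> {..<length xs}"]) auto
  have "{(i, j). i < j \<and> j < length (x # xs)} = (\<lambda>j. (0, Suc j)) ` {..<length xs} \<union> (\<lambda>(i, j). (Suc i, Suc j)) ` ?P"
    (is "?Q = ?A \<union> ?B")
  proof (intro set_eqI iffI)
    fix p assume "p \<in> ?Q"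
    then obtain i j where p: "p = (i, j)" "i < j" "j < Suc (length xs)" by auto
    then obtain j' where "j = Suc j'" by (cases j) auto
    with p show "p \<in> ?A \<union> ?B" by (cases i) auto
  qed auto
  then have "hamiltonian phi (x # xs)
      = (\<Sum>(i,j)\<in>?A \<union> ?B. phi ((x # xs) ! i - (x # xs) ! j))"
    by (simp add: hamiltonian_def)
  also have "\<dots> = (\<Sum>(i,j)\<in>?A. phi ((x # xs) ! i - (x # xs) ! j)) + (\<Sum>(i,j)\<in>?B. phi ((x # xs) ! i - (x # xs) ! j))"
    using fin by (intro sum.union_disjoint) auto
  also have "(\<Sum>(i,j)\<in>?A. phi ((x # xs) ! i - (x # xs) ! j)) = (\<Sum>j<length xs. phi (x - xs ! j))"
    by (subst sum.reindex) (auto simp: inj_on_def)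
  also have "(\<Sum>(i,j)\<in>?B. phi ((x # xs) ! i - (x # xs) ! j)) = hamiltonian phi xs"
    unfolding hamiltonian_def by (subst sum.reindex) (auto simp: inj_on_def intro!: sum.cong)
  finally show ?thesis .
qed

lemma prod_list_nth: "(\<Prod>x\<leftarrow>xs. g x) = (\<Prod>i<length xs. g (xs ! i))"
  using prod.list_conv_set_nth[of "map g xs"] by (simp add: atLeast0LessThan)

lemma prod_list_mset_cong:
  fixes g :: "'b \<Rightarrow> 'c::comm_monoid_mult"
  assumes "mset xs = mset ys"
  shows "(\<Prod>x\<leftarrow>xs. g x) = (\<Prod>x\<leftarrow>ys. g x)"
  using assms by (metis mset_map prod_mset_prod_list)

lemma prod_list_mult:
  fixes f g :: "'b \<Rightarrow> 'c::comm_monoid_mult"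
  shows "(\<Prod>x\<leftarrow>xs. f x * g x) = (\<Prod>x\<leftarrow>xs. f x) * (\<Prod>x\<leftarrow>xs. g x)"
  by (induction xs) (simp_all add: mult_ac)

lemma prod_list_le_1:
  "(\<And>x. x \<in> set xs \<Longrightarrow> 0 \<le> g x \<and> g x \<le> (1::real)) \<Longrightarrow> (\<Prod>x\<leftarrow>xs. g x) \<le> 1"
  by (induction xs) (auto intro!: mult_le_one prod_list_nonneg)

text \<open>Exactly what makes the Gibbs density normalisable here. It is preserved by cutting off
  to a ball and by the damping of boundary points.\<close>

definition integrable_activity :: "('a::euclidean_space \<Rightarrow> real) \<Rightarrow> bool" where
  "integrable_activity lam \<longleftrightarrow> lam \<in> borel_measurable borel \<and> (\<forall>x. 0 \<le> lam x) \<and> integrable lborel lam"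

locale repulsive =
  fixes phi :: "'a::euclidean_space \<Rightarrow> ereal" and r :: real
  assumes phi_measurable [measurable]: "phi \<in> borel_measurable borel"
    and phi_sym: "phi (- x) = phi x"
    and phi_nonneg: "0 \<le> phi x"
    and r_pos: "0 < r"
    and phi_range: "r < norm x \<Longrightarrow> phi x = 0"
begin

definition boltz :: "'a \<Rightarrow> real" where "boltz x = expneg (phi x)"

lemma boltz_measurable [measurable]: "boltz \<in> borel_measurable borel"
  unfolding boltz_def by measurable

lemma boltz_nonneg [simp]: "0 \<le> boltz x" and boltz_le_1 [simp]: "boltz x \<le> 1"
  by (simp_all add: boltz_def expneg_le_1 phi_nonneg)

lemma boltz_commute: "boltz (x - y) = boltz (y - x)"
  using phi_sym[of "x - y"] by (simp add: boltz_def)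

lemma boltz_far: "r < dist x y \<Longrightarrow> boltz (x - y) = 1"
  by (simp add: boltz_def dist_norm phi_range)

text \<open>The damping that the points \<open>zs\<close> exert on the activity at
  \<open>x\<close>.\<close>

definition field :: "'a list \<Rightarrow> 'a \<Rightarrow> real" where "field zs x = (\<Prod>z\<leftarrow>zs. boltz (x - z))"

text \<open>The Boltzmann factor of the Hamiltonian in a form suited to list induction;
  \<open>expneg_hamiltonian\<close> identifies the two.\<close>

fun gibbs_factor :: "'a list \<Rightarrow> real" where
  "gibbs_factor [] = 1"
| "gibbs_factor (x # xs) = field xs x * gibbs_factor xs"

lemma field_Nil [simp]: "field [] x = 1"
  and field_Cons: "field (z # zs) x = boltz (x - z) * field zs x"
  and field_append: "field (zs @ zs') x = field zs x * field zs' x"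
  by (simp_all add: field_def)

lemma field_nonneg [simp]: "0 \<le> field zs x"
  by (auto simp: field_def intro!: prod_list_nonneg)

lemma field_le_1 [simp]: "field zs x \<le> 1"
  by (auto simp: field_def intro!: prod_list_le_1)

lemma field_mset_cong: "mset zs = mset zs' \<Longrightarrow> field zs = field zs'"
  unfolding field_def by (intro ext prod_list_mset_cong)

lemma gibbs_factor_nonneg [simp]: "0 \<le> gibbs_factor xs"
  by (induction xs) auto

lemma gibbs_factor_le_1 [simp]: "gibbs_factor xs \<le> 1"
  by (induction xs) (auto intro!: mult_le_one)

lemma gibbs_factor_append:
  "gibbs_factor (xs @ ys) = gibbs_factor xs * gibbs_factor ys * (\<Prod>x\<leftarrow>xs. field ys x)"
  by (induction xs) (simp_all add: field_append mult_ac)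

text \<open>The cross interaction of two lists is the same from either side because
  \<open>phi\<close> is even.\<close>

lemma field_commute: "(\<Prod>x\<leftarrow>xs. field ys x) = (\<Prod>y\<leftarrow>ys. field xs y)"
proof (induction xs)
  case Nil then show ?case by (induction ys) auto
next
  case (Cons x xs)
  have "(\<Prod>y\<leftarrow>ys. field (x # xs) y) = (\<Prod>y\<leftarrow>ys. boltz (x - y)) * (\<Prod>y\<leftarrow>ys. field xs y)"
    by (simp add: field_Cons prod_list_mult boltz_commute[of x])
  then show ?case using Cons by (simp add: field_def)
qed

text \<open>The recursion singles out the head. By \<open>field_commute\<close> the copy of that
  point inside \<open>ys\<close> can be pulled to the front.\<close>

lemma gibbs_factor_mset_cong: "mset xs = mset ys \<Longrightarrow> gibbs_factor xs = gibbs_factor ys"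
proof (induction xs arbitrary: ys)
  case (Cons x xs)
  then have "x \<in> set ys" by (metis list.set_intros(1) set_mset_mset)
  then obtain as bs where ys: "ys = as @ x # bs" by (meson split_list)
  with Cons.prems have m: "mset xs = mset (as @ bs)" by simp
  have "gibbs_factor ys = field (as @ bs) x * gibbs_factor (as @ bs)"
    using field_commute[of as "[x]"]
    by (simp add: ys gibbs_factor_append field_append field_Cons prod_list_mult mult_ac)
  also have "\<dots> = field xs x * gibbs_factor xs"
    using Cons.IH[OF m] field_mset_cong[OF m] by simp
  finally show ?case by simp
qed simp

lemma measurable_field [measurable (raw)]:
  assumes [measurable]: "Z \<in> measurable N configM" "f \<in> borel_measurable N"
  shows "(\<lambda>w. field (Z w) (f w)) \<in> borel_measurable N"
  unfolding field_def by (rule measurable_prod_list) measurable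

lemma measurable_gibbs_factor [measurable]: "gibbs_factor \<in> borel_measurable configM"
proof (rule measurable_from_configM)
  fix k :: nat
  let ?M = "PiM {..<k} (\<lambda>_. lborel :: 'a measure)"
  \<comment> \<open>\<open>gibbs_factor\<close> recurses from the front while
    \<open>list_of_fun\<close> grows at the back, so the recursion is first turned around.\<close>
  have snoc: "gibbs_factor (xs @ [x]) = gibbs_factor xs * field xs x" for xs x
    using field_commute[of xs "[x]"] by (simp add: gibbs_factor_append)
  have Nil: "list_of_fun 0 = (\<lambda>_ :: nat \<Rightarrow> 'a. [])" by auto
  have list: "list_of_fun m \<in> measurable ?M configM" if "m \<le> k" for m
    using that
  proof (induction m)
    case (Suc m)
    then have [measurable]: "list_of_fun m \<in> measurable ?M configM"
      "(\<lambda>x. x m) \<in> borel_measurable ?M"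
      using measurable_component_singleton[of m "{..<k}" "\<lambda>_. lborel :: 'a measure"] by auto
    show ?case unfolding list_of_fun_Suc[abs_def] by measurable
  qed (simp add: Nil)
  have "(\<lambda>x. gibbs_factor (list_of_fun m x)) \<in> borel_measurable ?M" if "m \<le> k" for m
    using that
  proof (induction m)
    case (Suc m)
    then have [measurable]: "(\<lambda>x. gibbs_factor (list_of_fun m x)) \<in> borel_measurable ?M"
      "(\<lambda>x. x m) \<in> borel_measurable ?M" "list_of_fun m \<in> measurable ?M configM"
      using measurable_component_singleton[of m "{..<k}" "\<lambda>_. lborel :: 'a measure"] list by auto
    show ?case unfolding list_of_fun_Suc snoc by measurable
  qed simp
  then show "(\<lambda>x. gibbs_factor (list_of_fun k x)) \<in> borel_measurable ?M" by simp
qed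

lemma hamiltonian_nonneg: "0 \<le> hamiltonian phi xs"
  unfolding hamiltonian_def by (auto intro!: sum_nonneg phi_nonneg)

lemma expneg_hamiltonian: "expneg (hamiltonian phi xs) = gibbs_factor xs"
proof (induction xs)
  case (Cons x xs)
  then show ?case
    by (simp add: hamiltonian_Cons expneg_add expneg_sum sum_nonneg phi_nonneg hamiltonian_nonneg
        field_def prod_list_nth boltz_def)
qed simp

lemma expneg_energy:
  "expneg (hamiltonian phi ys + interaction phi ys zs) = gibbs_factor ys * (\<Prod>y\<leftarrow>ys. field zs y)"
  by (subst expneg_add)
     (simp_all add: interaction_def hamiltonian_nonneg sum_nonneg phi_nonneg expneg_hamiltonian expneg_sum
       field_def prod_list_nth boltz_def)

definition weight :: "('a \<Rightarrow> real) \<Rightarrow> 'a list \<Rightarrow> real" where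
  "weight lam xs = (\<Prod>x\<leftarrow>xs. lam x) * gibbs_factor xs"

text \<open>The normalisation against \<open>lebesgue_poisson\<close>; the factor exp(- integral of
  lam) of the Poisson law cancels and is left out.\<close>

definition partition_fn :: "('a \<Rightarrow> real) \<Rightarrow> real" where
  "partition_fn lam = (\<integral>xs. weight lam xs \<partial>lebesgue_poisson)"

definition gibbs_law :: "('a \<Rightarrow> real) \<Rightarrow> 'a list measure" where
  "gibbs_law lam = density lebesgue_poisson (\<lambda>xs. ennreal (weight lam xs / partition_fn lam))"

lemma sets_gibbs_law [simp, measurable_cong]: "sets (gibbs_law lam) = sets configM"
  by (simp add: gibbs_law_def)

lemma space_gibbs_law [simp]: "space (gibbs_law lam) = UNIV"
  by (simp add: gibbs_law_def)

lemma weight_nonneg: "(\<And>x. 0 \<le> lam x) \<Longrightarrow> 0 \<le> weight lam xs"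
  by (simp add: weight_def prod_list_nonneg)

lemma weight_measurable [measurable]:
  assumes [measurable]: "lam \<in> borel_measurable borel"
  shows "weight lam \<in> borel_measurable configM"
  unfolding weight_def by measurable

lemma weight_mset_cong: "mset xs = mset ys \<Longrightarrow> weight lam xs = weight lam ys"
  unfolding weight_def using gibbs_factor_mset_cong prod_list_mset_cong by metis

context
  fixes lam :: "'a \<Rightarrow> real"
  assumes act: "integrable_activity lam"
begin

lemma nn_integral_prod_activity:
  "(\<integral>\<^sup>+xs. ennreal (\<Prod>x\<leftarrow>xs. lam x) \<partial>lebesgue_poisson) = ennreal (exp (\<integral>x. lam x \<partial>lborel))"
  using act by (intro nn_integral_lebesgue_poisson_prod_list) (auto simp: integrable_activity_def)

text \<open>Repulsion gives \<open>gibbs_factor xs \<le> 1\<close>, so the weight is dominated by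
  the product of the activities, whose integral is an exponential.\<close>

lemma integrable_weight: "integrable lebesgue_poisson (weight lam)"
proof (rule integrableI_nonneg)
  have [measurable]: "lam \<in> borel_measurable borel" and nn: "0 \<le> lam x" for x
    using act by (auto simp: integrable_activity_def)
  show "weight lam \<in> borel_measurable lebesgue_poisson" by measurable
  show "AE xs in lebesgue_poisson. 0 \<le> weight lam xs" by (simp add: weight_nonneg nn)
  have "(\<integral>\<^sup>+xs. ennreal (weight lam xs) \<partial>lebesgue_poisson) \<le> (\<integral>\<^sup>+xs. ennreal (\<Prod>x\<leftarrow>xs. lam x) \<partial>lebesgue_poisson)"
    unfolding weight_def by (intro nn_integral_mono ennreal_leI mult_left_le) (simp_all add: prod_list_nonneg nn)
  then show "(\<integral>\<^sup>+xs. ennreal (weight lam xs) \<partial>lebesgue_poisson) < \<infinity>"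
    unfolding nn_integral_prod_activity using ennreal_less_top le_less_trans by (metis infinity_ennreal_def)
qed

lemma nn_integral_weight: "(\<integral>\<^sup>+xs. ennreal (weight lam xs) \<partial>lebesgue_poisson) = ennreal (partition_fn lam)"
  unfolding partition_fn_def using act
  by (intro nn_integral_eq_integral integrable_weight) (auto simp: weight_nonneg integrable_activity_def)

text \<open>The empty configuration alone contributes 1. This makes every later division by the
  partition function harmless.\<close>

lemma partition_fn_ge_1: "1 \<le> partition_fn lam"
proof -
  have [measurable]: "lam \<in> borel_measurable borel"
    using act by (auto simp: integrable_activity_def)
  have "(1::ennreal) = ennreal (1 / fact 0) * (\<integral>\<^sup>+xs. ennreal (weight lam xs) \<partial>vol lborel 0)"
    by (simp add: lborel_base.nn_integral_vol_0 weight_def)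
  also have "\<dots> \<le> (\<Sum>k. ennreal (1 / fact k) * (\<integral>\<^sup>+xs. ennreal (weight lam xs) \<partial>vol lborel k))"
    using sum_le_suminf[OF summableI, of "{0}" "\<lambda>k. ennreal (1 / fact k) * (\<integral>\<^sup>+xs. ennreal (weight lam xs) \<partial>vol lborel k)"]
    by simp
  also have "\<dots> = ennreal (partition_fn lam)"
    by (simp add: nn_integral_lebesgue_poisson[symmetric] nn_integral_weight)
  finally show ?thesis by simp
qed

lemma nn_integral_gibbs_law:
  assumes [measurable]: "f \<in> borel_measurable configM"
  shows "(\<integral>\<^sup>+xs. f xs \<partial>gibbs_law lam)
    = ennreal (1 / partition_fn lam) * (\<integral>\<^sup>+xs. ennreal (weight lam xs) * f xs \<partial>lebesgue_poisson)"
proof -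
  have [measurable]: "lam \<in> borel_measurable borel" and nn: "0 \<le> lam x" for x
    using act by (auto simp: integrable_activity_def)
  have "(\<integral>\<^sup>+xs. f xs \<partial>gibbs_law lam) = (\<integral>\<^sup>+xs. ennreal (1 / partition_fn lam) * (ennreal (weight lam xs) * f xs) \<partial>lebesgue_poisson)"
    unfolding gibbs_law_def using partition_fn_ge_1
    by (subst nn_integral_density)
       (auto simp: mult.assoc[symmetric] ennreal_mult[symmetric] weight_nonneg nn)
  then show ?thesis by (simp add: nn_integral_cmult)
qed

lemma prob_space_gibbs_law: "prob_space (gibbs_law lam)"
proof
  have "emeasure (gibbs_law lam) UNIV = (\<integral>\<^sup>+xs. 1 \<partial>gibbs_law lam)" by simp
  also have "\<dots> = ennreal (1 / partition_fn lam) * ennreal (partition_fn lam)"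
    by (subst nn_integral_gibbs_law) (simp_all add: nn_integral_weight)
  also have "\<dots> = 1"
    using partition_fn_ge_1 by (simp add: ennreal_mult[symmetric])
  finally show "emeasure (gibbs_law lam) (space (gibbs_law lam)) = 1" by simp
qed

lemma AE_gibbs_law: "AE xs in gibbs_law lam. \<forall>x\<in>set xs. lam x \<noteq> 0"
proof -
  have [measurable]: "lam \<in> borel_measurable borel"
    using act by (auto simp: integrable_activity_def)
  have "weight lam xs = 0" if "lam x = 0" "x \<in> set xs" for x xs
  proof -
    have "0 \<in> lam ` set xs" using that by (metis imageI)
    then show ?thesis by (simp add: weight_def prod_list_zero_iff)
  qed
  then have "lam x \<noteq> 0" if "0 < weight lam xs / partition_fn lam" "x \<in> set xs" for x xs
    using that by fastforce
  then show ?thesis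
    unfolding gibbs_law_def by (subst AE_density) auto
qed

lemma integrable_activity_field: "integrable_activity (\<lambda>x. lam x * field zs x)"
proof -
  have [measurable]: "lam \<in> borel_measurable borel" and nn: "0 \<le> lam x" and int: "integrable lborel lam" for x
    using act by (auto simp: integrable_activity_def)
  have m: "(\<lambda>x. lam x * field zs x) \<in> borel_measurable borel" by measurable
  have "integrable lborel (\<lambda>x. lam x * field zs x)"
    by (rule Bochner_Integration.integrable_bound[OF int])
       (use m nn in \<open>auto simp: abs_mult intro!: mult_left_le\<close>)
  then show ?thesis using nn m by (simp add: integrable_activity_def)
qed

end

lemma weight_field: "weight (\<lambda>x. lam x * field zs x) xs = (\<Prod>x\<leftarrow>xs. lam x) * (gibbs_factor xs * (\<Prod>x\<leftarrow>xs. field zs x))"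
  by (simp add: weight_def prod_list_mult)

text \<open>The energy between new points and boundary is a sum over the new points, so its
  Boltzmann factor is a product that can be absorbed into the activity. This turns boundary
  conditions into changes of activity, the only changes that strong spatial mixing speaks
  about.\<close>

lemma gibbs_bc_eq:
  assumes act: "integrable_activity lam"
  shows "gibbs_bc phi lam zs = gibbs_law (\<lambda>x. lam x * field zs x)"
proof -
  have [measurable]: "lam \<in> borel_measurable borel" and nn: "0 \<le> lam x" for x
    using act by (auto simp: integrable_activity_def)
  define c where "c = exp (- (\<integral>x. lam x \<partial>lborel))"
  define w where "w ys = gibbs_factor ys * (\<Prod>y\<leftarrow>ys. field zs y)" for ys
  let ?Z = "partition_fn (\<lambda>x. lam x * field zs x)"
  have [measurable]: "w \<in> borel_measurable configM" unfolding w_def by measurable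
  have c: "0 < c" by (simp add: c_def)
  have w: "0 \<le> w ys" for ys by (auto simp: w_def intro!: mult_nonneg_nonneg prod_list_nonneg)
  have P: "poisson_pp lam = density lebesgue_poisson (\<lambda>xs. ennreal (c * (\<Prod>x\<leftarrow>xs. lam x)))"
    unfolding c_def by (rule poisson_pp_eq) (simp_all add: nn)
  have "(\<integral>ys. w ys \<partial>poisson_pp lam) = (\<integral>ys. c * weight (\<lambda>x. lam x * field zs x) ys \<partial>lebesgue_poisson)"
    unfolding P by (subst integral_density) (auto simp: c_def prod_list_nonneg nn weight_field w_def mult_ac)
  then have Z: "(\<integral>ys. w ys \<partial>poisson_pp lam) = c * ?Z" by (simp add: partition_fn_def)
  have "gibbs_bc phi lam zs = density (poisson_pp lam) (\<lambda>ys. ennreal (w ys / (c * ?Z)))"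
    unfolding gibbs_bc_def Let_def expneg_energy w_def[symmetric] Z ..
  also have "\<dots> = density lebesgue_poisson (\<lambda>ys. ennreal (c * (\<Prod>x\<leftarrow>ys. lam x)) * ennreal (w ys / (c * ?Z)))"
    unfolding P by (rule density_density_eq) measurable
  also have "\<dots> = gibbs_law (\<lambda>x. lam x * field zs x)"
    unfolding gibbs_law_def using c w partition_fn_ge_1[OF integrable_activity_field[OF act, of zs]]
    by (intro arg_cong2[where f = density] refl ext)
       (simp add: ennreal_mult[symmetric] prod_list_nonneg nn weight_field w_def[symmetric])
  finally show ?thesis .
qed

lemma gibbs_eq:
  assumes "integrable_activity lam"
  shows "gibbs phi lam = gibbs_law lam"
  using gibbs_bc_eq[OF assms, of "[]"] by (simp add: gibbs_def)

end

section \<open>The block kernel\<close>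

definition symmetric_fn :: "('a list \<Rightarrow> 'b) \<Rightarrow> bool" where
  "symmetric_fn f \<longleftrightarrow> (\<forall>xs ys. mset xs = mset ys \<longrightarrow> f xs = f ys)"

lemma symmetric_fnD: "symmetric_fn f \<Longrightarrow> mset xs = mset ys \<Longrightarrow> f xs = f ys"
  unfolding symmetric_fn_def by blast

lemma mset_partition: "mset (filter (\<lambda>x. x \<notin> B) xs @ filter (\<lambda>x. x \<in> B) xs) = mset xs"
  by (induction xs) auto

lemma integrable_bounded:
  assumes "prob_space N" "f \<in> borel_measurable N" "\<And>X. 0 \<le> f X \<and> f X \<le> (1::real)"
  shows "integrable N f"
proof -
  interpret prob_space N by fact
  show ?thesis using assms by (intro integrable_const_bound[where B = 1]) auto
qed

locale block_dyn = repulsive phi r for phi :: "'a::euclidean_space \<Rightarrow> ereal" and r +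
  fixes lam :: "'a \<Rightarrow> real" and Lam :: "'a set" and L :: real
  assumes act: "integrable_activity lam"
    and Lam_sets [measurable]: "Lam \<in> sets borel"
    and Lam_pos: "emeasure lborel Lam \<noteq> 0" and Lam_fin: "emeasure lborel Lam \<noteq> \<infinity>"
begin

lemma lam_measurable [measurable]: "lam \<in> borel_measurable borel"
  and lam_nonneg: "0 \<le> lam x"
  using act by (auto simp: integrable_activity_def)

abbreviation outside :: "'a \<Rightarrow> 'a list \<Rightarrow> 'a list" where
  "outside y \<equiv> filter (\<lambda>x. x \<notin> ball y L)"

definition local_activity :: "'a \<Rightarrow> 'a list \<Rightarrow> 'a \<Rightarrow> real" where
  "local_activity y zs x = indicator (ball y L) x * lam x * field zs x"

definition update :: "'a \<Rightarrow> 'a list \<Rightarrow> 'a list measure" where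
  "update y X = distr (gibbs_law (local_activity y (outside y X))) configM (\<lambda>ys. outside y X @ ys)"

lemma integrable_activity_indicator: "integrable_activity (\<lambda>x. indicator (ball y L) x * lam x)"
proof -
  have "integrable lborel (\<lambda>x. indicator (ball y L) x * lam x)"
    using integrable_mult_indicator[of "ball y L" lborel lam] act by (simp add: integrable_activity_def)
  then show ?thesis using lam_nonneg by (auto simp: integrable_activity_def intro!: borel_measurable_times borel_measurable_indicator)
qed

lemma integrable_local_activity: "integrable_activity (local_activity y zs)"
  unfolding local_activity_def[abs_def]
  by (rule integrable_activity_field[OF integrable_activity_indicator])

lemma gibbs_bc_local: "gibbs_bc phi (\<lambda>x. indicator (ball y L) x * lam x) zs = gibbs_law (local_activity y zs)"
  unfolding local_activity_def[abs_def] by (rule gibbs_bc_eq[OF integrable_activity_indicator])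

lemma block_kernel_eq: "block_kernel phi lam Lam L X = bind (uniform_measure lborel Lam) (\<lambda>y. update y X)"
  unfolding block_kernel_def update_def gibbs_bc_local ..

lemma local_activity_mset_cong: "mset zs = mset zs' \<Longrightarrow> local_activity y zs = local_activity y zs'"
  using field_mset_cong[of zs zs'] by (auto simp: local_activity_def)

lemma sets_update [simp]: "sets (update y X) = sets configM"
  by (simp add: update_def)

lemma space_update [simp]: "space (update y X) = UNIV"
  by (simp add: update_def)

lemma prob_space_update: "prob_space (update y X)"
  unfolding update_def
  by (rule prob_space.prob_space_distr[OF prob_space_gibbs_law[OF integrable_local_activity]]) measurable

lemma measurable_outside [measurable (raw)]:
  assumes [measurable]: "Y \<in> measurable N borel" "X \<in> measurable N configM"
  shows "(\<lambda>w. outside (Y w) (X w)) \<in> measurable N configM"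
  unfolding mem_ball by (rule measurable_filter) measurable

lemma measurable_local_activity [measurable (raw)]:
  assumes [measurable]: "Y \<in> measurable N borel" "Z \<in> measurable N configM" "f \<in> measurable N borel"
  shows "(\<lambda>w. local_activity (Y w) (Z w) (f w)) \<in> borel_measurable N"
proof -
  have eq: "local_activity (Y w) (Z w) (f w) = (if dist (Y w) (f w) < L then 1 else 0) * lam (f w) * field (Z w) (f w)" for w
    by (simp add: local_activity_def indicator_def)
  show ?thesis unfolding eq by measurable
qed

lemma measurable_local_weight [measurable (raw)]:
  assumes [measurable]: "Y \<in> measurable N borel" "Z \<in> measurable N configM" "f \<in> measurable N configM"
  shows "(\<lambda>w. weight (local_activity (Y w) (Z w)) (f w)) \<in> borel_measurable N"
proof -
  have "(\<lambda>w. \<Prod>x\<leftarrow>f w. local_activity (Y w) (Z w) x) \<in> borel_measurable N"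
    by (rule measurable_prod_list) measurable
  then show ?thesis unfolding weight_def by measurable
qed

lemma measurable_local_partition [measurable (raw)]:
  assumes [measurable]: "Y \<in> measurable N borel" "Z \<in> measurable N configM"
  shows "(\<lambda>w. partition_fn (local_activity (Y w) (Z w))) \<in> borel_measurable N"
  unfolding partition_fn_def by measurable

lemma nn_integral_update:
  assumes [measurable]: "f \<in> borel_measurable configM"
  shows "(\<integral>\<^sup>+X'. f X' \<partial>update y X) = (\<integral>\<^sup>+ys. f (outside y X @ ys) \<partial>gibbs_law (local_activity y (outside y X)))"
  unfolding update_def by (rule nn_integral_distr) measurable

text \<open>Joint measurability in centre and configuration: averaging over centres and iterating
  the chain are both \<open>bind\<close>s and rest on it.\<close>

lemma measurable_update:
  "(\<lambda>(y, X). update y X) \<in> measurable (borel \<Otimes>\<^sub>M configM) (subprob_algebra configM)"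
proof (rule measurable_subprob_algebra)
  show "subprob_space (case p of (y, X) \<Rightarrow> update y X)" for p
    using prob_space_update by (auto split: prod.split intro: prob_space_imp_subprob_space)
  fix A :: "'a list set" assume [measurable]: "A \<in> sets configM"
  have "emeasure (update y X) A = ennreal (1 / partition_fn (local_activity y (outside y X))) *
     (\<integral>\<^sup>+ys. ennreal (weight (local_activity y (outside y X)) ys) * indicator A (outside y X @ ys) \<partial>lebesgue_poisson)" for y X
  proof -
    have "emeasure (update y X) A = (\<integral>\<^sup>+X'. indicator A X' \<partial>update y X)" by simp
    also have "\<dots> = (\<integral>\<^sup>+ys. indicator A (outside y X @ ys) \<partial>gibbs_law (local_activity y (outside y X)))"
      by (rule nn_integral_update) measurable
    finally show ?thesis by (subst (asm) nn_integral_gibbs_law[OF integrable_local_activity]) auto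
  qed
  then show "(\<lambda>p. emeasure (case p of (y, X) \<Rightarrow> update y X) A) \<in> borel_measurable (borel \<Otimes>\<^sub>M configM)"
    unfolding case_prod_beta by simp
qed (auto split: prod.split)

abbreviation unif :: "'a measure" where "unif \<equiv> uniform_measure lborel Lam"

lemma prob_space_unif: "prob_space unif"
  using Lam_pos Lam_fin by (rule prob_space_uniform_measure)

lemma measurable_update_fst: "(\<lambda>y. update y X) \<in> measurable unif (subprob_algebra configM)"
  using measurable_compose[OF _ measurable_update, of "\<lambda>y. (y, X)" unif] by simp

abbreviation kernel :: "'a list \<Rightarrow> 'a list measure" where "kernel \<equiv> block_kernel phi lam Lam L"

lemma measurable_kernel: "kernel \<in> measurable configM (subprob_algebra configM)"
proof -
  have "unif \<in> space (subprob_algebra borel)"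
    using prob_space_unif by (auto simp: space_subprob_algebra prob_space_imp_subprob_space)
  then have c: "(\<lambda>_. unif) \<in> measurable configM (subprob_algebra borel)" by simp
  have "(\<lambda>(X, y). update y X) \<in> measurable (configM \<Otimes>\<^sub>M borel) (subprob_algebra configM)"
    using measurable_compose[OF _ measurable_update, of "\<lambda>p. (snd p, fst p)" "configM \<Otimes>\<^sub>M borel"]
    by (simp add: case_prod_beta)
  from measurable_bind'[OF c this] show ?thesis
    unfolding block_kernel_eq[abs_def] .
qed

lemma prob_space_kernel: "prob_space (kernel X)"
proof -
  interpret prob_space unif by (rule prob_space_unif)
  show ?thesis
    unfolding block_kernel_eq
    by (rule prob_space_bind[OF _ measurable_update_fst]) (simp add: prob_space_update)
qed

lemma sets_kernel [simp]: "sets (kernel X) = sets configM"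
  using measurable_kernel by (metis sets_kernel space_configM UNIV_I)

lemma measurable_from_kernel: "f \<in> borel_measurable configM \<Longrightarrow> f \<in> borel_measurable (kernel X)"
  by (subst measurable_cong_sets[OF sets_kernel refl])

text \<open>The Markov operator of the block kernel on functions; \<open>uop\<close> is its version
  with a fixed centre.\<close>

definition kop :: "('a list \<Rightarrow> real) \<Rightarrow> 'a list \<Rightarrow> real" where
  "kop f X = (\<integral>X'. f X' \<partial>kernel X)"

definition uop :: "('a list \<Rightarrow> real) \<Rightarrow> 'a list \<Rightarrow> 'a \<Rightarrow> real" where
  "uop f X y = (\<integral>ys. f (outside y X @ ys) \<partial>gibbs_law (local_activity y (outside y X)))"

text \<open>A class that contains the indicators of the symmetric events in \<open>tv_dist\<close>
  and is preserved by \<open>kop\<close>.\<close>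

definition test_fn :: "('a list \<Rightarrow> real) \<Rightarrow> bool" where
  "test_fn f \<longleftrightarrow> f \<in> borel_measurable configM \<and> (\<forall>X. 0 \<le> f X \<and> f X \<le> 1) \<and> symmetric_fn f"

context
  fixes f assumes f: "test_fn f"
begin

lemma test_fn_measurable [measurable]: "f \<in> borel_measurable configM"
  and test_fn_bounds: "0 \<le> f X" "f X \<le> 1"
  and test_fn_sym: "mset X = mset X' \<Longrightarrow> f X = f X'"
  using f by (auto simp: test_fn_def dest: symmetric_fnD)

lemma kop_eq: "kop f X = (\<integral>y. uop f X y \<partial>unif)"
proof -
  have "kop f X = (\<integral>y. (\<integral>X'. f X' \<partial>update y X) \<partial>unif)"
    unfolding kop_def block_kernel_eq
    by (rule integral_bind[where K = configM and B = 1 and B' = 1])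
       (use measurable_update_fst prob_space_unif prob_space_update in
         \<open>auto simp: prob_space.finite_measure test_fn_bounds prob_space.emeasure_space_1[OF prob_space_update, simplified]\<close>)
  also have "\<dots> = (\<integral>y. uop f X y \<partial>unif)"
    unfolding uop_def update_def by (subst integral_distr) auto
  finally show ?thesis .
qed

lemma uop_bounds: "0 \<le> uop f X y" "uop f X y \<le> 1"
proof -
  interpret prob_space "gibbs_law (local_activity y (outside y X))"
    by (rule prob_space_gibbs_law[OF integrable_local_activity])
  show "0 \<le> uop f X y" unfolding uop_def by (simp add: test_fn_bounds)
  have "integrable (gibbs_law (local_activity y (outside y X))) (\<lambda>ys. f (outside y X @ ys))"
    by (rule integrable_bounded[OF prob_space_axioms]) (simp_all add: test_fn_bounds)
  then show "uop f X y \<le> 1" unfolding uop_def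
    by (rule integral_le_const) (simp add: test_fn_bounds)
qed

lemma measurable_uop [measurable]: "uop f X \<in> borel_measurable borel"
proof -
  have "(\<lambda>y. \<integral>X'. f X' \<partial>update y X) \<in> borel_measurable unif"
    by (rule measurable_compose[OF measurable_update_fst integral_measurable_subprob_algebra])
       measurable
  moreover have "uop f X = (\<lambda>y. \<integral>X'. f X' \<partial>update y X)"
    unfolding uop_def update_def by (subst integral_distr) auto
  ultimately show ?thesis by simp
qed

lemma test_fn_kop: "test_fn (kop f)"
  unfolding test_fn_def
proof (intro conjI allI)
  have "(\<lambda>X. \<integral>X'. f X' \<partial>kernel X) \<in> borel_measurable configM"
    by (rule measurable_compose[OF measurable_kernel integral_measurable_subprob_algebra])
       measurable
  then show "kop f \<in> borel_measurable configM" by (simp add: kop_def[abs_def])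
  fix X
  interpret prob_space "kernel X" by (rule prob_space_kernel)
  have [measurable]: "f \<in> borel_measurable (kernel X)"
    by (rule measurable_from_kernel) measurable
  show "0 \<le> kop f X" unfolding kop_def by (simp add: test_fn_bounds)
  have "integrable (kernel X) f"
    by (rule integrable_bounded[OF prob_space_axioms]) (simp_all add: test_fn_bounds)
  then show "kop f X \<le> 1" unfolding kop_def
    by (rule integral_le_const) (simp add: test_fn_bounds)
next
  show "symmetric_fn (kop f)"
    unfolding symmetric_fn_def
  proof (intro allI impI)
    fix X X' :: "'a list" assume "mset X = mset X'"
    then have m: "mset (outside y X) = mset (outside y X')" for y by (simp add: mset_filter)
    have "uop f X y = uop f X' y" for y
      unfolding uop_def local_activity_mset_cong[OF m]
      by (intro Bochner_Integration.integral_cong refl test_fn_sym) (simp only: mset_append m)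
    then show "kop f X = kop f X'" by (simp add: kop_eq)
  qed
qed

end

lemma test_fn_kop_iter: "test_fn f \<Longrightarrow> test_fn ((kop ^^ j) f)"
  by (induction j) (simp_all add: test_fn_kop)

section \<open>Duality between the chain on laws and the iterated operator on functions\<close>

lemma chain_dist_props:
  assumes "prob_space \<mu>0" "sets \<mu>0 = sets configM"
  shows "prob_space (chain_dist phi lam Lam L \<mu>0 j) \<and> sets (chain_dist phi lam Lam L \<mu>0 j) = sets configM"
proof (induction j)
  case 0 then show ?case using assms by (simp add: chain_dist_def)
next
  case (Suc j)
  let ?\<nu> = "chain_dist phi lam Lam L \<mu>0 j"
  have eq: "chain_dist phi lam Lam L \<mu>0 (Suc j) = bind ?\<nu> kernel"
    by (simp add: chain_dist_def)
  interpret prob_space ?\<nu> using Suc by simp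
  have m: "kernel \<in> measurable ?\<nu> (subprob_algebra configM)"
    using measurable_kernel Suc measurable_cong_sets by blast
  have "space ?\<nu> \<noteq> {}" using not_empty .
  then show ?case unfolding eq
    using prob_space_bind[OF _ m] sets_bind[of ?\<nu> kernel configM] prob_space_kernel by simp
qed

text \<open>A further update comes last for the law and is therefore the innermost application for
  the function; hence the induction for arbitrary \<open>f\<close>.\<close>

lemma integral_chain_dist:
  assumes "prob_space \<mu>0" "sets \<mu>0 = sets configM" "test_fn f"
  shows "(\<integral>X. f X \<partial>chain_dist phi lam Lam L \<mu>0 j) = (\<integral>X. (kop ^^ j) f X \<partial>\<mu>0)"
  using assms(3)
proof (induction j arbitrary: f)
  case 0 then show ?case by (simp add: chain_dist_def)
next
  case (Suc j)
  let ?\<nu> = "chain_dist phi lam Lam L \<mu>0 j"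
  have \<nu>: "prob_space ?\<nu>" "sets ?\<nu> = sets configM"
    using chain_dist_props[OF assms(1,2)] by auto
  interpret prob_space ?\<nu> by (rule \<nu>)
  have m: "kernel \<in> measurable ?\<nu> (subprob_algebra configM)"
    using measurable_kernel \<nu> measurable_cong_sets by blast
  have "(\<integral>X. f X \<partial>chain_dist phi lam Lam L \<mu>0 (Suc j)) = (\<integral>X. f X \<partial>bind ?\<nu> kernel)"
    by (simp add: chain_dist_def)
  also have "\<dots> = (\<integral>X. (\<integral>X'. f X' \<partial>kernel X) \<partial>?\<nu>)"
    by (rule integral_bind[OF _ _ m, where B = 1 and B' = 1])
       (use Suc.prems not_empty in
         \<open>auto simp: test_fn_measurable test_fn_bounds finite_measure_axioms prob_space.emeasure_space_1[OF prob_space_kernel]\<close>)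
  also have "\<dots> = (\<integral>X. kop f X \<partial>?\<nu>)" by (simp add: kop_def)
  also have "\<dots> = (\<integral>X. (kop ^^ j) (kop f) X \<partial>\<mu>0)"
    by (rule Suc.IH[OF test_fn_kop[OF Suc.prems]])
  finally show ?case by (simp add: funpow_swap1)
qed

section \<open>Invariance of the Gibbs law\<close>

lemma prod_list_indicator_zero:
  assumes "\<not> set b \<subseteq> B" shows "(\<Prod>x\<leftarrow>b. indicator B x * g x :: real) = 0"
  using assms by (induction b) (auto simp: indicator_def)

text \<open>Given the points \<open>a\<close> outside the ball, the weight of the points inside is
  that of the local Gibbs law: an update resamples from the conditional law.\<close>

lemma weight_local_activity:
  "supported_in (ball y L) b * ennreal (weight lam (a @ b))
    = ennreal (weight lam a) * ennreal (weight (local_activity y a) b)"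
proof (cases "set b \<subseteq> ball y L")
  case True
  then have "(\<Prod>x\<leftarrow>b. local_activity y a x) = (\<Prod>x\<leftarrow>b. lam x * field a x)"
    by (intro arg_cong[where f = prod_list] map_cong) (auto simp: local_activity_def)
  then have "weight lam (a @ b) = weight lam a * weight (local_activity y a) b"
    using field_commute[of a b] by (simp add: weight_def gibbs_factor_append prod_list_mult mult_ac)
  then show ?thesis using True by (simp add: ennreal_mult weight_nonneg lam_nonneg integrable_local_activity[unfolded integrable_activity_def])
next
  case False
  then have "(\<Prod>x\<leftarrow>b. local_activity y a x) = 0"
    unfolding local_activity_def mult.assoc by (rule prod_list_indicator_zero)
  then show ?thesis using False by (simp add: weight_def)
qed

text \<open>The heat-bath argument: split the configuration at the ball, integrate the inner points
  out, and put in fresh ones with the same conditional weight.\<close>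

lemma nn_integral_update_invariant:
  assumes g [measurable]: "g \<in> borel_measurable configM" and sym: "symmetric_fn g"
  shows "(\<integral>\<^sup>+X. (\<integral>\<^sup>+X'. g X' \<partial>update y X) \<partial>gibbs_law lam) = (\<integral>\<^sup>+X. g X \<partial>gibbs_law lam)"
proof -
  let ?B = "ball y L" and ?in = "filter (\<lambda>x. x \<in> ball y L)"
  let ?c = "ennreal (1 / partition_fn lam)"
  define h where "h a = (\<integral>\<^sup>+ys. g (a @ ys) \<partial>gibbs_law (local_activity y a))" for a
  have h_eq: "h a = ennreal (1 / partition_fn (local_activity y a)) *
      (\<integral>\<^sup>+ys. ennreal (weight (local_activity y a) ys) * g (a @ ys) \<partial>lebesgue_poisson)" for a
    unfolding h_def by (rule nn_integral_gibbs_law[OF integrable_local_activity]) measurable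
  have [measurable]: "h \<in> borel_measurable configM"
    unfolding h_eq[abs_def] by measurable
  \<comment> \<open>The integral of the inner weights produces exactly the partition function by
    which \<open>h\<close> is divided.\<close>
  have hZ: "h a * ennreal (partition_fn (local_activity y a)) =
      (\<integral>\<^sup>+ys. ennreal (weight (local_activity y a) ys) * g (a @ ys) \<partial>lebesgue_poisson)" for a
  proof -
    have "1 \<le> partition_fn (local_activity y a)" by (rule partition_fn_ge_1[OF integrable_local_activity])
    then have "ennreal (partition_fn (local_activity y a)) * ennreal (1 / partition_fn (local_activity y a)) = 1"
      by (simp add: ennreal_mult[symmetric])
    moreover have "p * q = 1 \<Longrightarrow> q * z * p = z" for p q z :: ennreal
      by (metis mult.assoc mult.commute mult.left_neutral)
    ultimately show ?thesis unfolding h_eq by blast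
  qed
  have meas_B [measurable]: "?B \<in> sets borel" by simp
  have "(\<integral>\<^sup>+X. (\<integral>\<^sup>+X'. g X' \<partial>update y X) \<partial>gibbs_law lam) = (\<integral>\<^sup>+X. h (outside y X) \<partial>gibbs_law lam)"
    by (simp add: nn_integral_update h_def)
  also have "\<dots> = ?c * (\<integral>\<^sup>+X. ennreal (weight lam X) * h (outside y X) \<partial>lebesgue_poisson)"
    by (rule nn_integral_gibbs_law[OF act]) measurable
  also have "(\<integral>\<^sup>+X. ennreal (weight lam X) * h (outside y X) \<partial>lebesgue_poisson)
     = (\<integral>\<^sup>+X. (case (outside y X, ?in X) of (a, b) \<Rightarrow> ennreal (weight lam (a @ b)) * h a) \<partial>lebesgue_poisson)"
    unfolding prod.case by (intro nn_integral_cong arg_cong2[where f = "(*)"] refl arg_cong[where f = ennreal] weight_mset_cong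
        mset_partition[symmetric])
  also have "\<dots> = (\<integral>\<^sup>+a. (\<integral>\<^sup>+b. supported_in (- ?B) a * (supported_in ?B b *
      (case (a, b) of (a, b) \<Rightarrow> ennreal (weight lam (a @ b)) * h a)) \<partial>lebesgue_poisson) \<partial>lebesgue_poisson)"
    by (rule nn_integral_lebesgue_poisson_split) measurable
  also have "\<dots> = (\<integral>\<^sup>+a. (\<integral>\<^sup>+b. supported_in (- ?B) a * (supported_in ?B b *
      (case (a, b) of (a, b) \<Rightarrow> ennreal (weight lam (a @ b)) * g (a @ b))) \<partial>lebesgue_poisson) \<partial>lebesgue_poisson)"
  proof (rule nn_integral_cong)
    fix a
    have act_meas [measurable]: "local_activity y a \<in> borel_measurable borel" by measurable
    have "(\<integral>\<^sup>+b. supported_in (- ?B) a * (supported_in ?B b *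
        (case (a, b) of (a, b) \<Rightarrow> ennreal (weight lam (a @ b)) * h a)) \<partial>lebesgue_poisson)
      = (\<integral>\<^sup>+b. supported_in (- ?B) a * ennreal (weight lam a) * h a * ennreal (weight (local_activity y a) b) \<partial>lebesgue_poisson)"
      unfolding prod.case mult.assoc[symmetric, of "supported_in ?B _"] weight_local_activity by (simp add: mult_ac)
    also have "\<dots> = supported_in (- ?B) a * ennreal (weight lam a) * (h a * ennreal (partition_fn (local_activity y a)))"
      by (simp add: nn_integral_cmult nn_integral_weight[OF integrable_local_activity] mult.assoc)
    also have "\<dots> = (\<integral>\<^sup>+b. supported_in (- ?B) a * ennreal (weight lam a) * (ennreal (weight (local_activity y a) b) * g (a @ b)) \<partial>lebesgue_poisson)"
      unfolding hZ by (rule nn_integral_cmult[symmetric]) measurable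
    also have "\<dots> = (\<integral>\<^sup>+b. supported_in (- ?B) a * (supported_in ?B b *
        (case (a, b) of (a, b) \<Rightarrow> ennreal (weight lam (a @ b)) * g (a @ b))) \<partial>lebesgue_poisson)"
      unfolding prod.case mult.assoc[symmetric, of "supported_in ?B _"] weight_local_activity by (simp add: mult_ac)
    finally show "(\<integral>\<^sup>+b. supported_in (- ?B) a * (supported_in ?B b *
        (case (a, b) of (a, b) \<Rightarrow> ennreal (weight lam (a @ b)) * h a)) \<partial>lebesgue_poisson) =
      (\<integral>\<^sup>+b. supported_in (- ?B) a * (supported_in ?B b *
        (case (a, b) of (a, b) \<Rightarrow> ennreal (weight lam (a @ b)) * g (a @ b))) \<partial>lebesgue_poisson)" .
  qed
  also have "\<dots> = (\<integral>\<^sup>+X. (case (outside y X, ?in X) of (a, b) \<Rightarrow> ennreal (weight lam (a @ b)) * g (a @ b)) \<partial>lebesgue_poisson)"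
    by (rule nn_integral_lebesgue_poisson_split[symmetric]) measurable
  also have "\<dots> = (\<integral>\<^sup>+X. ennreal (weight lam X) * g X \<partial>lebesgue_poisson)"
    unfolding prod.case by (intro nn_integral_cong arg_cong2[where f = "(*)"] arg_cong[where f = ennreal] weight_mset_cong
        symmetric_fnD[OF sym] mset_partition)
  also have "?c * \<dots> = (\<integral>\<^sup>+X. g X \<partial>gibbs_law lam)"
    by (rule nn_integral_gibbs_law[OF act, symmetric]) measurable
  finally show ?thesis .
qed

text \<open>Averaging over the centre keeps the invariance by Fubini, which is applied to
  nonnegative integrals and then read back for real ones.\<close>

lemma integral_kop_invariant:
  assumes f: "test_fn f"
  shows "(\<integral>X. kop f X \<partial>gibbs_law lam) = (\<integral>X. f X \<partial>gibbs_law lam)"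
proof -
  interpret G: prob_space "gibbs_law lam" by (rule prob_space_gibbs_law[OF act])
  interpret U: prob_space unif by (rule prob_space_unif)
  interpret P: pair_sigma_finite "gibbs_law lam" unif by standard
  note [measurable] = test_fn_measurable[OF f] test_fn_measurable[OF test_fn_kop[OF f]]
  have nn: "ennreal (kop f X) = (\<integral>\<^sup>+y. (\<integral>\<^sup>+X'. f X' \<partial>update y X) \<partial>unif)" for X
  proof -
    interpret K: prob_space "kernel X" by (rule prob_space_kernel)
    have fk: "f \<in> borel_measurable (kernel X)"
      by (rule measurable_from_kernel) measurable
    have "ennreal (kop f X) = (\<integral>\<^sup>+X'. f X' \<partial>kernel X)"
      unfolding kop_def using fk
      by (intro nn_integral_eq_integral[symmetric] integrable_bounded K.prob_space_axioms)
         (simp_all add: test_fn_bounds[OF f])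
    also have "\<dots> = (\<integral>\<^sup>+y. (\<integral>\<^sup>+X'. f X' \<partial>update y X) \<partial>unif)"
      unfolding block_kernel_eq by (rule nn_integral_bind[OF _ measurable_update_fst]) measurable
    finally show ?thesis .
  qed
  have meas: "(\<lambda>(X, y). \<integral>\<^sup>+X'. f X' \<partial>update y X) \<in> borel_measurable (gibbs_law lam \<Otimes>\<^sub>M unif)"
  proof -
    have "(\<lambda>p. update (snd p) (fst p)) \<in> measurable (gibbs_law lam \<Otimes>\<^sub>M unif) (subprob_algebra configM)"
      using measurable_compose[OF _ measurable_update, of "\<lambda>p. (snd p, fst p)" "gibbs_law lam \<Otimes>\<^sub>M unif"]
      by (simp add: case_prod_beta)
    from measurable_compose[OF this nn_integral_measurable_subprob_algebra[of f]]
    show ?thesis by (simp add: case_prod_beta)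
  qed
  have sym: "symmetric_fn (\<lambda>X. ennreal (f X))"
    unfolding symmetric_fn_def using test_fn_sym[OF f] by metis
  have "ennreal (\<integral>X. kop f X \<partial>gibbs_law lam) = (\<integral>\<^sup>+X. kop f X \<partial>gibbs_law lam)"
    by (intro nn_integral_eq_integral[symmetric] integrable_bounded G.prob_space_axioms)
       (simp_all add: test_fn_bounds[OF test_fn_kop[OF f]])
  also have "\<dots> = (\<integral>\<^sup>+X. (\<integral>\<^sup>+y. (\<integral>\<^sup>+X'. f X' \<partial>update y X) \<partial>unif) \<partial>gibbs_law lam)"
    by (simp add: nn)
  also have "\<dots> = (\<integral>\<^sup>+y. (\<integral>\<^sup>+X. (\<integral>\<^sup>+X'. f X' \<partial>update y X) \<partial>gibbs_law lam) \<partial>unif)"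
    by (rule P.Fubini'[symmetric, OF meas])
  also have "\<dots> = (\<integral>\<^sup>+y. (\<integral>\<^sup>+X. f X \<partial>gibbs_law lam) \<partial>unif)"
    by (intro nn_integral_cong nn_integral_update_invariant sym) measurable
  also have "\<dots> = (\<integral>\<^sup>+X. f X \<partial>gibbs_law lam)"
    using U.emeasure_space_1 by simp
  also have "\<dots> = ennreal (\<integral>X. f X \<partial>gibbs_law lam)"
    by (intro nn_integral_eq_integral integrable_bounded G.prob_space_axioms)
       (simp_all add: test_fn_bounds[OF f])
  finally show ?thesis
    by (simp add: test_fn_bounds[OF f] test_fn_bounds[OF test_fn_kop[OF f]])
qed

lemma integral_kop_iter_invariant:
  assumes "test_fn f"
  shows "(\<integral>X. (kop ^^ j) f X \<partial>gibbs_law lam) = (\<integral>X. f X \<partial>gibbs_law lam)"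
  by (induction j) (simp_all add: integral_kop_invariant test_fn_kop_iter assms)

end

section \<open>Cells, oscillation and total variation\<close>

text \<open>The lower corner of the half-open unit cube around \<open>x\<close> serves as the name
  of that cube.\<close>

definition cell :: "'a::euclidean_space \<Rightarrow> 'a" where
  "cell x = (\<Sum>b\<in>Basis. of_int \<lfloor>x \<bullet> b\<rfloor> *\<^sub>R b)"

lemma cell_inner: "b \<in> Basis \<Longrightarrow> cell x \<bullet> b = of_int \<lfloor>x \<bullet> b\<rfloor>"
  by (simp add: cell_def)

text \<open>Bounding the norm by the sum of the coordinates gives diameter \<open>DIM('a)\<close>.
  This is the origin of the \<open>DIM('a)\<close> that is added to or subtracted from the radii
  below.\<close>

lemma dist_same_cell:
  fixes x y :: "'a::euclidean_space"
  assumes "cell x = cell y"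
  shows "dist x y \<le> DIM('a)"
proof -
  have "\<bar>(x - y) \<bullet> b\<bar> \<le> 1" if b: "b \<in> Basis" for b
  proof -
    have "\<lfloor>x \<bullet> b\<rfloor> = \<lfloor>y \<bullet> b\<rfloor>"
      using cell_inner[OF b, of x] cell_inner[OF b, of y] assms by simp
    then show ?thesis unfolding inner_diff_left by linarith
  qed
  then have "(\<Sum>b\<in>Basis. \<bar>(x - y) \<bullet> b\<bar>) \<le> (\<Sum>b\<in>(Basis::'a set). 1)" by (rule sum_mono)
  then show ?thesis using norm_le_l1[of "x - y"] by (simp add: dist_norm)
qed

lemma finite_card_cell_image:
  fixes S :: "'a::euclidean_space set"
  assumes b: "\<And>x b. x \<in> S \<Longrightarrow> b \<in> Basis \<Longrightarrow> lo b \<le> \<lfloor>x \<bullet> b\<rfloor> \<and> \<lfloor>x \<bullet> b\<rfloor> \<le> hi b"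
    and m: "\<And>b. b \<in> Basis \<Longrightarrow> of_int (hi b) - of_int (lo b) + 1 \<le> m" and "0 \<le> m"
  shows "finite (cell ` S) \<and> real (card (cell ` S)) \<le> m ^ DIM('a)"
proof -
  let ?P = "PiE (Basis::'a set) (\<lambda>b. {lo b..hi b})"
  have "cell ` S \<subseteq> (\<lambda>g. \<Sum>b\<in>Basis. of_int (g b) *\<^sub>R b) ` ?P"
  proof
    fix k assume "k \<in> cell ` S"
    then obtain x where x: "x \<in> S" "k = cell x" by auto
    then have "k = (\<lambda>g. \<Sum>b\<in>Basis. of_int (g b) *\<^sub>R b) (restrict (\<lambda>b. \<lfloor>x \<bullet> b\<rfloor>) Basis)"
      by (simp add: cell_def)
    moreover have "restrict (\<lambda>b. \<lfloor>x \<bullet> b\<rfloor>) Basis \<in> ?P" using b[OF x(1)] by auto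
    ultimately show "k \<in> (\<lambda>g. \<Sum>b\<in>Basis. of_int (g b) *\<^sub>R b) ` ?P" by (rule image_eqI)
  qed
  moreover have fin: "finite ?P" by (intro finite_PiE) auto
  ultimately have 1: "finite (cell ` S)" "card (cell ` S) \<le> card ?P"
    using finite_surj surj_card_le by blast+
  have "real (card ?P) = (\<Prod>b\<in>(Basis::'a set). real (card {lo b..hi b}))"
    by (simp add: card_PiE)
  also have "\<dots> \<le> (\<Prod>b\<in>(Basis::'a set). m)"
  proof (intro prod_mono conjI)
    fix b :: 'a assume b: "b \<in> Basis"
    have "real (nat (hi b - lo b + 1)) \<le> m" using m[OF b] \<open>0 \<le> m\<close> by linarith
    then show "real (card {lo b..hi b}) \<le> m" by (simp add: add.commute diff_add_eq)
  qed simp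
  finally show ?thesis using 1 by simp
qed

text \<open>In each coordinate the floors run through an interval of length 2R, which meets at most
  2R + 2 of them.\<close>

lemma card_cell_cball:
  fixes z :: "'a::euclidean_space"
  assumes "0 \<le> R"
  shows "finite (cell ` cball z R) \<and> real (card (cell ` cball z R)) \<le> (2 * R + 2) ^ DIM('a)"
proof (rule finite_card_cell_image[where lo = "\<lambda>b. \<lfloor>z \<bullet> b - R\<rfloor>" and hi = "\<lambda>b. \<lfloor>z \<bullet> b + R\<rfloor>"])
  fix x b :: 'a assume "x \<in> cball z R" "b \<in> Basis"
  then have "\<bar>(x - z) \<bullet> b\<bar> \<le> R"
    using Basis_le_norm[of b "x - z"] by (simp add: dist_norm norm_minus_commute)
  then have "z \<bullet> b - R \<le> x \<bullet> b" "x \<bullet> b \<le> z \<bullet> b + R"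
    by (auto simp: inner_diff_left)
  then show "\<lfloor>z \<bullet> b - R\<rfloor> \<le> \<lfloor>x \<bullet> b\<rfloor> \<and> \<lfloor>x \<bullet> b\<rfloor> \<le> \<lfloor>z \<bullet> b + R\<rfloor>"
    by (auto intro: floor_mono)
next
  fix b :: 'a
  show "of_int \<lfloor>z \<bullet> b + R\<rfloor> - of_int \<lfloor>z \<bullet> b - R\<rfloor> + 1 \<le> 2 * R + 2" by linarith
qed (use assms in simp)

text \<open>Equality as multisets outside the cells in \<open>T\<close>. Within \<open>T\<close> the
  two configurations may differ arbitrarily, also in their number of points.\<close>

definition agree_off :: "'a::euclidean_space set \<Rightarrow> 'a list \<Rightarrow> 'a list \<Rightarrow> bool" where
  "agree_off T X X' \<longleftrightarrow> mset (filter (\<lambda>x. cell x \<notin> T) X) = mset (filter (\<lambda>x. cell x \<notin> T) X')"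

lemma agree_off_filter:
  assumes "agree_off T X X'"
  shows "agree_off T (filter P X) (filter P X')"
proof -
  have "mset (filter (\<lambda>x. cell x \<notin> T) (filter P Y)) = filter_mset P (mset (filter (\<lambda>x. cell x \<notin> T) Y))" for Y
    by (simp add: filter_filter_mset conj_commute)
  then show ?thesis using assms by (simp add: agree_off_def)
qed

lemma agree_off_append:
  "agree_off T X X' \<Longrightarrow> agree_off T Y Y' \<Longrightarrow> agree_off T (X @ Y) (X' @ Y')"
  by (simp add: agree_off_def)

lemma agree_off_refl [simp]: "agree_off T X X"
  by (simp add: agree_off_def)

lemma agree_off_sym: "agree_off T X X' \<Longrightarrow> agree_off T X' X"
  by (simp add: agree_off_def)

lemma agree_off_mono:
  assumes "agree_off T X X'" "T \<subseteq> T'"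
  shows "agree_off T' X X'"
proof -
  have "mset (filter (\<lambda>x. cell x \<notin> T') Y) = filter_mset (\<lambda>x. cell x \<notin> T') (mset (filter (\<lambda>x. cell x \<notin> T) Y))" for Y
    unfolding mset_filter filter_filter_mset using assms(2) by (intro filter_mset_cong) auto
  then show ?thesis using assms(1) by (simp only: agree_off_def)
qed

lemma agree_off_filter_self:
  assumes "\<And>x. x \<in> set Y \<Longrightarrow> \<not> P x \<Longrightarrow> cell x \<in> T"
  shows "agree_off T Y (filter P Y)"
proof -
  have "filter (\<lambda>x. cell x \<notin> T) Y = filter (\<lambda>x. cell x \<notin> T) (filter P Y)"
    using assms by (auto intro!: filter_cong)
  then show ?thesis by (simp only: agree_off_def)
qed

text \<open>A Lipschitz condition for the distance that counts the cells of disagreement. A cell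
  counts once, however many points it holds, so a bounded region has bounded diameter.\<close>

definition oscillation_le :: "'a::euclidean_space set \<Rightarrow> ('a list \<Rightarrow> real) \<Rightarrow> real \<Rightarrow> bool" where
  "oscillation_le S f \<delta> \<longleftrightarrow> (\<forall>X X' k. set X \<subseteq> S \<longrightarrow> set X' \<subseteq> S \<longrightarrow> agree_off {k} X X' \<longrightarrow> \<bar>f X - f X'\<bar> \<le> \<delta>)"

lemma oscillation_leD:
  "oscillation_le S f \<delta> \<Longrightarrow> set X \<subseteq> S \<Longrightarrow> set X' \<subseteq> S \<Longrightarrow> agree_off {k} X X' \<Longrightarrow> \<bar>f X - f X'\<bar> \<le> \<delta>"
  unfolding oscillation_le_def by blast

lemma oscillation_le_nonneg: "oscillation_le S f \<delta> \<Longrightarrow> 0 \<le> \<delta>"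
  using oscillation_leD[of S f \<delta> "[]" "[]"] by simp

text \<open>Interpolating between two configurations one cell at a time.\<close>
lemma oscillation_many_cells:
  fixes f :: "'a::euclidean_space list \<Rightarrow> real"
  assumes osc: "oscillation_le S f \<delta>" and sym: "symmetric_fn f"
    and "finite T" "set X \<subseteq> S" "set X' \<subseteq> S" "agree_off T X X'"
  shows "\<bar>f X - f X'\<bar> \<le> real (card T) * \<delta>"
  using assms(3-)
proof (induction T arbitrary: X rule: finite_induct)
  case empty
  then have "f X = f X'" by (intro symmetric_fnD[OF sym]) (simp add: agree_off_def)
  then show ?case by simp
next
  case (insert k T)
  \<comment> \<open>\<open>Y\<close> takes the cell \<open>k\<close> from \<open>X'\<close> and
    everything else from \<open>X\<close>, so it differs from \<open>X\<close> only in
    \<open>k\<close> and from \<open>X'\<close> only in \<open>T\<close>.\<close>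
  define Y where "Y = filter (\<lambda>x. cell x \<noteq> k) X @ filter (\<lambda>x. cell x = k) X'"
  have Y: "set Y \<subseteq> S" using insert.prems by (auto simp: Y_def)
  have "agree_off {k} X Y" by (simp add: agree_off_def Y_def)
  then have 1: "\<bar>f X - f Y\<bar> \<le> \<delta>"
    using insert.prems(1) Y by (intro oscillation_leD[OF osc])
  have "mset (filter (\<lambda>x. cell x \<notin> T) Y) = mset (filter (\<lambda>x. cell x \<notin> T) X')"
  proof -
    have "mset (filter (\<lambda>x. cell x \<notin> T) Y)
      = mset (filter (\<lambda>x. cell x \<notin> insert k T) X) + mset (filter (\<lambda>x. cell x = k) X')"
      unfolding Y_def using insert.hyps(2)
      by (auto intro!: arg_cong2[where f = "(+)"] filter_mset_cong)
    also have "\<dots> = mset (filter (\<lambda>x. cell x \<notin> insert k T) X') + mset (filter (\<lambda>x. cell x = k) X')"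
      using insert.prems(3) by (simp only: agree_off_def)
    also have "\<dots> = mset (filter (\<lambda>x. cell x \<notin> T) X')"
      using insert.hyps(2) by (induction X') auto
    finally show ?thesis .
  qed
  then have "agree_off T Y X'" by (simp only: agree_off_def)
  from insert.IH[OF Y insert.prems(2) this] have "\<bar>f Y - f X'\<bar> \<le> real (card T) * \<delta>" .
  then show ?case using 1 insert.hyps by (simp add: algebra_simps)
qed

section \<open>Total variation tested against symmetric functions\<close>

lemma sum_thresholds:
  assumes "0 \<le> t" "t \<le> real n"
  shows "(\<Sum>i=1..n. if real i \<le> t then 1 else 0 :: real) = of_int \<lfloor>t\<rfloor>"
proof -
  have "{i \<in> {1..n}. real i \<le> t} = {1..nat \<lfloor>t\<rfloor>}"
    using assms by (auto simp: le_nat_floor le_floor_iff nat_le_iff) linarith+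
  then have "card {i \<in> {1..n}. real i \<le> t} = nat \<lfloor>t\<rfloor>" by simp
  then show ?thesis using assms by (simp add: sum.If_cases Int_def)
qed

lemma tv_dist_ge:
  fixes M N :: "'a::euclidean_space list measure"
  assumes "prob_space M" "prob_space N" "A \<in> sets configM" "sym_event A"
  shows "\<bar>measure M A - measure N A\<bar> \<le> tv_dist M N"
  unfolding tv_dist_def
proof (rule cSUP_upper)
  show "A \<in> {A \<in> sets configM. sym_event A}" using assms by simp
  have "\<bar>measure M A - measure N A\<bar> \<le> 1" for A
    using prob_space.prob_le_1[OF assms(1), of A] prob_space.prob_le_1[OF assms(2), of A]
      measure_nonneg[of M A] measure_nonneg[of N A] by linarith
  then show "bdd_above ((\<lambda>A. \<bar>measure M A - measure N A\<bar>) ` {A \<in> sets configM. sym_event A})"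
    by (intro bdd_aboveI2[where M = 1])
qed

text \<open>The integral of a function with values in the unit interval is approximated by averages of
  measures of its superlevel sets.\<close>
lemma integral_diff_le_tv_dist_unit:
  fixes M N :: "'a::euclidean_space list measure"
  assumes M: "prob_space M" "sets M = sets configM" and N: "prob_space N" "sets N = sets configM"
    and H [measurable]: "H \<in> borel_measurable configM" and b: "\<And>X. 0 \<le> H X \<and> H X \<le> (1::real)"
    and sym: "symmetric_fn H"
  shows "\<bar>(\<integral>X. H X \<partial>M) - (\<integral>X. H X \<partial>N)\<bar> \<le> tv_dist M N"
proof -
  let ?A = "\<lambda>n i. {X. real i \<le> real n * H X}"
  have A: "?A n i \<in> sets configM" for n i
  proof -
    have "Measurable.pred configM (\<lambda>X. real i \<le> real n * H X)" by measurable
    then show ?thesis by (simp add: pred_def)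
  qed
  have "sym_event (?A n i)" for n i
    unfolding sym_event_def
  proof (intro allI impI)
    fix xs ys :: "'a list" assume "mset xs = mset ys"
    then have "H xs = H ys" by (rule symmetric_fnD[OF sym])
    then show "xs \<in> ?A n i \<longleftrightarrow> ys \<in> ?A n i" by simp
  qed
  then have tv: "\<bar>measure M (?A n i) - measure N (?A n i)\<bar> \<le> tv_dist M N" for n i
    by (intro tv_dist_ge M N A)
  have approx: "(\<Sum>i=1..n. measure Q (?A n i)) \<le> real n * (\<integral>X. H X \<partial>Q) \<and>
      real n * (\<integral>X. H X \<partial>Q) \<le> (\<Sum>i=1..n. measure Q (?A n i)) + 1"
    if Q: "prob_space Q" "sets Q = sets configM" for Q :: "'a list measure" and n
  proof -
    interpret prob_space Q by fact
    note [measurable_cong] = Q(2)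
    have sp: "space Q = UNIV" using sets_eq_imp_space_eq[OF Q(2)] by simp
    have intH: "integrable Q H" using b by (intro integrable_bounded Q) auto
    have AQ: "?A n i \<in> sets Q" for i using A Q(2) by simp
    have ind: "integrable Q (indicat_real (?A n i))" for i
      using AQ by (intro integrable_real_indicator) (auto simp: emeasure_eq_measure)
    have sum: "(\<Sum>i=1..n. indicat_real (?A n i) X) = of_int \<lfloor>real n * H X\<rfloor>" for X
    proof -
      have "(\<Sum>i=1..n. indicat_real (?A n i) X) = (\<Sum>i=1..n. if real i \<le> real n * H X then 1 else 0)"
        by (intro sum.cong) (auto simp: indicator_def)
      then show ?thesis using sum_thresholds[of "real n * H X" n] b[of X] by (simp add: mult_left_le)
    qed
    have "(\<Sum>i=1..n. measure Q (?A n i)) = (\<integral>X. (\<Sum>i=1..n. indicat_real (?A n i) X) \<partial>Q)"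
      using ind by (simp add: sp)
    moreover have intS: "integrable Q (\<lambda>X. \<Sum>i=1..n. indicat_real (?A n i) X)"
      using ind by (intro Bochner_Integration.integrable_sum)
    moreover have "(\<integral>X. (\<Sum>i=1..n. indicat_real (?A n i) X) \<partial>Q) \<le> (\<integral>X. real n * H X \<partial>Q)"
    proof (rule integral_mono[OF intS])
      show "(\<Sum>i=1..n. indicat_real (?A n i) X) \<le> real n * H X" for X
        unfolding sum by (rule of_int_floor_le)
    qed (use intH in simp)
    moreover have "(\<integral>X. real n * H X \<partial>Q) \<le> (\<integral>X. (\<Sum>i=1..n. indicat_real (?A n i) X) + 1 \<partial>Q)"
    proof (rule integral_mono)
      show "real n * H X \<le> (\<Sum>i=1..n. indicat_real (?A n i) X) + 1" for X
        unfolding sum by linarith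
    qed (use intH intS in simp_all)
    moreover have "(\<integral>X. (\<Sum>i=1..n. indicat_real (?A n i) X) + 1 \<partial>Q) = (\<integral>X. (\<Sum>i=1..n. indicat_real (?A n i) X) \<partial>Q) + 1"
      by (subst Bochner_Integration.integral_add[OF intS]) (simp_all add: prob_space)
    ultimately show ?thesis by simp
  qed
  let ?d = "\<bar>(\<integral>X. H X \<partial>M) - (\<integral>X. H X \<partial>N)\<bar>"
  \<comment> \<open>For each law, rounding down costs between 0 and 1 after multiplication by n, so
    the difference of the two costs at most 1. Dividing by a large n removes it.\<close>
  have bound: "real n * ?d \<le> real n * tv_dist M N + 1" for n
  proof -
    have "\<bar>(\<Sum>i=1..n. measure M (?A n i)) - (\<Sum>i=1..n. measure N (?A n i))\<bar>
      \<le> (\<Sum>i=1..n. \<bar>measure M (?A n i) - measure N (?A n i)\<bar>)"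
      unfolding sum_subtractf[symmetric] by (rule sum_abs)
    also have "\<dots> \<le> (\<Sum>i=1..n. tv_dist M N)" by (intro sum_mono tv)
    finally have "\<bar>(\<Sum>i=1..n. measure M (?A n i)) - (\<Sum>i=1..n. measure N (?A n i))\<bar> \<le> real n * tv_dist M N"
      by simp
    with approx[OF M, of n] approx[OF N, of n]
    have "\<bar>real n * (\<integral>X. H X \<partial>M) - real n * (\<integral>X. H X \<partial>N)\<bar> \<le> real n * tv_dist M N + 1" by linarith
    then show ?thesis by (simp add: right_diff_distrib[symmetric] abs_mult)
  qed
  show ?thesis
  proof (rule ccontr)
    assume "\<not> ?thesis"
    then have "0 < ?d - tv_dist M N" by simp
    then obtain n where "1 < real n * (?d - tv_dist M N)"
      using reals_Archimedean3 by blast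
    then show False using bound[of n] by (simp add: right_diff_distrib)
  qed
qed

text \<open>Rescaling the range of \<open>H\<close> affinely to the unit interval costs its width
  \<open>2 * m\<close>. Only the deviation from \<open>c\<close> enters, which later makes the
  mixing error proportional to the oscillation.\<close>

lemma integral_diff_le_tv_dist:
  fixes M N :: "'a::euclidean_space list measure"
  assumes M: "prob_space M" "sets M = sets configM" and N: "prob_space N" "sets N = sets configM"
    and H [measurable]: "H \<in> borel_measurable configM" and b: "\<And>X. \<bar>H X - c\<bar> \<le> (m::real)"
    and sym: "symmetric_fn H"
  shows "\<bar>(\<integral>X. H X \<partial>M) - (\<integral>X. H X \<partial>N)\<bar> \<le> 2 * m * tv_dist M N"
proof -
  have m: "0 \<le> m" using b[of undefined] by linarith
  interpret M: prob_space M by fact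
  interpret N: prob_space N by fact
  show ?thesis
  proof (cases "m = 0")
    case True
    then have "H = (\<lambda>_. c)" using b by (auto intro!: ext)
    then show ?thesis using True by (simp add: M.prob_space N.prob_space)
  next
    case False
    with m have m: "0 < m" by simp
    define G where "G X = (H X - (c - m)) / (2 * m)" for X
    have [measurable]: "G \<in> borel_measurable configM" unfolding G_def by measurable
    have Gb: "0 \<le> G X \<and> G X \<le> 1" for X
      using b[of X] m by (auto simp: G_def abs_le_iff field_simps)
    have "symmetric_fn G" unfolding symmetric_fn_def G_def using symmetric_fnD[OF sym] by metis
    then have d: "\<bar>(\<integral>X. G X \<partial>M) - (\<integral>X. G X \<partial>N)\<bar> \<le> tv_dist M N"
      using Gb by (intro integral_diff_le_tv_dist_unit M N) auto
    have "(\<integral>X. H X \<partial>Q) = 2 * m * (\<integral>X. G X \<partial>Q) + (c - m)"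
      if Q: "prob_space Q" "sets Q = sets configM" for Q :: "'a list measure"
    proof -
      interpret prob_space Q by fact
      note [measurable_cong] = Q(2)
      have "integrable Q G" using Gb by (intro integrable_bounded Q) auto
      moreover have "H X = 2 * m * G X + (c - m)" for X using m by (simp add: G_def)
      ultimately show ?thesis by (simp add: prob_space)
    qed
    from this[OF M] this[OF N]
    have "(\<integral>X. H X \<partial>M) - (\<integral>X. H X \<partial>N) = 2 * m * ((\<integral>X. G X \<partial>M) - (\<integral>X. G X \<partial>N))"
      by (simp add: right_diff_distrib)
    then show ?thesis using d m by (simp add: abs_mult)
  qed
qed

section \<open>Contraction of the oscillation\<close>

text \<open>The contraction towards \<open>z\<close> with ratio
  \<open>\<rho>\<^sub>1 / \<rho>\<^sub>2\<close> maps the large ball into the small one and stays in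
  \<open>S\<close> by convexity. This compares volumes of balls cut by the boundary of
  \<open>S\<close>.\<close>

lemma measure_ball_scale:
  fixes S :: "'a::euclidean_space set"
  assumes [measurable]: "S \<in> sets borel" and S: "convex S" "z \<in> S" and \<rho>: "0 < \<rho>\<^sub>1" "\<rho>\<^sub>1 \<le> \<rho>\<^sub>2"
  shows "measure lborel (ball z \<rho>\<^sub>2 \<inter> S) \<le> (\<rho>\<^sub>2 / \<rho>\<^sub>1) ^ DIM('a) * measure lborel (ball z \<rho>\<^sub>1 \<inter> S)"
proof -
  define t where "t = \<rho>\<^sub>1 / \<rho>\<^sub>2"
  have t: "0 < t" "t \<le> 1" using \<rho> by (auto simp: t_def)
  define T where "T x = (z - t *\<^sub>R z) + t *\<^sub>R x" for x
  let ?A1 = "ball z \<rho>\<^sub>1 \<inter> S" and ?A2 = "ball z \<rho>\<^sub>2 \<inter> S"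
  have [measurable]: "?A1 \<in> sets borel" "?A2 \<in> sets borel" "T \<in> borel_measurable borel"
    by (auto simp: T_def[abs_def])
  have sub: "?A2 \<subseteq> T -` ?A1"
  proof
    fix x assume x: "x \<in> ?A2"
    have Tx: "T x = (1 - t) *\<^sub>R z + t *\<^sub>R x" by (simp add: T_def algebra_simps)
    have "T x \<in> S" unfolding Tx using x S t by (intro convexD) auto
    moreover have "z - T x = t *\<^sub>R (z - x)" by (simp add: T_def algebra_simps)
    then have "dist z (T x) = t * dist z x" using t by (simp add: dist_norm)
    moreover have "t * dist z x < \<rho>\<^sub>1"
      using x \<rho> t mult_strict_left_mono[of "dist z x" \<rho>\<^sub>2 t] by (simp add: t_def)
    ultimately show "x \<in> T -` ?A1" by simp
  qed
  have fin1: "emeasure lborel ?A1 < \<infinity>"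
    by (rule le_less_trans[OF emeasure_mono emeasure_lborel_ball_finite[of z \<rho>\<^sub>1]]) auto
  have fin2: "emeasure lborel ?A2 < \<infinity>"
    by (rule le_less_trans[OF emeasure_mono emeasure_lborel_ball_finite[of z \<rho>\<^sub>2]]) auto
  have "lborel = density (distr lborel borel T) (\<lambda>_. ennreal (\<bar>t\<bar> ^ DIM('a)))"
    unfolding T_def[abs_def] using t by (intro lborel_affine) simp
  then have "emeasure lborel ?A1 = emeasure (density (distr lborel borel T) (\<lambda>_. ennreal (\<bar>t\<bar> ^ DIM('a)))) ?A1"
    by (rule arg_cong[where f = "\<lambda>M. emeasure M ?A1"])
  also have "\<dots> = ennreal (t ^ DIM('a)) * emeasure lborel (T -` ?A1)"
    using t by (subst emeasure_density) (auto simp: emeasure_distr nn_integral_cmult_indicator)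
  also have "\<dots> \<ge> ennreal (t ^ DIM('a)) * emeasure lborel ?A2"
    using measurable_sets[of T borel borel ?A1] by (intro mult_left_mono emeasure_mono sub) auto
  finally have "ennreal (t ^ DIM('a)) * ennreal (measure lborel ?A2) \<le> ennreal (measure lborel ?A1)"
    using fin1 fin2 by (simp add: emeasure_eq_ennreal_measure less_top)
  then have "t ^ DIM('a) * measure lborel ?A2 \<le> measure lborel ?A1"
    using t by (simp add: ennreal_mult[symmetric])
  then have "measure lborel ?A2 \<le> (1 / t) ^ DIM('a) * measure lborel ?A1"
    using t by (simp add: field_simps)
  then show ?thesis by (simp add: t_def)
qed

section \<open>Volume of balls cut by the box\<close>

lemma box_n_inner: "x \<in> box_n n \<longleftrightarrow> (\<forall>b\<in>Basis. - real n \<le> x \<bullet> b \<and> x \<bullet> b \<le> real n)"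
  by (auto simp: box_n_def mem_box)

lemma measure_ball_box_ge_1:
  fixes z :: "'a::euclidean_space"
  assumes z: "z \<in> box_n n" and n: "1 \<le> n" and \<rho>: "real DIM('a) < \<rho>"
  shows "1 \<le> measure lborel (ball z \<rho> \<inter> box_n n)"
proof -
  \<comment> \<open>The lower corner of a unit cube that touches \<open>z\<close> and extends in
    each coordinate towards the centre of the box. It fits because the half side is at least
    1.\<close>
  define l where "l = (\<Sum>b\<in>Basis. (if z \<bullet> b \<le> 0 then z \<bullet> b else z \<bullet> b - 1) *\<^sub>R b)"
  have l: "l \<bullet> b = (if z \<bullet> b \<le> 0 then z \<bullet> b else z \<bullet> b - 1)" if "b \<in> Basis" for b
    using that by (simp add: l_def)
  have n': "1 \<le> real n" using n by simp
  have "cbox l (l + One) \<subseteq> ball z \<rho> \<inter> box_n n"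
  proof
    fix x assume "x \<in> cbox l (l + One)"
    then have x: "l \<bullet> b \<le> x \<bullet> b" "x \<bullet> b \<le> l \<bullet> b + 1" if "b \<in> Basis" for b
      using that by (auto simp: mem_box inner_add_left)
    have "\<bar>(z - x) \<bullet> b\<bar> \<le> 1" if "b \<in> Basis" for b
      using x[OF that] l[OF that] by (auto simp: inner_diff_left split: if_splits)
    then have "(\<Sum>b\<in>Basis. \<bar>(z - x) \<bullet> b\<bar>) \<le> (\<Sum>b\<in>(Basis::'a set). 1)" by (rule sum_mono)
    then have "dist z x < \<rho>" using norm_le_l1[of "z - x"] \<rho> by (simp add: dist_norm)
    moreover have "x \<in> box_n n"
      unfolding box_n_inner
    proof
      fix b :: 'a assume b: "b \<in> Basis"
      have "- real n \<le> z \<bullet> b" "z \<bullet> b \<le> real n" using z b by (auto simp: box_n_inner)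
      moreover have lb: "(l \<bullet> b = z \<bullet> b \<and> z \<bullet> b \<le> 0) \<or> (l \<bullet> b = z \<bullet> b - 1 \<and> 0 < z \<bullet> b)"
        using l[OF b] by auto
      ultimately show "- real n \<le> x \<bullet> b \<and> x \<bullet> b \<le> real n"
        using x[OF b] lb n' by linarith
    qed
    ultimately show "x \<in> ball z \<rho> \<inter> box_n n" by simp
  qed
  moreover have "measure lborel (cbox l (l + One)) = 1"
    by (subst measure_lborel_cbox_eq) (simp add: inner_add_left)
  moreover have "ball z \<rho> \<inter> box_n n \<in> fmeasurable lborel"
    by (intro fmeasurableI emeasure_bounded_finite) (auto simp: box_n_def)
  ultimately show ?thesis
    using measure_mono_fmeasurable[of "cbox l (l + One)" "ball z \<rho> \<inter> box_n n" lborel] by simp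
qed

lemma integral_diff_bound:
  assumes Q: "prob_space Q" and u: "u \<in> borel_measurable Q" "\<And>x. 0 \<le> u x \<and> u x \<le> (1::real)"
    and v: "v \<in> borel_measurable Q" "\<And>x. 0 \<le> v x \<and> v x \<le> (1::real)"
    and c: "AE x in Q. \<bar>u x - v x\<bar> \<le> c"
  shows "\<bar>(\<integral>x. u x \<partial>Q) - (\<integral>x. v x \<partial>Q)\<bar> \<le> c"
proof -
  interpret prob_space Q by fact
  have i: "integrable Q u" "integrable Q v" using integrable_bounded[OF Q] u v by blast+
  have "\<bar>(\<integral>x. u x \<partial>Q) - (\<integral>x. v x \<partial>Q)\<bar> = \<bar>\<integral>x. u x - v x \<partial>Q\<bar>" using i by simp
  also have "\<dots> \<le> (\<integral>x. \<bar>u x - v x\<bar> \<partial>Q)" by (rule integral_abs_bound)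
  also have "\<dots> \<le> c" using i c by (intro integral_le_const) auto
  finally show ?thesis .
qed

context repulsive
begin

lemma field_filter:
  assumes "\<And>w. w \<in> set a \<Longrightarrow> \<not> P w \<Longrightarrow> r < dist x w"
  shows "field (filter P a) x = field a x"
  using assms by (induction a) (auto simp: field_Cons boltz_far)

lemma field_agree_off:
  assumes "agree_off {k} a a'" and "\<And>w. cell w = k \<Longrightarrow> r < dist x w"
  shows "field a x = field a' x"
proof -
  have "field a x = field (filter (\<lambda>w. cell w \<notin> {k}) a) x" for a
    using assms(2) by (intro field_filter[symmetric]) auto
  then show ?thesis
    using field_mset_cong[OF assms(1)[unfolded agree_off_def]] by metis
qed

end

text \<open>\<open>R\<close> is the distance from the disagreement up to which mixing is not
  invoked. It stays free here and is chosen in terms of \<open>L\<close> at the end.\<close>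

locale ssm_dyn = block_dyn phi r lam Lam L
  for phi :: "'a::euclidean_space \<Rightarrow> ereal" and r lam Lam L +
  fixes lmax \<alpha> \<beta> R :: real
  assumes activity: "activity_fn lmax lam"
    and lam_support: "lam x \<noteq> 0 \<Longrightarrow> x \<in> Lam"
    and Lam_convex: "convex Lam" and Lam_bounded: "bounded Lam"
    and \<alpha>_pos: "0 < \<alpha>" and \<beta>_pos: "0 < \<beta>" and R_nonneg: "0 \<le> R" and L_large: "real DIM('a) < L"
    and ssm: "\<And>\<Lambda> lam lam'. \<lbrakk>\<Lambda> \<in> sets lborel; bounded \<Lambda>; activity_fn lmax lam; activity_fn lmax lam'\<rbrakk> \<Longrightarrow>
     tv_dist (restrict_config \<Lambda> (gibbs phi lam)) (restrict_config \<Lambda> (gibbs phi lam'))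
       \<le> \<alpha> * measure lborel \<Lambda> * exp (- \<beta> * setdist \<Lambda> {x. lam x \<noteq> lam' x})"
begin

text \<open>Beyond \<open>r + DIM('a)\<close> from the disagreement both local activities coincide;
  points farther than \<open>R\<close> from it thus keep distance \<open>R - r - DIM('a)\<close>
  from any change.\<close>

definition mixing_error :: real where
  "mixing_error = \<alpha> * measure lborel (ball (0::'a) L) * exp (- \<beta> * (R - r - real DIM('a)))"

text \<open>The first term pays for the cells near the disagreement, once for each of the two
  boundary conditions. The second is the mixing error times the range of a function of the points in
  the ball.\<close>

definition shell_bound :: real where
  "shell_bound = 2 * (2 * R + 2) ^ DIM('a) + 2 * (2 * L + 2) ^ DIM('a) * mixing_error"

lemma mixing_error_nonneg: "0 \<le> mixing_error"
  using \<alpha>_pos by (simp add: mixing_error_def)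

lemma L_pos: "0 < L"
  using L_large by (rule le_less_trans[rotated]) simp

lemma shell_bound_ge_1: "1 \<le> shell_bound"
proof -
  have "1 \<le> (2 * R + 2) ^ DIM('a)" using R_nonneg by (intro one_le_power) simp
  moreover have "0 \<le> 2 * (2 * L + 2) ^ DIM('a) * mixing_error"
    using L_pos mixing_error_nonneg by simp
  ultimately show ?thesis unfolding shell_bound_def by linarith
qed

text \<open>Repulsion enters here: damping never raises the activity above \<open>lmax\<close>, so
  the mixing hypothesis applies to the resampled laws.\<close>

lemma activity_local: "activity_fn lmax (local_activity y zs)"
proof -
  have "0 \<le> local_activity y zs x \<and> local_activity y zs x \<le> lmax" for x
  proof -
    have l: "0 \<le> lam x" "lam x \<le> lmax" using activity by (auto simp: activity_fn_def)
    have "lam x * field zs x \<le> lam x" using l by (intro mult_left_le) auto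
    then show ?thesis using l by (auto simp: local_activity_def indicator_def)
  qed
  moreover have "bounded {x. local_activity y zs x \<noteq> 0}"
    by (rule bounded_subset[OF Lam_bounded]) (auto simp: local_activity_def dest: lam_support)
  ultimately show ?thesis
    by (simp add: activity_fn_def) measurable
qed

lemma AE_local: "AE ys in gibbs_law (local_activity y zs). set ys \<subseteq> ball y L \<inter> Lam"
proof -
  have supp: "x \<in> ball y L \<inter> Lam" if "local_activity y zs x \<noteq> 0" for x
    using that lam_support[of x] by (cases "x \<in> ball y L") (simp_all add: local_activity_def)
  show ?thesis
    using AE_gibbs_law[OF integrable_local_activity[of y zs]]
  proof eventually_elim
    case (elim ys)
    then show ?case using supp by blast
  qed
qed

context
  fixes f :: "'a list \<Rightarrow> real" and \<delta> :: real and X X' :: "'a list" and z :: 'a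
  assumes f: "test_fn f" and osc: "oscillation_le Lam f \<delta>"
    and XL: "set X \<subseteq> Lam" and XL': "set X' \<subseteq> Lam" and agree: "agree_off {cell z} X X'"
begin

section \<open>One update of two configurations that differ in one cell\<close>

lemma f_sym: "symmetric_fn f"
  using f unfolding test_fn_def by blast

lemma f_measurable [measurable]: "f \<in> borel_measurable configM"
  by (rule test_fn_measurable[OF f])

lemma agree_outside: "agree_off {cell z} (outside y X) (outside y X')"
  by (rule agree_off_filter[OF agree])

lemma uop_diff_inner:
  assumes y: "dist y z < L - real DIM('a)"
  shows "uop f X y = uop f X' y"
proof -
  have "w \<in> ball y L" if "cell w = cell z" for w
    using dist_same_cell[OF that] y dist_triangle[of y w z] by (simp add: dist_commute)
  then have "filter (\<lambda>x. cell x \<notin> {cell z}) (outside y Y) = outside y Y" for Y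
    by (subst filter_id_conv) auto
  then have m: "mset (outside y X) = mset (outside y X')"
    using agree_outside[of y] unfolding agree_off_def by simp
  show ?thesis
    unfolding uop_def local_activity_mset_cong[OF m]
    by (intro Bochner_Integration.integral_cong refl test_fn_sym[OF f]) (simp only: mset_append m)
qed

text \<open>The ball is out of range of the whole cell, so both updates draw from the same law. With
  the same new points on both sides the results still agree off that cell.\<close>

lemma uop_diff_outer:
  assumes y: "L + r + real DIM('a) \<le> dist y z"
  shows "\<bar>uop f X y - uop f X' y\<bar> \<le> \<delta>"
proof -
  let ?a = "outside y X" and ?a' = "outside y X'"
  have "field ?a x = field ?a' x" if x: "x \<in> ball y L" for x
  proof (rule field_agree_off[OF agree_outside])
    fix w :: 'a assume "cell w = cell z"
    from dist_same_cell[OF this] have "dist w z \<le> real DIM('a)" .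
    moreover have "dist y z \<le> dist y x + dist x w + dist w z"
      using dist_triangle[of y z x] dist_triangle[of x z w] by linarith
    ultimately show "r < dist x w" using x y by simp
  qed
  then have eq: "local_activity y ?a = local_activity y ?a'"
    by (auto simp: local_activity_def indicator_def)
  have "AE ys in gibbs_law (local_activity y ?a'). \<bar>f (?a @ ys) - f (?a' @ ys)\<bar> \<le> \<delta>"
    using AE_local
  proof eventually_elim
    case (elim ys)
    then show ?case
      using XL XL' by (intro oscillation_leD[OF osc, of _ _ "cell z"] agree_off_append agree_outside) auto
  qed
  then show ?thesis
    unfolding uop_def eq
    by (intro integral_diff_bound prob_space_gibbs_law integrable_local_activity)
       (auto simp: test_fn_bounds[OF f])
qed

text \<open>Points within distance \<open>R\<close> of the disagreement are erased at the price of one oscillation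
  per cell; the law of the remaining points is controlled by strong spatial mixing.\<close>
lemma uop_diff_shell: "\<bar>uop f X y - uop f X' y\<bar> \<le> shell_bound * \<delta>"
proof -
  let ?a = "outside y X" and ?a' = "outside y X'"
  let ?A = "local_activity y ?a" and ?A' = "local_activity y ?a'"
  let ?G = "gibbs_law ?A" and ?G' = "gibbs_law ?A'"
  define W where "W = {x \<in> ball y L \<inter> Lam. R < dist x z}"
  let ?flt = "filter (\<lambda>x. x \<in> W)"
  let ?T = "cell ` cball z R"
  let ?c = "(2 * R + 2) ^ DIM('a)" and ?m = "(2 * L + 2) ^ DIM('a)"
  have \<delta>: "0 \<le> \<delta>" using oscillation_le_nonneg[OF osc] .
  have T: "finite ?T" "real (card ?T) \<le> ?c" using card_cell_cball[OF R_nonneg, of z] by auto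
  have zT: "{cell z} \<subseteq> ?T" using R_nonneg by auto
  have aL: "set ?a \<subseteq> Lam" "set ?a' \<subseteq> Lam" using XL XL' by auto
  have W [measurable]: "W \<in> sets borel"
  proof -
    have "W = ball y L \<inter> Lam \<inter> - cball z R" by (auto simp: W_def dist_commute)
    then show ?thesis by simp
  qed
  have WL: "W \<subseteq> Lam" "W \<subseteq> ball y L" by (auto simp: W_def)
  have G: "prob_space ?G" and G': "prob_space ?G'"
    by (rule prob_space_gibbs_law[OF integrable_local_activity])+
  define H where "H ys = f (?a @ ?flt ys)" for ys
  have Hm [measurable]: "H \<in> borel_measurable configM" unfolding H_def by measurable
  have Hb: "0 \<le> H ys \<and> H ys \<le> 1" for ys by (simp add: H_def test_fn_bounds[OF f])
  have Hsym: "symmetric_fn H"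
    unfolding symmetric_fn_def H_def by (auto intro!: test_fn_sym[OF f])
  have near: "\<bar>f (b @ ys) - H ys\<bar> \<le> ?c * \<delta>"
    if "agree_off {cell z} b ?a" "set b \<subseteq> Lam" "set ys \<subseteq> ball y L \<inter> Lam" for b ys
  proof -
    have "agree_off ?T ys (?flt ys)"
      using that(3) by (intro agree_off_filter_self) (auto simp: W_def dist_commute not_less)
    moreover have "agree_off ?T b ?a" by (rule agree_off_mono[OF that(1) zT])
    ultimately have "\<bar>f (b @ ys) - H ys\<bar> \<le> real (card ?T) * \<delta>"
      unfolding H_def using that aL WL
      by (intro oscillation_many_cells[OF osc f_sym T(1)] agree_off_append) auto
    also have "\<dots> \<le> ?c * \<delta>" using T(2) \<delta> by (rule mult_right_mono)
    finally show ?thesis .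
  qed
  have 1: "\<bar>uop f X y - (\<integral>ys. H ys \<partial>?G)\<bar> \<le> ?c * \<delta>"
    unfolding uop_def
  proof (rule integral_diff_bound[OF G])
    show "AE ys in ?G. \<bar>f (?a @ ys) - H ys\<bar> \<le> ?c * \<delta>"
      using AE_local by eventually_elim (intro near aL agree_off_refl)
  qed (use Hb in \<open>auto simp: test_fn_bounds[OF f]\<close>)
  have 2: "\<bar>uop f X' y - (\<integral>ys. H ys \<partial>?G')\<bar> \<le> ?c * \<delta>"
    unfolding uop_def
  proof (rule integral_diff_bound[OF G'])
    show "AE ys in ?G'. \<bar>f (?a' @ ys) - H ys\<bar> \<le> ?c * \<delta>"
      using AE_local by eventually_elim (intro near aL agree_off_sym[OF agree_outside])
  qed (use Hb in \<open>auto simp: test_fn_bounds[OF f]\<close>)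
  \<comment> \<open>Equal activities are treated apart: their difference set is empty and
    \<open>setdist\<close> to it is 0 by convention, so the mixing bound would show no
    decay.\<close>
  have 3: "\<bar>(\<integral>ys. H ys \<partial>?G) - (\<integral>ys. H ys \<partial>?G')\<bar> \<le> 2 * (?m * \<delta>) * mixing_error"
  proof (cases "?A = ?A'")
    case True
    then show ?thesis using \<delta> mixing_error_nonneg L_pos by simp
  next
    case False
    have "x \<in> cball z (r + real DIM('a))" if "?A x \<noteq> ?A' x" for x
    proof (rule ccontr)
      assume x: "x \<notin> cball z (r + real DIM('a))"
      have "field ?a x = field ?a' x"
      proof (rule field_agree_off[OF agree_outside])
        fix w :: 'a assume "cell w = cell z"
        from dist_same_cell[OF this] have "dist w z \<le> real DIM('a)" .
        then show "r < dist x w" using x dist_triangle[of x z w] by (simp add: dist_commute)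
      qed
      then show False using that by (simp add: local_activity_def)
    qed
    note supp = this
    have rc: "prob_space (restrict_config W Q)" "sets (restrict_config W Q) = sets configM"
        "(\<integral>ys. H ys \<partial>restrict_config W Q) = (\<integral>ys. H ys \<partial>Q)"
      if Q: "prob_space Q" "sets Q = sets configM" for Q
    proof -
      note [measurable_cong] = Q(2)
      have m: "?flt \<in> measurable Q configM" by (rule measurable_filter) measurable
      show "prob_space (restrict_config W Q)"
        unfolding restrict_config_def by (rule prob_space.prob_space_distr[OF Q(1) m])
      show "sets (restrict_config W Q) = sets configM" by (simp add: restrict_config_def)
      show "(\<integral>ys. H ys \<partial>restrict_config W Q) = (\<integral>ys. H ys \<partial>Q)"
        unfolding restrict_config_def by (subst integral_distr[OF m Hm]) (simp add: H_def[abs_def])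
    qed
    let ?R = "restrict_config W ?G" and ?R' = "restrict_config W ?G'"
    have "tv_dist ?R ?R' \<le> \<alpha> * measure lborel W * exp (- \<beta> * setdist W {x. ?A x \<noteq> ?A' x})"
      unfolding gibbs_eq[OF integrable_local_activity, symmetric]
      using W bounded_subset[OF Lam_bounded WL(1)] by (intro ssm activity_local) auto
    also have "\<dots> \<le> mixing_error"
    \<comment> \<open>Again \<open>setdist\<close> is 0 by convention for the empty set, but here
      the volume factor vanishes.\<close>
    proof (cases "W = {}")
      case True then show ?thesis using mixing_error_nonneg by simp
    next
      case W_ne: False
      have ne: "{x. ?A x \<noteq> ?A' x} \<noteq> {}" using False by auto
      have "R - r - real DIM('a) \<le> setdist W {x. ?A x \<noteq> ?A' x}"
      proof (rule le_setdistI[OF W_ne ne])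
        fix w x assume "w \<in> W" "x \<in> {x. ?A x \<noteq> ?A' x}"
        then have "R < dist w z" "dist x z \<le> r + real DIM('a)" using supp[of x] by (auto simp: W_def dist_commute)
        then show "R - r - real DIM('a) \<le> dist w x" using dist_triangle[of w z x] by linarith
      qed
      then have e: "exp (- \<beta> * setdist W {x. ?A x \<noteq> ?A' x}) \<le> exp (- \<beta> * (R - r - real DIM('a)))"
        using \<beta>_pos by simp
      have "measure lborel W \<le> measure lborel (ball y L)"
        using W WL by (intro measure_mono_fmeasurable fmeasurableI emeasure_lborel_ball_finite) auto
      also have "\<dots> = measure lborel (ball (0::'a) L)"
        using L_pos by (simp add: content_ball)
      finally have v: "measure lborel W \<le> measure lborel (ball (0::'a) L)" .
      show ?thesis
        unfolding mixing_error_def using v e \<alpha>_pos by (intro mult_mono) auto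
    qed
    finally have tv: "tv_dist ?R ?R' \<le> mixing_error" .
    \<comment> \<open>Erasing all new points changes at most the cells that meet the ball. This
      bounds the range of \<open>H\<close> by a multiple of \<delta>, so the mixing error
      contributes in proportion to \<delta>.\<close>
    have "\<bar>H ys - f ?a\<bar> \<le> ?m * \<delta>" for ys
    proof -
      let ?U = "cell ` cball y L"
      have U: "finite ?U" "real (card ?U) \<le> ?m" using card_cell_cball[of L y] L_pos by auto
      have "agree_off ?U (?flt ys) []"
        using agree_off_filter_self[of "?flt ys" "\<lambda>_. False" ?U] WL by force
      then have "agree_off ?U (?a @ ?flt ys) (?a @ [])" by (intro agree_off_append) auto
      then have "\<bar>H ys - f (?a @ [])\<bar> \<le> real (card ?U) * \<delta>"
        unfolding H_def using aL WL by (intro oscillation_many_cells[OF osc f_sym U(1)]) auto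
      also have "\<dots> \<le> ?m * \<delta>" using U(2) \<delta> by (rule mult_right_mono)
      finally show ?thesis by simp
    qed
    then have "\<bar>(\<integral>ys. H ys \<partial>?R) - (\<integral>ys. H ys \<partial>?R')\<bar> \<le> 2 * (?m * \<delta>) * tv_dist ?R ?R'"
      using G G' Hsym by (intro integral_diff_le_tv_dist rc) auto
    also have "\<dots> \<le> 2 * (?m * \<delta>) * mixing_error"
      using tv \<delta> L_pos by (intro mult_left_mono) auto
    finally show ?thesis using rc(3)[OF G] rc(3)[OF G'] by simp
  qed
  have "\<bar>uop f X y - uop f X' y\<bar> \<le> ?c * \<delta> + 2 * (?m * \<delta>) * mixing_error + ?c * \<delta>"
    using 1 2 3 by linarith
  then show ?thesis by (simp add: shell_bound_def algebra_simps)
qed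

end

text \<open>By \<open>vol\<close>, a centre that erases the disagreement has probability at least
  1/N; by \<open>small\<close>, the shell gives back at most half of that gain.\<close>

lemma oscillation_kop:
  assumes f: "test_fn f" and osc: "oscillation_le Lam f \<delta>"
    and vol: "\<And>z. z \<in> Lam \<Longrightarrow> 1 \<le> measure lborel (ball z (L - real DIM('a)) \<inter> Lam)"
    and small: "shell_bound * (((L + r + real DIM('a)) / (L - real DIM('a))) ^ DIM('a) - 1) \<le> 1 / 2"
  shows "oscillation_le Lam (kop f) ((1 - 1 / (2 * measure lborel Lam)) * \<delta>)"
  unfolding oscillation_le_def
proof (intro allI impI)
  fix X X' k assume X: "set X \<subseteq> Lam" and X': "set X' \<subseteq> Lam" and agree: "agree_off {k} X X'"
  have \<delta>: "0 \<le> \<delta>" using oscillation_le_nonneg[OF osc] .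
  let ?N = "measure lborel Lam"
  have N_pos: "0 < ?N"
    using Lam_pos Lam_fin by (metis emeasure_eq_ennreal_measure ennreal_0 infinity_ennreal_def
        measure_nonneg order_le_imp_less_or_eq)
  show "\<bar>kop f X - kop f X'\<bar> \<le> (1 - 1 / (2 * ?N)) * \<delta>"
  proof (cases "\<exists>z\<in>set X \<union> set X'. cell z = k")
    \<comment> \<open>Neither configuration has a point in the cell, so they are permutations of
      each other. The bound \<open>1 \<le> ?N\<close> makes the factor on the right
      nonnegative.\<close>
    case False
    then have "filter (\<lambda>x. cell x \<notin> {k}) X = X" "filter (\<lambda>x. cell x \<notin> {k}) X' = X'"
      by (auto simp: filter_id_conv)
    then have "mset X = mset X'" using agree unfolding agree_off_def by metis
    then have eq: "kop f X = kop f X'" by (rule test_fn_sym[OF test_fn_kop[OF f]])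
    have "\<exists>z. z \<in> Lam"
      using Lam_pos by (metis emeasure_empty equals0I)
    then obtain z where z: "z \<in> Lam" by blast
    have "measure lborel (ball z (L - real DIM('a)) \<inter> Lam) \<le> ?N"
      using Lam_fin by (intro measure_mono_fmeasurable) (auto simp: fmeasurable_def less_top)
    then have "1 \<le> ?N" using vol[OF z] by linarith
    then show ?thesis using eq \<delta> by simp
  next
    \<comment> \<open>A point of a configuration represents the cell because it lies in
      \<open>Lam\<close>, as the volume bounds require; the corner \<open>k\<close> need
      not.\<close>
    case True
    then obtain z where z: "z \<in> Lam" "k = cell z" using X X' by auto
    note agree' = agree[unfolded z(2)]
    let ?I = "ball z (L - real DIM('a))" and ?O = "ball z (L + r + real DIM('a))"
    interpret U: prob_space unif by (rule prob_space_unif)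
    let ?D = "shell_bound"
    let ?p = "measure unif ?I" and ?q = "measure unif ?O"
    \<comment> \<open>0 on the inner ball, \<open>?D * \<delta>\<close> on the shell and \<delta>
      elsewhere.\<close>
    define g where "g y = \<delta> * (1 - indicator ?O y) + ?D * \<delta> * (indicator ?O y - indicator ?I y)" for y
    have rh: "0 < r" "0 \<le> real DIM('a)" using r_pos by auto
    have IO: "?I \<subseteq> ?O" using rh by (intro subset_ball) linarith
    have bound: "\<bar>uop f X y - uop f X' y\<bar> \<le> g y" for y
    proof -
      consider "dist y z < L - real DIM('a)" | "L - real DIM('a) \<le> dist y z" "dist y z < L + r + real DIM('a)" | "L + r + real DIM('a) \<le> dist y z"
        by linarith
      then show ?thesis
      proof cases
        case 1
        moreover from this have "dist y z < L + r + real DIM('a)" using rh by linarith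
        ultimately show ?thesis
          using uop_diff_inner[OF f osc X X' agree'] by (simp add: g_def indicator_def dist_commute)
      next
        case 2
        then show ?thesis
          using uop_diff_shell[OF f osc X X' agree'] by (simp add: g_def indicator_def dist_commute)
      next
        case 3
        then show ?thesis
          using uop_diff_outer[OF f osc X X' agree' 3] rh by (simp add: g_def indicator_def dist_commute)
      qed
    qed
    have int: "integrable unif (indicator B :: _ \<Rightarrow> real)" if "B \<in> sets borel" for B
      using that by (intro integrable_real_indicator) (auto simp: U.emeasure_eq_measure)
    have intg: "integrable unif g"
      unfolding g_def by (intro Bochner_Integration.integrable_add integrable_mult_right Bochner_Integration.integrable_diff int) auto
    have intu: "integrable unif (uop f Y)" for Y
      by (rule integrable_bounded[OF prob_space_unif])
         (use measurable_uop[OF f] uop_bounds[OF f] in auto)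
    have "\<bar>kop f X - kop f X'\<bar> = \<bar>\<integral>y. uop f X y - uop f X' y \<partial>unif\<bar>"
      unfolding kop_eq[OF f] using intu by simp
    also have "\<dots> \<le> (\<integral>y. \<bar>uop f X y - uop f X' y\<bar> \<partial>unif)" by (rule integral_abs_bound)
    also have "\<dots> \<le> (\<integral>y. g y \<partial>unif)"
      using intu intg bound by (intro integral_mono) auto
    also have "\<dots> = \<delta> * (1 - ?q) + ?D * \<delta> * (?q - ?p)"
      unfolding g_def using int U.prob_space by simp
    also have "\<dots> \<le> (1 - 1 / (2 * ?N)) * \<delta>"
    proof -
      have p: "?p = measure lborel (?I \<inter> Lam) / ?N" and q: "?q = measure lborel (?O \<inter> Lam) / ?N"
        using Lam_pos Lam_fin by (simp_all add: measure_uniform_measure Int_commute)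
      have "measure lborel (?O \<inter> Lam) \<le> ((L + r + real DIM('a)) / (L - real DIM('a))) ^ DIM('a) * measure lborel (?I \<inter> Lam)"
        using Lam_convex z(1) L_large rh by (intro measure_ball_scale) auto
      then have qp: "?q \<le> ((L + r + real DIM('a)) / (L - real DIM('a))) ^ DIM('a) * ?p"
        unfolding p q using N_pos by (simp add: divide_right_mono)
      \<comment> \<open>The scaling bound makes the shell a small fraction of the inner ball itself,
        also near the boundary of \<open>Lam\<close>; this yields the comparison with
        \<open>?p\<close>.\<close>
      have "?D * (?q - ?p) \<le> ?D * ((((L + r + real DIM('a)) / (L - real DIM('a))) ^ DIM('a) - 1) * ?p)"
        using qp shell_bound_ge_1 by (intro mult_left_mono) (auto simp: algebra_simps)
      also have "\<dots> \<le> 1 / 2 * ?p"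
        unfolding mult.assoc[symmetric] using small by (rule mult_right_mono) simp
      finally have D: "?D * (?q - ?p) \<le> 1 / 2 * ?p" .
      have pq: "?p \<le> ?q" using IO by (intro U.finite_measure_mono) auto
      have "1 / ?N \<le> ?p" unfolding p using vol[OF z(1)] N_pos by (simp add: divide_right_mono)
      then have "(1 - ?q) + ?D * (?q - ?p) \<le> 1 - 1 / (2 * ?N)" using D pq by simp
      then have "((1 - ?q) + ?D * (?q - ?p)) * \<delta> \<le> (1 - 1 / (2 * ?N)) * \<delta>"
        using \<delta> by (rule mult_right_mono)
      then show ?thesis by (simp add: algebra_simps)
    qed
    finally show ?thesis .
  qed
qed

end

section \<open>Choice of scales and mixing time\<close>

lemma power_minus_one_le:
  fixes x :: real
  assumes "0 \<le> x" "x \<le> 1"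
  shows "(1 + x) ^ d - 1 \<le> real d * 2 ^ d * x"
proof -
  have "(1 + x) ^ d - 1 = x * (\<Sum>i<d. (1 + x) ^ i)"
    using power_diff_1_eq[of "1 + x" d] by simp
  also have "\<dots> \<le> x * (\<Sum>i<d. 2 ^ d)"
  proof (intro mult_left_mono sum_mono)
    fix i assume "i \<in> {..<d}"
    have "(1 + x) ^ i \<le> 2 ^ i" using assms by (intro power_mono) auto
    also have "\<dots> \<le> (2::real) ^ d" using \<open>i \<in> {..<d}\<close> by (intro power_increasing) auto
    finally show "(1 + x) ^ i \<le> 2 ^ d" .
  qed (use assms in simp)
  finally show ?thesis by (simp add: mult_ac)
qed

lemma tendsto_power_times_exp_neg:
  assumes "0 < (\<beta>::real)"
  shows "((\<lambda>x. x ^ m * exp (- \<beta> * x)) \<longlongrightarrow> 0) at_top"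
proof -
  have "filterlim (\<lambda>x. \<beta> * x) at_top at_top"
    using assms by (intro filterlim_tendsto_pos_mult_at_top[OF tendsto_const]) (auto simp: filterlim_ident)
  from filterlim_compose[OF tendsto_power_div_exp_0[of m] this]
  have "((\<lambda>x. (1 / \<beta>) ^ m * ((\<beta> * x) ^ m / exp (\<beta> * x))) \<longlongrightarrow> (1 / \<beta>) ^ m * 0) at_top"
    by (intro tendsto_mult tendsto_const)
  moreover have "(1 / \<beta>) ^ m * ((\<beta> * x) ^ m / exp (\<beta> * x)) = x ^ m * exp (- \<beta> * x)" for x
    using assms by (simp add: power_mult_distrib power_divide exp_minus field_simps)
  ultimately show ?thesis by simp
qed

text \<open>The inner radius \<open>R\<close> is chosen with \<open>R ^ (2 * d) = L\<close>: then \<open>R ^ d\<close> is small compared with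
  \<open>L\<close>, while \<open>exp (- \<beta> * R)\<close> still beats every power of \<open>L\<close>.\<close>
lemma block_radius_exists:
  fixes r \<alpha> \<beta> V :: real and d :: nat
  assumes pos: "0 < r" "0 < \<alpha>" "0 < \<beta>" "0 \<le> V" "0 < d"
  shows "\<exists>L0>0. \<forall>L\<ge>L0. 2 * real d < L \<and> (\<exists>R\<ge>0.
    (2 * (2 * R + 2) ^ d + 2 * (2 * L + 2) ^ d * (\<alpha> * (V * L ^ d) * exp (- \<beta> * (R - r - real d))))
      * (((L + r + real d) / (L - real d)) ^ d - 1) \<le> 1 / 2)"
proof -
  \<comment> \<open>\<open>c\<close> is the width of the shell. \<open>K / L\<close> bounds the
    excess of the volume ratio over 1, the factor 2 coming from \<open>L - d \<ge> L / 2\<close>;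
    \<open>B\<close> collects the constants of the mixing term.\<close>
  define c where "c = r + 2 * real d"
  define K where "K = 2 * c * real d * 2 ^ d"
  define B where "B = 2 * 4 ^ d * \<alpha> * V * exp (\<beta> * (r + real d)) * K"
  have c: "0 < c" using pos by (simp add: c_def)
  have K: "0 < K" using c pos by (simp add: K_def)
  \<comment> \<open>The two summands are the costs of near cells and of mixing. The power
    \<open>4 * d * d\<close> is \<open>L ^ (2 * d)\<close> written in terms of
    \<open>R\<close>.\<close>
  have "((\<lambda>R. 2 * 4 ^ d * K * inverse (R ^ d) + B * (R ^ (4 * d * d) * exp (- \<beta> * R)))
      \<longlongrightarrow> 2 * 4 ^ d * K * 0 + B * 0) at_top"
    using pos
    by (intro tendsto_add tendsto_mult tendsto_const tendsto_power_times_exp_neg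
        filterlim_compose[OF tendsto_inverse_0_at_top filterlim_pow_at_top] filterlim_ident tendsto_inverse_0_at_top
        filterlim_pow_at_top)
  then have "((\<lambda>R. 2 * 4 ^ d * K * inverse (R ^ d) + B * (R ^ (4 * d * d) * exp (- \<beta> * R))) \<longlongrightarrow> 0) at_top"
    by (simp only: mult_zero_right add_0_left)
  then have "eventually (\<lambda>R. 2 * 4 ^ d * K * inverse (R ^ d) + B * (R ^ (4 * d * d) * exp (- \<beta> * R)) < 1 / 2) at_top"
    by (rule order_tendstoD(2)) simp
  then obtain R0 where R0: "\<And>R. R0 \<le> R \<Longrightarrow>
      2 * 4 ^ d * K * inverse (R ^ d) + B * (R ^ (4 * d * d) * exp (- \<beta> * R)) < 1 / 2"
    unfolding eventually_at_top_linorder by blast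
  \<comment> \<open>The entries guarantee in turn \<open>R \<ge> max 1 R0\<close>,
    \<open>L > 2 * d\<close>, and \<open>c / (L - d) \<le> 1\<close>, which
    \<open>power_minus_one_le\<close> requires.\<close>
  define L0 where "L0 = max ((max 1 R0) ^ (2 * d)) (max (2 * real d + 1) (real d + c))"
  show ?thesis
  proof (rule exI[of _ L0], rule conjI, goal_cases)
    case 1
    show "0 < L0" by (simp add: L0_def less_max_iff_disj)
  next
    case 2
    show ?case
    proof (rule allI, rule impI, rule conjI)
      fix L assume L: "L0 \<le> L"
      show Ld: "2 * real d < L" using L by (simp add: L0_def)
      have Lc: "real d + c \<le> L" using L by (simp add: L0_def)
      have L1: "1 \<le> L" using Ld pos by linarith
      define R where "R = root (2 * d) L"
      have RL: "R ^ (2 * d) = L" unfolding R_def using pos L1 by (intro real_root_pow_pos2) auto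
      have R_ge: "max 1 R0 \<le> R"
      proof -
        have "(max 1 R0) ^ (2 * d) \<le> R ^ (2 * d)" unfolding RL using L by (simp add: L0_def)
        then show ?thesis
          using pos L1 by (subst (asm) power_mono_iff) (auto simp: R_def)
      qed
      then have R1: "1 \<le> R" "R0 \<le> R" by auto
      let ?E = "((L + r + real d) / (L - real d)) ^ d - 1"
      have Lmd: "0 < L - real d" using Ld by linarith
      have frac: "(L + r + real d) / (L - real d) = 1 + c / (L - real d)"
        using Lmd by (simp add: c_def field_simps)
      have "?E \<le> real d * 2 ^ d * (c / (L - real d))"
        unfolding frac using Lmd Lc c by (intro power_minus_one_le) auto
      also have "\<dots> \<le> real d * 2 ^ d * (2 * c / L)"
      proof (intro mult_left_mono)
        have "c * L \<le> 2 * c * (L - real d)" using Ld c by (simp add: algebra_simps)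
        then show "c / (L - real d) \<le> 2 * c / L" using Lmd L1 by (simp add: divide_simps)
      qed simp
      finally have E: "?E \<le> K / L" by (simp add: K_def mult_ac)
      have E0: "0 \<le> ?E"
        unfolding frac using c Lmd by (simp add: one_le_power)
      have "K / L \<le> K / 1" using K L1 by (intro divide_left_mono) auto
      then have EK: "?E \<le> K" using E by simp
      have "2 * (2 * R + 2) ^ d * ?E \<le> 2 * (4 * R) ^ d * (K / L)"
        using R1 E E0 by (intro mult_mono power_mono) auto
      also have "\<dots> = 2 * 4 ^ d * K * inverse (R ^ d)"
      proof -
        have "L = R ^ d * R ^ d" using RL by (simp add: mult_2 power_add)
        then show ?thesis using R1 by (simp add: power_mult_distrib field_simps)
      qed
      finally have 1: "2 * (2 * R + 2) ^ d * ?E \<le> 2 * 4 ^ d * K * inverse (R ^ d)" .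
      let ?T = "\<alpha> * (V * L ^ d) * exp (- \<beta> * (R - r - real d))"
      have T0: "0 \<le> ?T" using pos L1 by simp
      \<comment> \<open>The smallness of the shell is not spent here: the constant bound
        \<open>K\<close> suffices, since the exponential absorbs every power of
        \<open>L\<close>.\<close>
      have "2 * (2 * L + 2) ^ d * ?T * ?E \<le> 2 * (4 * L) ^ d * ?T * K"
        using pos L1 EK E0 T0 by (intro mult_mono power_mono mult_nonneg_nonneg) auto
      also have "\<dots> = B * (R ^ (4 * d * d) * exp (- \<beta> * R))"
      proof -
        have e: "exp (- \<beta> * (R - r - real d)) = exp (\<beta> * (r + real d)) * exp (- \<beta> * R)"
          by (simp add: exp_add[symmetric] algebra_simps)
        have "R ^ (4 * d * d) = (R ^ (2 * d)) ^ (2 * d)" by (simp add: power_mult[symmetric] mult_ac)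
        then have "R ^ (4 * d * d) = L ^ d * L ^ d" unfolding RL by (simp add: mult_2 power_add)
        then show ?thesis unfolding B_def e by (simp add: power_mult_distrib mult_ac)
      qed
      finally have 2: "2 * (2 * L + 2) ^ d * ?T * ?E \<le> B * (R ^ (4 * d * d) * exp (- \<beta> * R))" .
      show "\<exists>R\<ge>0. (2 * (2 * R + 2) ^ d + 2 * (2 * L + 2) ^ d * (\<alpha> * (V * L ^ d) * exp (- \<beta> * (R - r - real d))))
        * (((L + r + real d) / (L - real d)) ^ d - 1) \<le> 1 / 2"
      proof (intro exI[of _ R] conjI)
        show "0 \<le> R" using R1 by simp
        have "(2 * (2 * R + 2) ^ d + 2 * (2 * L + 2) ^ d * ?T) * ?E
          = 2 * (2 * R + 2) ^ d * ?E + 2 * (2 * L + 2) ^ d * ?T * ?E" by (simp add: distrib_right)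
        then show "(2 * (2 * R + 2) ^ d + 2 * (2 * L + 2) ^ d * ?T) * ?E \<le> 1 / 2"
          using 1 2 R0[OF R1(2)] by linarith
      qed
    qed
  qed
qed

section \<open>Volume and number of cells of the box\<close>

lemma measure_box_n: "measure lborel (box_n n :: 'a::euclidean_space set) = (2 * real n) ^ DIM('a)"
  unfolding box_n_def by (subst measure_lborel_cbox_eq) (simp add: algebra_simps)

text \<open>The floors of a coordinate run from -n to n. Their number 2n + 1 is at most 3/2 times 2n
  because n is at least 1.\<close>

lemma card_cell_box_n:
  assumes "1 \<le> n"
  shows "finite (cell ` (box_n n :: 'a::euclidean_space set))
    \<and> real (card (cell ` (box_n n :: 'a set))) \<le> (3 / 2) ^ DIM('a) * measure lborel (box_n n :: 'a set)"
proof -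
  have "finite (cell ` (box_n n :: 'a set)) \<and> real (card (cell ` (box_n n :: 'a set))) \<le> (2 * real n + 1) ^ DIM('a)"
  proof (rule finite_card_cell_image[where lo = "\<lambda>_. - int n" and hi = "\<lambda>_. int n"])
    fix x b :: 'a assume "x \<in> box_n n" "b \<in> Basis"
    then have "- real n \<le> x \<bullet> b" "x \<bullet> b \<le> real n" by (auto simp: box_n_inner)
    then show "- int n \<le> \<lfloor>x \<bullet> b\<rfloor> \<and> \<lfloor>x \<bullet> b\<rfloor> \<le> int n"
      by (auto simp: le_floor_iff floor_le_iff)
  qed auto
  moreover have "(2 * real n + 1) ^ DIM('a) \<le> (3 / 2 * (2 * real n)) ^ DIM('a)"
    using assms by (intro power_mono) auto
  ultimately show ?thesis
    unfolding measure_box_n power_mult_distrib[of "3 / 2" "2 * real n"] by linarith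
qed

context ssm_dyn
begin

lemma oscillation_kop_iter:
  assumes "test_fn f"
    and vol: "\<And>z. z \<in> Lam \<Longrightarrow> 1 \<le> measure lborel (ball z (L - real DIM('a)) \<inter> Lam)"
    and small: "shell_bound * (((L + r + real DIM('a)) / (L - real DIM('a))) ^ DIM('a) - 1) \<le> 1 / 2"
  shows "oscillation_le Lam ((kop ^^ j) f) ((1 - 1 / (2 * measure lborel Lam)) ^ j)"
proof (induction j)
  case 0
  have "\<bar>f X - f X'\<bar> \<le> 1" for X X'
    using test_fn_bounds[OF assms(1), of X] test_fn_bounds[OF assms(1), of X'] by linarith
  then show ?case by (simp add: oscillation_le_def)
next
  case (Suc j)
  from oscillation_kop[OF test_fn_kop_iter[OF assms(1)] this vol small] show ?case by simp
qed

text \<open>All configurations in \<open>Lam\<close> agree off its cells, so the iterated function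
  is close to its value at the empty configuration. The chain and, by invariance, the Gibbs law are
  both compared with that value; hence the factor 2.\<close>

lemma tv_dist_chain_le:
  assumes \<mu>0: "prob_space \<mu>0" "sets \<mu>0 = sets configM" "AE X in \<mu>0. set X \<subseteq> Lam"
    and fin: "finite (cell ` Lam)"
    and vol: "\<And>z. z \<in> Lam \<Longrightarrow> 1 \<le> measure lborel (ball z (L - real DIM('a)) \<inter> Lam)"
    and small: "shell_bound * (((L + r + real DIM('a)) / (L - real DIM('a))) ^ DIM('a) - 1) \<le> 1 / 2"
  shows "tv_dist (chain_dist phi lam Lam L \<mu>0 j) (gibbs phi lam)
    \<le> 2 * real (card (cell ` Lam)) * (1 - 1 / (2 * measure lborel Lam)) ^ j"
  unfolding tv_dist_def
proof (rule cSUP_least)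
  show "{A \<in> sets (configM :: 'a list measure). sym_event A} \<noteq> {}"
    by (auto simp: sym_event_def intro: exI[of _ "{}"])
  fix A :: "'a list set" assume "A \<in> {A \<in> sets configM. sym_event A}"
  then have A [measurable]: "A \<in> sets configM" and symA: "sym_event A" by auto
  let ?f = "indicat_real A" and ?q = "(1 - 1 / (2 * measure lborel Lam)) ^ j"
  let ?b = "real (card (cell ` Lam)) * ?q"
  let ?g = "(kop ^^ j) ?f"
  have f: "test_fn ?f"
    unfolding test_fn_def symmetric_fn_def
  proof (intro conjI allI impI)
    fix xs ys :: "'a list" assume "mset xs = mset ys"
    then have "xs \<in> A \<longleftrightarrow> ys \<in> A" using symA unfolding sym_event_def by blast
    then show "?f xs = ?f ys" by (simp add: indicator_def)
  qed simp_all
  have g: "test_fn ?g" by (rule test_fn_kop_iter[OF f])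
  have osc: "oscillation_le Lam ?g ?q" by (rule oscillation_kop_iter[OF f vol small])
  have close: "\<bar>?g X - ?g []\<bar> \<le> ?b" if "set X \<subseteq> Lam" for X
  proof (rule oscillation_many_cells[OF osc _ fin that])
    show "symmetric_fn ?g" using g unfolding test_fn_def by blast
    have "filter (\<lambda>x. cell x \<notin> cell ` Lam) X = []" using that by (auto simp: filter_empty_conv)
    then show "agree_off (cell ` Lam) X []" by (simp add: agree_off_def)
  qed simp
  have int: "\<bar>(\<integral>X. ?g X \<partial>Q) - ?g []\<bar> \<le> ?b"
    if Q: "prob_space Q" "sets Q = sets configM" "AE X in Q. set X \<subseteq> Lam" for Q
  proof -
    interpret prob_space Q by fact
    note [measurable_cong] = Q(2)
    note [measurable] = test_fn_measurable[OF g]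
    have "AE X in Q. \<bar>?g X - ?g []\<bar> \<le> ?b" using Q(3) by eventually_elim (rule close)
    then have "\<bar>(\<integral>X. ?g X \<partial>Q) - (\<integral>X. ?g [] \<partial>Q)\<bar> \<le> ?b"
      by (intro integral_diff_bound Q) (auto simp: test_fn_bounds[OF g])
    then show ?thesis by (simp add: prob_space)
  qed
  have chain: "sets (chain_dist phi lam Lam L \<mu>0 j) = sets configM"
    using chain_dist_props[OF \<mu>0(1,2)] by simp
  have "measure (chain_dist phi lam Lam L \<mu>0 j) A = (\<integral>X. ?f X \<partial>chain_dist phi lam Lam L \<mu>0 j)"
    using chain A sets_eq_imp_space_eq[OF chain] by simp
  also have "\<dots> = (\<integral>X. ?g X \<partial>\<mu>0)" by (rule integral_chain_dist[OF \<mu>0(1,2) f])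
  finally have 1: "measure (chain_dist phi lam Lam L \<mu>0 j) A = (\<integral>X. ?g X \<partial>\<mu>0)" .
  have "measure (gibbs phi lam) A = (\<integral>X. ?f X \<partial>gibbs_law lam)"
    using A by (simp add: gibbs_eq[OF act])
  also have "\<dots> = (\<integral>X. ?g X \<partial>gibbs_law lam)" by (rule integral_kop_iter_invariant[OF f, symmetric])
  finally have 2: "measure (gibbs phi lam) A = (\<integral>X. ?g X \<partial>gibbs_law lam)" .
  have "AE X in gibbs_law lam. set X \<subseteq> Lam"
    using AE_gibbs_law[OF act] by eventually_elim (use lam_support in blast)
  then have "\<bar>(\<integral>X. ?g X \<partial>gibbs_law lam) - ?g []\<bar> \<le> ?b"
    by (intro int prob_space_gibbs_law[OF act]) simp
  with int[OF \<mu>0] show "\<bar>measure (chain_dist phi lam Lam L \<mu>0 j) A - measure (gibbs phi lam) A\<bar>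
      \<le> 2 * real (card (cell ` Lam)) * ?q"
    unfolding 1 2 by linarith
qed

end

lemma integrable_activity_if_activity_fn:
  assumes "activity_fn lmax lam"
  shows "integrable_activity lam"
proof -
  have m [measurable]: "lam \<in> borel_measurable borel" and nn: "0 \<le> lam x" and le: "lam x \<le> lmax" for x
    using assms by (auto simp: activity_fn_def)
  obtain a where "\<forall>x\<in>{x. lam x \<noteq> 0}. norm x \<le> a"
    using assms unfolding activity_fn_def bounded_iff by blast
  then have a: "{x. lam x \<noteq> 0} \<subseteq> cball 0 a" by auto
  have "integrable lborel (\<lambda>x. lmax * indicator (cball 0 a) x)"
    by (intro integrable_mult_right integrable_indicator_cball)
  then have "integrable lborel lam"
  proof (rule Bochner_Integration.integrable_bound)
    have "norm (lam x) \<le> norm (lmax * indicator (cball 0 a) x)" for x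
    proof (cases "lam x = 0")
      case False
      then have "x \<in> cball 0 a" using a by blast
      then show ?thesis using nn[of x] le[of x] by simp
    qed simp
    then show "AE x in lborel. norm (lam x) \<le> norm (lmax * indicator (cball 0 a) x)" by simp
  qed simp
  then show ?thesis using m nn by (simp add: integrable_activity_def)
qed

text \<open>\<open>a\<close> is the logarithm of the prefactor 2 (3/2)^d. As N is at least 2,
  ln(N/\<epsilon>) is at least ln 2, so terms of order N are absorbed into N
  ln(N/\<epsilon>).\<close>

lemma contraction_steps:
  fixes N M \<epsilon> :: real and d :: nat
  assumes N: "2 \<le> N" and \<epsilon>: "0 < \<epsilon>" "\<epsilon> < 1" and M: "0 \<le> M" "M \<le> (3 / 2) ^ d * N"
  shows "\<exists>j::nat. real j \<le> (2 + (2 * (ln 2 + real d * ln (3 / 2)) + 1) / ln 2) * N * ln (N / \<epsilon>)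
     \<and> 2 * M * (1 - 1 / (2 * N)) ^ j < \<epsilon>"
proof -
  define a where "a = ln 2 + real d * ln (3 / 2 :: real)"
  define l where "l = ln (N / \<epsilon>)"
  have a: "0 \<le> a" by (simp add: a_def)
  have "2 \<le> N / \<epsilon>" using N \<epsilon> by (simp add: field_simps)
  then have l: "ln 2 \<le> l" unfolding l_def using N \<epsilon> by (subst ln_le_cancel_iff) auto
  have l2: "0 < ln (2::real)" by simp
  define t where "t = 2 * N * (l + a)"
  have t: "0 \<le> t" using N l l2 a unfolding t_def by (intro mult_nonneg_nonneg) linarith+
  \<comment> \<open>The successor of the ceiling makes \<open>t < j\<close> strict, for the strict
    inequality with \<epsilon>. The excess of at most 2 is covered by
    \<open>N \<ge> 2\<close>.\<close>
  define j where "j = Suc (nat \<lceil>t\<rceil>)"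
  have j: "t < real j" "real j \<le> t + 2" using t unfolding j_def by linarith+
  have "real j \<le> 2 * N * l + (2 * a + 1) * N" using j N by (simp add: t_def algebra_simps)
  also have "\<dots> \<le> 2 * N * l + (2 * a + 1) * N * (l / ln 2)"
  proof -
    have "(2 * a + 1) * N * 1 \<le> (2 * a + 1) * N * (l / ln 2)"
      using a N l l2 by (intro mult_left_mono) (auto simp: field_simps)
    then show ?thesis by simp
  qed
  also have "\<dots> = (2 + (2 * a + 1) / ln 2) * N * l"
    by (simp add: field_simps)
  finally have jb: "real j \<le> (2 + (2 * a + 1) / ln 2) * N * l" .
  have "0 \<le> 1 - 1 / (2 * N)" using N by (simp add: field_simps)
  moreover have "1 - 1 / (2 * N) \<le> exp (- (1 / (2 * N)))"
    using exp_ge_add_one_self[of "- (1 / (2 * N))"] by simp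
  ultimately have "(1 - 1 / (2 * N)) ^ j \<le> exp (- (1 / (2 * N))) ^ j" by (intro power_mono)
  also have "\<dots> = exp (- (real j / (2 * N)))" by (simp add: exp_of_nat_mult[symmetric])
  also have "\<dots> < exp (- (l + a))"
    using j(1) N by (simp add: t_def field_simps)
  also have "exp (- (l + a)) = \<epsilon> / (2 * (3 / 2) ^ d * N)"
  proof -
    have "exp a = 2 * (3 / 2) ^ d" unfolding a_def exp_add exp_of_nat_mult by simp
    moreover have "exp l = N / \<epsilon>" using N \<epsilon> by (simp add: l_def)
    ultimately have "exp (- (l + a)) = inverse (N / \<epsilon> * (2 * (3 / 2) ^ d))"
      by (simp only: exp_minus exp_add)
    then show ?thesis using N \<epsilon> by (simp add: field_simps)
  qed
  finally have q: "(1 - 1 / (2 * N)) ^ j < \<epsilon> / (2 * (3 / 2) ^ d * N)" .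
  have "2 * M * (1 - 1 / (2 * N)) ^ j \<le> 2 * ((3 / 2) ^ d * N) * (1 - 1 / (2 * N)) ^ j"
    using M \<open>0 \<le> 1 - 1 / (2 * N)\<close> by (intro mult_right_mono) auto
  also have "\<dots> < 2 * ((3 / 2) ^ d * N) * (\<epsilon> / (2 * (3 / 2) ^ d * N))"
    using q N by (intro mult_strict_left_mono) auto
  also have "\<dots> = \<epsilon>" using N by simp
  finally show ?thesis using jb unfolding a_def l_def by blast
qed

theorem theorem29:
  fixes phi :: "'a::euclidean_space \<Rightarrow> ereal" and lmax :: real
  assumes "finite_range_repulsive phi"
    and "strong_spatial_mixing phi lmax"
  shows "\<exists>L0>0. \<forall>L\<ge>L0. \<exists>C>0. \<forall>(n::nat) lam (\<epsilon>::real) (\<mu>0::'a list measure).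
           n \<ge> 1 \<and> activity_fn lmax lam \<and> {x. lam x \<noteq> 0} \<subseteq> box_n n \<and> 0 < \<epsilon> \<and> \<epsilon> < 1
           \<and> prob_space \<mu>0 \<and> sets \<mu>0 = sets configM \<and> (AE X in \<mu>0. set X \<subseteq> box_n n) \<longrightarrow>
           (\<exists>j::nat. real j \<le> C * measure lborel (box_n n :: 'a set)
                                 * ln (measure lborel (box_n n :: 'a set) / \<epsilon>)
              \<and> tv_dist (chain_dist phi lam (box_n n) L \<mu>0 j) (gibbs phi lam) < \<epsilon>)"
proof -
  obtain r where r: "0 < r" "\<And>x. r < norm x \<Longrightarrow> phi x = 0"
    and phi: "phi \<in> borel_measurable borel" "\<And>x. phi (- x) = phi x" "\<And>x. 0 \<le> phi x"
    using assms(1) unfolding finite_range_repulsive_def by blast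
  obtain \<alpha> \<beta> where ab: "0 < \<alpha>" "0 < \<beta>"
    and ssm: "\<And>\<Lambda> lam lam'. \<Lambda> \<in> sets lborel \<and> bounded \<Lambda> \<and> activity_fn lmax lam \<and> activity_fn lmax lam' \<Longrightarrow>
     tv_dist (restrict_config \<Lambda> (gibbs phi lam)) (restrict_config \<Lambda> (gibbs phi lam'))
       \<le> \<alpha> * measure lborel \<Lambda> * exp (- \<beta> * setdist \<Lambda> {x. lam x \<noteq> lam' x})"
    using assms(2) unfolding strong_spatial_mixing_def by blast
  let ?d = "DIM('a)"
  let ?V = "unit_ball_vol (real ?d)"
  obtain L0 where L0: "0 < L0" and radius: "\<And>L. L0 \<le> L \<Longrightarrow> 2 * real ?d < L \<and> (\<exists>R\<ge>0.
    (2 * (2 * R + 2) ^ ?d + 2 * (2 * L + 2) ^ ?d * (\<alpha> * (?V * L ^ ?d) * exp (- \<beta> * (R - r - real ?d))))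
      * (((L + r + real ?d) / (L - real ?d)) ^ ?d - 1) \<le> 1 / 2)"
    using block_radius_exists[of r \<alpha> \<beta> ?V ?d] r(1) ab by auto
  \<comment> \<open>The constant of \<open>contraction_steps\<close>. It depends on the dimension
    only and thus serves every block radius, box, activity and initial law.\<close>
  define C where "C = 2 + (2 * (ln 2 + real ?d * ln (3 / 2)) + 1) / ln (2::real)"
  have C: "0 < C" unfolding C_def by (intro add_pos_nonneg divide_nonneg_nonneg) auto
  show ?thesis
  proof (rule exI[of _ L0], rule conjI[OF L0], rule allI, rule impI)
    fix L assume "L0 \<le> L"
    then obtain R where L: "2 * real ?d < L" and R: "0 \<le> R"
      and small: "(2 * (2 * R + 2) ^ ?d + 2 * (2 * L + 2) ^ ?d * (\<alpha> * (?V * L ^ ?d) * exp (- \<beta> * (R - r - real ?d))))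
      * (((L + r + real ?d) / (L - real ?d)) ^ ?d - 1) \<le> 1 / 2"
      using radius by blast
    show "\<exists>C>0. \<forall>(n::nat) lam (\<epsilon>::real) (\<mu>0::'a list measure).
           n \<ge> 1 \<and> activity_fn lmax lam \<and> {x. lam x \<noteq> 0} \<subseteq> box_n n \<and> 0 < \<epsilon> \<and> \<epsilon> < 1
           \<and> prob_space \<mu>0 \<and> sets \<mu>0 = sets configM \<and> (AE X in \<mu>0. set X \<subseteq> box_n n) \<longrightarrow>
           (\<exists>j::nat. real j \<le> C * measure lborel (box_n n :: 'a set)
                                 * ln (measure lborel (box_n n :: 'a set) / \<epsilon>)
              \<and> tv_dist (chain_dist phi lam (box_n n) L \<mu>0 j) (gibbs phi lam) < \<epsilon>)"
    proof (rule exI[of _ C], rule conjI[OF C], intro allI impI, elim conjE)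
      fix n :: nat and lam :: "'a \<Rightarrow> real" and \<epsilon> :: real and \<mu>0 :: "'a list measure"
      assume n: "1 \<le> n" and lam: "activity_fn lmax lam" and supp: "{x. lam x \<noteq> 0} \<subseteq> box_n n"
        and \<epsilon>: "0 < \<epsilon>" "\<epsilon> < 1"
        and \<mu>0: "prob_space \<mu>0" "sets \<mu>0 = sets configM" "AE X in \<mu>0. set X \<subseteq> box_n n"
      let ?B = "box_n n :: 'a set"
      let ?N = "measure lborel ?B"
      have N: "2 \<le> ?N"
      proof -
        have "2 \<le> 2 * real n" using n by simp
        also have "\<dots> \<le> (2 * real n) ^ ?d" using n by (intro self_le_power) auto
        finally show ?thesis by (simp add: measure_box_n)
      qed
      interpret ssm_dyn phi r lam ?B L lmax \<alpha> \<beta> R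
      proof unfold_locales
        show "emeasure lborel ?B \<noteq> 0" using N by (auto simp: measure_def)
        show "emeasure lborel ?B \<noteq> \<infinity>"
          using emeasure_bounded_finite[of ?B] by (simp add: box_n_def)
        show "tv_dist (restrict_config \<Lambda> (gibbs phi lam1)) (restrict_config \<Lambda> (gibbs phi lam2))
          \<le> \<alpha> * measure lborel \<Lambda> * exp (- \<beta> * setdist \<Lambda> {x. lam1 x \<noteq> lam2 x})"
          if "\<Lambda> \<in> sets lborel" "bounded \<Lambda>" "activity_fn lmax lam1" "activity_fn lmax lam2" for \<Lambda> lam1 lam2
          using ssm that by blast
        show "real ?d < L" using L by (rule le_less_trans[rotated]) simp
      qed (use r phi ab lam supp R integrable_activity_if_activity_fn[OF lam] in \<open>auto simp: box_n_def\<close>)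
      have "mixing_error = \<alpha> * (?V * L ^ ?d) * exp (- \<beta> * (R - r - real ?d))"
        unfolding mixing_error_def using L_pos by (simp add: content_ball)
      then have small': "shell_bound * (((L + r + real ?d) / (L - real ?d)) ^ ?d - 1) \<le> 1 / 2"
        unfolding shell_bound_def using small by simp
      \<comment> \<open>\<open>L > 2 * d\<close> makes the inner radius \<open>L - d\<close> exceed
        \<open>d\<close>, enough for a unit cube that touches \<open>z\<close>.\<close>
      have vol: "1 \<le> measure lborel (ball z (L - real ?d) \<inter> ?B)" if "z \<in> ?B" for z
        using that n L by (intro measure_ball_box_ge_1) auto
      have cells: "finite (cell ` ?B)" "real (card (cell ` ?B)) \<le> (3 / 2) ^ ?d * ?N"
        using card_cell_box_n[OF n] by auto
      obtain j where j: "real j \<le> C * ?N * ln (?N / \<epsilon>)"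
        "2 * real (card (cell ` ?B)) * (1 - 1 / (2 * ?N)) ^ j < \<epsilon>"
        using contraction_steps[OF N \<epsilon> _ cells(2)] unfolding C_def by auto
      show "\<exists>j::nat. real j \<le> C * ?N * ln (?N / \<epsilon>)
          \<and> tv_dist (chain_dist phi lam ?B L \<mu>0 j) (gibbs phi lam) < \<epsilon>"
        using j tv_dist_chain_le[OF \<mu>0 cells(1) vol small', of j] by (intro exI[of _ j]) auto
    qed
  qed
qed

end
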